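(* Let $d\geq 1$. Let $\mu_{\mathrm B}=\mathcal N(m_{\mathrm B},\Sigma_{\mathrm B})$ be the Gaussian measure on $\mathbb R^d$ with arbitrary mean $m_{\mathrm B}\in\mathbb R^d$ and arbitrary symmetric positive definite covariance matrix $\Sigma_{\mathrm B}\in\mathbb R^{d\times d}$, and let $\rho_{\mathrm B}$ be its density with respect to Lebesgue measure. Let $\rho_*$ be any probability density on $\mathbb R^d$ such that, for some $M>0$ and $\sigma_\bullet>0$, $$\rho_*(x)\leq \frac{1}{(2\pi\sigma_\bullet^2)^{d/2}}\,e^{-\frac{\|x\|^2}{2\sigma_\bullet^2}}\qquad\text{for all }x\in\mathbb R^d\text{ with }\|x\|\geq M .$$ Then for any $T>0$ and any $\varepsilon>0$ there exists $\theta=(w,a,b):[0,T]\to\mathbb R^d\times\mathbb R^d\times\mathbb R$, piecewise constant with finitely many switches, such that the solution $\rho$ of $$\partial_t\rho(t,x)+\mathrm{div}_x\Big(w(t)\big(a(t)^\top x+b(t)\big)_+\,\rho(t,x)\Big)=0\ \text{ in }[0,T]\times\mathbb R^d,\qquad \rho(0,\cdot)=\rho_{\mathrm B},$$ satisfies $$\int_{\mathbb R^d}\rho_*(x)\log\frac{\rho_*(x)}{\rho(T,x)}\,\mathrm dx\leq\varepsilon .$$ Equivalently, $\mathsf{KL}\big(\mu_*\,\|\,\Phi^T_{\theta\#}\mu_{\mathrm B}\big)\leq\varepsilon$, where $\mu_*$ is the measure with density $\rho_*$ and $\Phi^T_\theta:\mathbb R^d\to\mathbb R^d$ is the time-$T$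 flow map of $\dot x(t)=w(t)\big(a(t)^\top x(t)+b(t)\big)_+$.
   Context: Here $(s)_+=\max\{s,0\}$. For piecewise constant $\theta=(w,a,b)$, the Cauchy problem $\dot x(t)=w(t)(a(t)^\top x(t)+b(t))_+$, $x(0)=x$, has a unique solution on $[0,T]$, and the flow map is $\Phi^t_\theta(x)=x(t)$. The solution $\rho$ of the continuity equation is the one given by the method of characteristics, i.e. $\rho(t,\cdot)$ is the density of the pushforward $\Phi^t_{\theta\#}\mu_{\mathrm B}$, where $\mathsf T_\#\mu(A)=\mu(\mathsf T^{-1}(A))$. A switch of a piecewise constant function is a point of discontinuity. For measures $\mu_2,\mu_1$ with Lebesgue densities $\rho_2,\rho_1$, the Kullback–Leibler divergence (relative entropy) is $\mathsf{KL}(\mu_2\,\|\,\mu_1)=\int\rho_2\log\frac{\rho_2}{\rho_1}\,\mathrm dx$.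
   Formalization: The formal theorem additionally assumes that ρ_* log ρ_* is Lebesgue integrable; without this the divergence is +∞ for every θ, since ρ(T,·) is bounded (e.g. d=1, ρ_*(x)=c/(x log² x) near 0). *)

theory Defs
  imports "HOL-Probability.Probability"
begin

definition gaussian_density :: "real^'n \<Rightarrow> real^'n^'n \<Rightarrow> real^'n \<Rightarrow> real" where
  "gaussian_density m \<Sigma> x =
     exp (- ((x - m) \<bullet> (matrix_inv \<Sigma> *v (x - m))) / 2) / sqrt ((2 * pi) ^ CARD('n) * det \<Sigma>)"

definition probability_density :: "(real^'n \<Rightarrow> real) \<Rightarrow> bool" where
  "probability_density f \<longleftrightarrow>
     f \<in> borel_measurable borel \<and> (\<forall>x. 0 \<le> f x) \<and> (\<integral>\<^sup>+x. ennreal (f x) \<partial>lborel) = 1"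

definition switches :: "real \<Rightarrow> (real \<Rightarrow> 'a::topological_space) \<Rightarrow> real set" where
  "switches T f = {t \<in> {0..T}. \<not> continuous (at t within {0..T}) f}"

(* Constant on every subinterval free of switches, i.e. on each of the finitely many
   components of the complement of the switches in [0,T]; the values at the switches
   themselves are arbitrary. *)
definition piecewise_constant_finite_switches ::
    "real \<Rightarrow> (real \<Rightarrow> 'a::topological_space) \<Rightarrow> bool" where
  "piecewise_constant_finite_switches T f \<longleftrightarrow>
     finite (switches T f) \<and>
     (\<forall>s\<in>{0..T}. \<forall>t\<in>{0..T}. s \<le> t \<and> {s..t} \<inter> switches T f = {} \<longrightarrow> f s = f t)"

(* Solutions of x' = w (a . x + b)_+ with x(0) = x0 on [0,T]: continuous curves satisfying
   the equation except at the switches of the control, where x need not be differentiable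
   (at the end points of [0,T] the derivative is one-sided). *)
definition solves_ode ::
    "real \<Rightarrow> (real \<Rightarrow> real^'n) \<Rightarrow> (real \<Rightarrow> real^'n) \<Rightarrow> (real \<Rightarrow> real) \<Rightarrow> real^'n \<Rightarrow>
     (real \<Rightarrow> real^'n) \<Rightarrow> bool" where
  "solves_ode T w a b x0 x \<longleftrightarrow>
     continuous_on {0..T} x \<and> x 0 = x0 \<and>
     (\<forall>t \<in> {0..T} - switches T (\<lambda>s. (w s, a s, b s)).
        (x has_vector_derivative (max (a t \<bullet> x t + b t) 0 *\<^sub>R w t)) (at t within {0..T}))"

(* The value at time t of the solution started at x0. For piecewise constant controls with
   finitely many switches the solution on [0,T] exists and is unique, so for t in [0,T] the
   description is proper. *)
definition flow_map ::
    "real \<Rightarrow> (real \<Rightarrow> real^'n) \<Rightarrow> (real \<Rightarrow> real^'n) \<Rightarrow> (real \<Rightarrow> real) \<Rightarrow> real \<Rightarrow>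
     real^'n \<Rightarrow> real^'n" where
  "flow_map T w a b t x0 = (THE y. \<exists>x. solves_ode T w a b x0 x \<and> y = x t)"

(* The solution, by the method of characteristics, of the continuity equation with velocity
   w(t) (a(t) . x + b(t))_+ and initial density rho0. The density at time t > 0 is determined
   up to a Lebesgue null set. *)
definition characteristics_solution ::
    "real \<Rightarrow> (real \<Rightarrow> real^'n) \<Rightarrow> (real \<Rightarrow> real^'n) \<Rightarrow> (real \<Rightarrow> real) \<Rightarrow>
     (real^'n \<Rightarrow> real) \<Rightarrow> (real \<Rightarrow> real^'n \<Rightarrow> real) \<Rightarrow> bool" where
  "characteristics_solution T w a b \<rho>0 \<rho> \<longleftrightarrow>
     \<rho> 0 = \<rho>0 \<and>
     (\<forall>t\<in>{0..T}. probability_density (\<rho> t) \<and>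
        distr (density lborel \<rho>0) lborel (flow_map T w a b t) = density lborel (\<rho> t))"

(* Hypothesis on the target density f: integrability of f ln f. Flows of piecewise constant
   controls are bi-Lipschitz, so they push a Gaussian to a bounded density; hence the relative
   entropy of f is infinite for every control unless f ln f is integrable. A Gaussian tail
   bound on f leaves this condition open only on a ball. *)

end

theory Submission
  imports Defs
begin

text \<open>The target is first approximated, in relative entropy, by a finite mixture
  \<open>\<Sum>u\<in>I. wt u * N(u, s\<^sup>2 \<Sigma>\<^sub>B)\<close>: a lower semicontinuous majorant of the target density is smoothed with
  the kernel, the mixing measure is discretised, and Fatou's lemma controls the entropy from above.
  After a scaling, which is itself a flow of piecewise constant controls, the Gaussian and the
  mixture are the end points of the path of mixtures \<open>\<Sum>u\<in>I. wt u * N(z + t u, s\<^sup>2 \<Sigma>\<^sub>B)\<close> with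
  \<open>0 \<le> t \<le> 1\<close>, which is transported by a bounded smooth velocity field.

  On a short time step this field is approximated by a trigonometric polynomial field, a
  superposition of ridge fields \<open>f (a \<bullet> x) w\<close>, and each ridge field by a composition of flows of
  \<open>x' = w (a \<bullet> x + b)\<^sub>+\<close>. These flows are explicit piecewise linear homeomorphisms, so all Jacobians
  are explicit; components of \<open>w\<close> along \<open>a\<close> produce the divergence. The error made in one step of
  length \<open>h\<close> is amplified through the Donsker--Varadhan inequality by at most \<open>exp h\<close> and adds a
  term \<open>o(h)\<close>, so over the unit time interval the entropy of the target relative to the transported Gaussian
  is at most \<open>exp 1\<close> times its entropy relative to the mixture, up to an arbitrarily small error.\<close>

section \<open>Piecewise linear flows and their Jacobians\<close>

text \<open>The target may be unbounded and may vanish, so nothing about it can enter the error of a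
  time step except its entropy. This fixes the form of the step: with step length \<open>h\<close>,
  the integral of \<open>\<nu> ln (\<rho> / \<rho>')\<close> is at most \<open>h\<close> times the
  entropy of \<open>\<nu>\<close> relative to \<open>\<rho>\<close> plus a term with the exponential
  moment of \<open>ln (\<rho> / \<rho>') / h\<close> under the explicit density
  \<open>\<rho>\<close>, and only this moment has to be close to 1. Exponential moments need control
  on all of space, so a field that is accurate on a ball and grows outside it is useless. Hence the
  mixture shares the base covariance up to scale, which makes the velocity bounded, and the
  approximants are superpositions of sines, bounded everywhere. Pointwise convergence then suffices,
  since Gaussian tails supply the dominating functions. No rates are tracked: short steps are glued
  by bisection of the time interval, and the targets that arise in between are arbitrary densities.
  All maps are treated as inverses \<open>\<Psi>\<close> of flows, because the transported density
  at \<open>x\<close> is \<open>\<rho> (\<Psi> x) * J x\<close>.\<close>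

lemma det_rank_one_update:
  fixes a w :: "real^'n"
  shows "det (matrix (\<lambda>x. x + (a \<bullet> x) *\<^sub>R w)) = 1 + a \<bullet> w"
proof (cases "a = 0")
  case True
  have "matrix (\<lambda>x::real^'n. x) = mat 1"
    by (auto simp: matrix_def mat_def axis_def vec_eq_iff)
  with True show ?thesis by simp
next
  case False
  then obtain k where k: "a $ k \<noteq> 0" by (auto simp: vec_eq_iff)
  \<comment> \<open>\<open>M\<close> is the identity with row \<open>k\<close> replaced by
    \<open>a\<close>, so it turns \<open>a \<bullet> x\<close> into coordinate \<open>k\<close>. It
    conjugates the map to \<open>x + x $ k *\<^sub>R z\<close> with \<open>z = M *v w\<close>, whose
    matrix \<open>R\<close> differs from the identity only in column \<open>k\<close>; Cramer's
    lemma reads off its determinant.\<close>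
  define M :: "real^'n^'n" where "M = (\<chi> i. if i = k then a else axis i 1)"
  define z where "z = M *v w"
  define R :: "real^'n^'n" where "R = (\<chi> i j. if j = k then (axis k 1 + z) $ i else mat 1 $ i $ j)"
  have Mt: "transpose M = (\<chi> i j. if j = k then (mat 1 *v a) $ i else mat 1 $ i $ j)"
    by (simp add: M_def transpose_def vec_eq_iff) (auto simp: mat_def axis_def)
  have "det (transpose M) = a $ k * det (mat 1 :: real^'n^'n)"
    unfolding Mt by (rule cramer_lemma)
  then have detM: "det M = a $ k" by simp
  have "det R = (axis k 1 + z) $ k"
    using cramer_lemma[where A="mat 1" and k=k and x="axis k 1 + z", unfolded matrix_vector_mul_lid] by (simp add: R_def)
  moreover have Mk: "z $ k = a \<bullet> w"
    by (simp add: z_def M_def matrix_vector_mult_def inner_vec_def)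
  ultimately have detR: "det R = 1 + a \<bullet> w" by simp
  have lin: "linear (\<lambda>x. x + (a \<bullet> x) *\<^sub>R w)"
    by (auto intro!: linearI simp: algebra_simps inner_right_distrib)
  have Rv: "R *v x = x + x $ k *\<^sub>R z" for x
  proof (simp add: vec_eq_iff, intro allI)
    fix i
    have "(R *v x) $ i = (\<Sum>j\<in>UNIV. (if j = i then x $ i else 0) + (if j = k then z $ i * x $ k else 0))"
      unfolding R_def matrix_vector_mult_def
      by (simp, intro sum.cong) (auto simp: mat_def axis_def algebra_simps)
    then show "(R *v x) $ i = x $ i + x $ k * z $ i"
      by (simp add: sum.distrib)
  qed
  have Mxk: "(M *v x) $ k = a \<bullet> x" for x
    by (simp add: M_def matrix_vector_mult_def inner_vec_def)
  have "M ** matrix (\<lambda>x. x + (a \<bullet> x) *\<^sub>R w) = R ** M"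
  proof (subst matrix_eq, intro allI)
    fix x
    show "(M ** matrix (\<lambda>x. x + (a \<bullet> x) *\<^sub>R w)) *v x = (R ** M) *v x"
      by (simp add: matrix_vector_mul_assoc[symmetric] matrix_vector_mul(2)[OF lin, THEN fun_cong] Rv Mxk
           z_def matrix_vector_right_distrib matrix_vector_mult_scaleR del: matrix_vector_mul_assoc)
  qed
  then have "det M * det (matrix (\<lambda>x. x + (a \<bullet> x) *\<^sub>R w)) = det R * det M"
    by (metis det_mul)
  with k show ?thesis by (simp add: detM detR)
qed

section \<open>Change of variables under linear maps\<close>

lemma linear_measurable_borel:
  fixes L :: "'a::euclidean_space \<Rightarrow> 'b::euclidean_space"
  shows "linear L \<Longrightarrow> L \<in> borel_measurable borel"
  by (simp add: borel_measurable_continuous_onI linear_continuous_on linear_conv_bounded_linear)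

text \<open>The preimage of a box under the inverse \<open>f'\<close> is its image under the shear,
  whose volume is known. So \<open>f'\<close> preserves Lebesgue measure, and applying
  \<open>f\<close> to this gives the claim.\<close>

lemma distr_lborel_shear:
  fixes m n :: "'n::finite"
  assumes mn: "m \<noteq> n"
  shows "distr lborel borel (\<lambda>x::real^'n. \<chi> i. if i = m then x$m + x$n else x$i) = lborel"
proof -
  define f where "f = (\<lambda>x::real^'n. \<chi> i. if i = m then x$m + x$n else x$i)"
  define f' where "f' = (\<lambda>x::real^'n. \<chi> i. if i = m then x$m - x$n else x$i)"
  have lin: "linear f" "linear f'"
    by (auto intro!: linearI simp: f_def f'_def vec_eq_iff algebra_simps)
  have inv: "f (f' x) = x" "f' (f x) = x" for x
    using mn by (auto simp: f_def f'_def vec_eq_iff)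
  note [measurable] = lin[THEN linear_measurable_borel]
  have "lborel = distr lborel borel f'"
  proof (rule lborel_eqI)
    fix l u :: "real^'n" assume le: "\<And>b. b \<in> Basis \<Longrightarrow> l \<bullet> b \<le> u \<bullet> b"
    \<comment> \<open>The volume formula for a sheared box asks for nonnegative values of coordinate
      \<open>n\<close>; moving the corner \<open>l\<close> to the origin ensures this.\<close>
    have ne: "cbox 0 (u - l) \<noteq> {}" using le by (simp add: box_ne_empty inner_diff_left)
    have sh: "f ` cbox 0 (u - l) \<in> lmeasurable" "measure lebesgue (f ` cbox 0 (u - l)) = measure lebesgue (cbox 0 (u - l))"
      unfolding f_def using measurable_shear_interval[OF mn ne] measure_shear_interval[OF mn ne] by auto
    have "cbox l u = (+) l ` cbox 0 (u - l)" by (simp add: cbox_translation[symmetric])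
    then have im: "f ` cbox l u = (+) (f l) ` (f ` cbox 0 (u - l))"
      by (simp add: image_image linear_add[OF lin(1)])
    \<comment> \<open>\<open>lborel_eqI\<close> tests open boxes and the volume formula treats
      closed ones; the linear image of the boundary is negligible.\<close>
    have neg: "negligible (f ` (cbox l u - box l u))"
      by (rule negligible_differentiable_image_negligible)
        (auto simp: negligible_frontier_interval lin linear_imp_differentiable_on)
    have split: "f ` cbox l u = f ` box l u \<union> f ` (cbox l u - box l u)"
      using box_subset_cbox[of l u] by auto
    have pre: "f' -` box l u = f ` box l u"
      by (auto simp: inv image_iff) (metis inv(1))
    have op: "open (f ` box l u)" unfolding pre[symmetric]
      using lin(2) by (metis linear_conv_bounded_linear linear_continuous_on open_box open_vimage)
    have "f ` cbox l u \<in> lmeasurable" unfolding im using sh(1) by (rule measurable_translation)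
    then have lm: "f ` box l u \<in> lmeasurable"
      using op by (rule_tac fmeasurableI2[of "f ` cbox l u"]) (auto simp: split)
    have "measure lebesgue (f ` box l u) = measure lebesgue (f ` cbox l u)"
    proof (rule measure_negligible_symdiff[symmetric])
      show "f ` box l u \<in> lmeasurable" by (rule lm)
      show "negligible ((f ` box l u - f ` cbox l u) \<union> (f ` cbox l u - f ` box l u))"
        by (rule negligible_subset[OF neg]) (auto simp: split)
    qed
    also have "\<dots> = measure lebesgue (cbox 0 (u - l))"
      unfolding im by (simp add: measure_translation sh)
    also have "\<dots> = (\<Prod>b\<in>Basis. (u - l) \<bullet> b)"
      using le by (simp add: inner_diff_left)
    finally have "emeasure lebesgue (f ` box l u) = ennreal (\<Prod>b\<in>Basis. (u - l) \<bullet> b)"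
      using lm by (simp add: emeasure_eq_measure2)
    then show "emeasure (distr lborel borel f') (box l u) = ennreal (\<Prod>b\<in>Basis. (u - l) \<bullet> b)"
      using op by (simp add: emeasure_distr pre)
  qed simp
  then have "distr lborel borel f = distr (distr lborel borel f') borel f" by simp
  also have "\<dots> = lborel" by (subst distr_distr) (simp_all add: o_def inv distr_id2)
  finally show ?thesis by (simp add: f_def)
qed

lemma distr_lborel_transpose:
  fixes m n :: "'n::finite"
  shows "distr lborel borel (\<lambda>x::real^'n. \<chi> i. x $ Transposition.transpose m n i) = lborel"
proof (rule lborel_eqI[symmetric])
  let ?h = "\<lambda>v::real^'n. \<chi> i. v $ Transposition.transpose m n i"
  have lin: "linear ?h"
    by (rule linearI) (simp_all add: plus_vec_def scaleR_vec_def)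
  note [measurable] = linear_measurable_borel[OF lin]
  fix l u :: "real^'n" assume le: "\<And>b. b \<in> Basis \<Longrightarrow> l \<bullet> b \<le> u \<bullet> b"
  have pre: "?h -` box l u = box (?h l) (?h u)"
    by (auto simp: mem_box_cart) (metis transpose_involutory)+
  have le': "l $ i \<le> u $ i" for i using le[of "axis i 1"] by (auto simp: inner_axis Basis_vec_def)
  have "emeasure (distr lborel borel ?h) (box l u) = emeasure lborel (box (?h l) (?h u))"
    by (simp add: emeasure_distr pre)
  also have "\<dots> = emeasure lborel (cbox (?h l) (?h u))"
    by (simp add: emeasure_lborel_box_eq emeasure_lborel_cbox_eq)
  also have "\<dots> = ennreal (measure lborel (cbox (?h l) (?h u)))"
    by (rule emeasure_eq_ennreal_measure) (metis emeasure_lborel_cbox_finite less_irrefl infinity_ennreal_def)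
  also have "measure lborel (cbox (?h l) (?h u)) = measure lborel (cbox l u)"
  proof -
    have "cbox l u \<noteq> {}" "cbox (?h l) (?h u) \<noteq> {}"
      using le' by (simp_all add: interval_ne_empty_cart)
    then show ?thesis
      using prod.permute [OF permutes_swap_id[of m UNIV n], where g="\<lambda>i. u$i - l$i"]
      by (simp add: content_cbox_cart o_def)
  qed
  finally show "emeasure (distr lborel borel ?h) (box l u) = ennreal (\<Prod>b\<in>Basis. (u - l) \<bullet> b)"
    using le by (simp add: inner_diff_left)
qed simp

text \<open>Every linear map is composed of diagonal maps, coordinate swaps, shears and maps that
  kill a coordinate. The determinant condition sits inside the predicate \<open>P\<close>, so the
  last kind is vacuous, and a nonsingular composition has nonsingular factors.\<close>

lemma nn_integral_lborel_linear:
  fixes L :: "real^'n \<Rightarrow> real^'n"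
  assumes "linear L" and "det (matrix L) \<noteq> 0" and "h \<in> borel_measurable borel"
  shows "(\<integral>\<^sup>+x. h (L x) * ennreal \<bar>det (matrix L)\<bar> \<partial>lborel) = (\<integral>\<^sup>+x. h x \<partial>lborel)"
proof -
  define P where "P f \<longleftrightarrow> (det (matrix f) \<noteq> 0 \<longrightarrow> (\<forall>h\<in>borel_measurable borel.
     (\<integral>\<^sup>+x. h (f x) * ennreal \<bar>det (matrix f)\<bar> \<partial>lborel) = (\<integral>\<^sup>+x. h x \<partial>lborel)))" for f :: "real^'n \<Rightarrow> real^'n"
  have unimodular: "P f" if "linear f" "distr lborel borel f = lborel" "\<bar>det (matrix f)\<bar> = 1" for f
    unfolding P_def
  proof (intro impI ballI)
    fix h :: "real^'n \<Rightarrow> ennreal" assume [measurable]: "h \<in> borel_measurable borel"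
    note [measurable] = linear_measurable_borel[OF that(1)]
    show "(\<integral>\<^sup>+x. h (f x) * ennreal \<bar>det (matrix f)\<bar> \<partial>lborel) = (\<integral>\<^sup>+x. h x \<partial>lborel)"
      by (subst (2) that(2)[symmetric]) (simp add: nn_integral_distr that(3))
  qed
  have "P L"
  proof (rule induct_linear_elementary[OF \<open>linear L\<close>])
    fix f g :: "real^'n \<Rightarrow> real^'n" assume lin: "linear f" "linear g" and Pf: "P f" and Pg: "P g"
    note [measurable] = lin[THEN linear_measurable_borel]
    have det: "det (matrix (f \<circ> g)) = det (matrix f) * det (matrix g)"
      by (simp add: matrix_compose lin det_mul)
    show "P (f \<circ> g)"
      unfolding P_def
    proof (intro impI ballI)
      assume d: "det (matrix (f \<circ> g)) \<noteq> 0"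
      fix h :: "real^'n \<Rightarrow> ennreal" assume [measurable]: "h \<in> borel_measurable borel"
      have "(\<integral>\<^sup>+x. h ((f \<circ> g) x) * ennreal \<bar>det (matrix (f \<circ> g))\<bar> \<partial>lborel)
        = (\<integral>\<^sup>+x. (\<lambda>y. h (f y) * ennreal \<bar>det (matrix f)\<bar>) (g x) * ennreal \<bar>det (matrix g)\<bar> \<partial>lborel)"
        by (intro nn_integral_cong) (simp add: det abs_mult ennreal_mult' mult.assoc)
      also have "\<dots> = (\<integral>\<^sup>+x. h (f x) * ennreal \<bar>det (matrix f)\<bar> \<partial>lborel)"
        using Pg d det unfolding P_def by (intro Pg[unfolded P_def, rule_format]) auto
      also have "\<dots> = (\<integral>\<^sup>+x. h x \<partial>lborel)"
        using Pf d det unfolding P_def by auto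
      finally show "(\<integral>\<^sup>+x. h ((f \<circ> g) x) * ennreal \<bar>det (matrix (f \<circ> g))\<bar> \<partial>lborel) = (\<integral>\<^sup>+x. h x \<partial>lborel)" .
    qed
  next
    fix f :: "real^'n \<Rightarrow> real^'n" and i assume "linear f" and "\<And>x. f x $ i = 0"
    then have "\<not> inj f"
      by (metis (full_types) linear_injective_imp_surjective one_neq_zero surjE vec_component)
    then show "P f" using det_nz_iff_inj[OF \<open>linear f\<close>] by (simp add: P_def)
  next
    fix c :: "'n \<Rightarrow> real"
    let ?f = "\<lambda>x::real^'n. \<chi> i. c i * x$i"
    have lin: "linear ?f" by (auto intro!: linearI simp: vec_eq_iff algebra_simps)
    have det: "det (matrix ?f) = prod c UNIV"
      by (simp add: axis_def matrix_def det_diagonal)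
    have B: "(Basis :: (real^'n) set) = range (\<lambda>i. axis i 1)" by (auto simp: Basis_vec_def)
    have "(\<Sum>j\<in>Basis. (c (axis_index j) * (x \<bullet> j)) *\<^sub>R j) = (\<Sum>i\<in>UNIV. (c i * x $ i) *\<^sub>R axis i 1)" for x :: "real^'n"
      by (simp add: B sum.reindex inj_on_def axis_eq_axis axis_index_axis inner_axis)
    then have T: "?f = (\<lambda>x. 0 + (\<Sum>j\<in>Basis. (c (axis_index j) * (x \<bullet> j)) *\<^sub>R j))"
      by (auto simp: fun_eq_iff vec_eq_iff axis_def if_distrib cong: if_cong)
    have p: "(\<Prod>j\<in>Basis. \<bar>c (axis_index (j::real^'n))\<bar>) = \<bar>prod c UNIV\<bar>"
      by (simp add: B prod.reindex inj_on_def axis_eq_axis axis_index_axis abs_prod)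
    show "P ?f"
      unfolding P_def det
    proof (intro impI ballI)
      assume c: "prod c UNIV \<noteq> 0"
      fix h :: "real^'n \<Rightarrow> ennreal" assume [measurable]: "h \<in> borel_measurable borel"
      note [measurable] = linear_measurable_borel[OF lin]
      have "lborel = density (distr lborel borel ?f) (\<lambda>_. ennreal (\<Prod>j\<in>Basis. \<bar>c (axis_index (j::real^'n))\<bar>))"
        unfolding T by (rule lborel_affine_euclidean) (use c in auto)
      then have *: "lborel = density (distr lborel borel ?f) (\<lambda>_. ennreal \<bar>prod c UNIV\<bar>)"
        unfolding p .
      show "(\<integral>\<^sup>+x. h (?f x) * ennreal \<bar>prod c UNIV\<bar> \<partial>lborel) = (\<integral>\<^sup>+x. h x \<partial>lborel)"
        by (subst (2) *) (simp add: nn_integral_density nn_integral_distr mult.commute)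
    qed
  next
    fix m n :: 'n assume mn: "m \<noteq> n"
    let ?h = "\<lambda>x::real^'n. \<chi> i. x $ Transposition.transpose m n i"
    have lin: "linear ?h"
      by (rule linearI) (simp_all add: plus_vec_def scaleR_vec_def)
    have hh: "?h \<circ> ?h = id" by (auto simp: fun_eq_iff vec_eq_iff)
    \<comment> \<open>A swap is an involution, so its determinant squares to 1.\<close>
    have "det (matrix ?h) * det (matrix ?h) = det (matrix (id :: real^'n \<Rightarrow> _))"
      using matrix_compose[OF lin lin] by (simp add: hh det_mul)
    then have "\<bar>det (matrix ?h)\<bar> = 1"
      by (simp add: matrix_id_mat_1) (metis abs_1 abs_mult_self_eq abs_square_eq_1 power2_eq_square)
    then show "P ?h" by (intro unimodular lin distr_lborel_transpose)
  next
    fix m n :: 'n assume mn: "m \<noteq> n"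
    let ?h = "\<lambda>x::real^'n. \<chi> i. if i = m then x$m + x$n else x$i"
    have h: "?h = (\<lambda>x. x + (axis n 1 \<bullet> x) *\<^sub>R axis m 1)"
      by (simp add: fun_eq_iff vec_eq_iff inner_axis') (auto simp: axis_def)
    have "linear ?h" by (auto intro!: linearI simp: vec_eq_iff algebra_simps)
    moreover have "\<bar>det (matrix ?h)\<bar> = 1"
      unfolding h det_rank_one_update using mn by (simp add: inner_axis_axis)
    ultimately show "P ?h" by (intro unimodular distr_lborel_shear mn)
  qed
  then show ?thesis using assms by (simp add: P_def)
qed

lemma nn_integral_lborel_shift:
  fixes c :: "'a::euclidean_space"
  assumes [measurable]: "f \<in> borel_measurable borel"
  shows "(\<integral>\<^sup>+x. f (x + c) \<partial>lborel) = (\<integral>\<^sup>+x. f x \<partial>lborel)"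
  by (subst (2) lborel_distr_plus[of c, symmetric]) (simp add: nn_integral_distr add.commute)

section \<open>Elementary maps and their compositions\<close>

text \<open>The flow of a constant control at a fixed time has this form. It is the identity where
  \<open>a \<bullet> x + b \<le> 0\<close>, and on the complement it is affine and multiplies
  \<open>a \<bullet> x + b\<close> by \<open>1 + a \<bullet> w\<close>; positivity of this factor
  makes it a homeomorphism.\<close>

definition el :: "real^'n \<Rightarrow> real^'n \<Rightarrow> real \<Rightarrow> real^'n \<Rightarrow> real^'n" where
  "el w a b x = x + max (a \<bullet> x + b) 0 *\<^sub>R w"

definition el_jac :: "real^'n \<Rightarrow> real^'n \<Rightarrow> real \<Rightarrow> real^'n \<Rightarrow> real" where
  "el_jac w a b x = (if a \<bullet> x + b > 0 then 1 + a \<bullet> w else 1)"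

lemma el_measurable [measurable]: "el w a b \<in> borel_measurable borel"
  unfolding el_def[abs_def] by measurable

lemma el_jac_measurable [measurable]: "el_jac w a b \<in> borel_measurable borel"
  unfolding el_jac_def[abs_def] by measurable

text \<open>Both half spaces are preserved, since \<open>a \<bullet> x + b\<close> is fixed on one
  and multiplied by a positive factor on the other. So the inverse has the same form and moves back
  by the new value of \<open>a \<bullet> x + b\<close> divided by this factor.\<close>

lemma el_inverse:
  assumes "1 + a \<bullet> w > 0"
  shows "el w a b (el ((- 1 / (1 + a \<bullet> w)) *\<^sub>R w) a b x) = x"
    and "el ((- 1 / (1 + a \<bullet> w)) *\<^sub>R w) a b (el w a b x) = x"
proof -
  define s where "s = a \<bullet> x + b"
  define k where "k = a \<bullet> w"
  have k: "1 + k > 0" using assms by (simp add: k_def)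
  have 1: "a \<bullet> el w' a b x + b = s + max s 0 * (a \<bullet> w')" for w'
    by (simp add: el_def s_def inner_right_distrib)
  have "max (s + max s 0 * (-1 / (1 + k) * k)) 0 = max s 0 / (1 + k)"
    using k by (cases "s > 0") (auto simp: max_def field_simps)
  then have "el w a b (el ((- 1 / (1 + a \<bullet> w)) *\<^sub>R w) a b x)
     = el ((- 1 / (1 + a \<bullet> w)) *\<^sub>R w) a b x + (max s 0 / (1 + k)) *\<^sub>R w"
    unfolding el_def[of w a b "el _ _ _ _"] by (simp add: 1 k_def)
  then show "el w a b (el ((- 1 / (1 + a \<bullet> w)) *\<^sub>R w) a b x) = x"
    by (simp add: el_def s_def k_def)
  have "max (s + max s 0 * k) 0 = max s 0 * (1 + k)"
  proof (cases "s > 0")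
    case True
    then have "s + s * k = s * (1 + k)" by (simp add: algebra_simps)
    moreover have "s * (1 + k) > 0" using True k by simp
    ultimately show ?thesis using True by (simp add: max_def)
  qed auto
  then have "el ((- 1 / (1 + a \<bullet> w)) *\<^sub>R w) a b (el w a b x)
     = el w a b x - ((max s 0 * (1 + k)) / (1 + k)) *\<^sub>R w"
    unfolding el_def[of "_ *\<^sub>R w" a b "el _ _ _ _"] by (simp add: 1 k_def)
  then show "el ((- 1 / (1 + a \<bullet> w)) *\<^sub>R w) a b (el w a b x) = x"
    using k by (simp add: el_def s_def)
qed

text \<open>On the open half space the map is \<open>L\<close> followed by the translation by
  \<open>b *\<^sub>R w\<close>. Since both half spaces are invariant, the two parts of
  \<open>f\<close> are substituted separately; \<open>g\<close> is the part on the open one.\<close>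

lemma nn_integral_el:
  assumes w: "1 + a \<bullet> w > 0" and [measurable]: "f \<in> borel_measurable borel"
  shows "(\<integral>\<^sup>+x. f (el w a b x) * ennreal (el_jac w a b x) \<partial>lborel) = (\<integral>\<^sup>+x. f x \<partial>lborel)"
proof -
  define k where "k = a \<bullet> w"
  define L where "L = (\<lambda>x. x + (a \<bullet> x) *\<^sub>R w)"
  have lin: "linear L"
    by (auto intro!: linearI simp: L_def algebra_simps inner_right_distrib)
  have det: "det (matrix L) = 1 + k" unfolding L_def k_def by (rule det_rank_one_update)
  have k: "1 + k > 0" using w by (simp add: k_def)
  define g where "g y = f y * indicator {y. a \<bullet> y + b > 0} y" for y
  have gm [measurable]: "g \<in> borel_measurable borel" unfolding g_def[abs_def] by measurable
  have [measurable]: "L \<in> borel_measurable borel" unfolding L_def by measurable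
  have pos: "a \<bullet> (x + (a \<bullet> x + b) *\<^sub>R w) + b > 0 \<longleftrightarrow> a \<bullet> x + b > 0" for x
  proof -
    have "a \<bullet> (x + (a \<bullet> x + b) *\<^sub>R w) + b = (a \<bullet> x + b) * (1 + k)"
      by (simp add: inner_right_distrib k_def algebra_simps)
    then show ?thesis using k by (simp add: zero_less_mult_iff)
  qed
  have "(\<integral>\<^sup>+x. f (el w a b x) * ennreal (el_jac w a b x) \<partial>lborel)
     = (\<integral>\<^sup>+x. f x * indicator {y. \<not> a \<bullet> y + b > 0} x + g (L x + b *\<^sub>R w) * ennreal (1 + k) \<partial>lborel)"
  proof (intro nn_integral_cong)
    fix x
    have "L x + b *\<^sub>R w = x + (a \<bullet> x + b) *\<^sub>R w" by (simp add: L_def algebra_simps)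
    then show "f (el w a b x) * ennreal (el_jac w a b x)
      = f x * indicator {y. \<not> a \<bullet> y + b > 0} x + g (L x + b *\<^sub>R w) * ennreal (1 + k)"
      using pos[of x] by (auto simp: el_def el_jac_def g_def k_def max_def)
  qed
  also have "\<dots> = (\<integral>\<^sup>+x. f x * indicator {y. \<not> a \<bullet> y + b > 0} x \<partial>lborel) + (\<integral>\<^sup>+x. g (L x + b *\<^sub>R w) * ennreal (1 + k) \<partial>lborel)"
    by (rule nn_integral_add) auto
  also have "(\<integral>\<^sup>+x. g (L x + b *\<^sub>R w) * ennreal (1 + k) \<partial>lborel) = (\<integral>\<^sup>+x. g (x + b *\<^sub>R w) \<partial>lborel)"
    using nn_integral_lborel_linear[OF lin, of "\<lambda>x. g (x + b *\<^sub>R w)"] det k by simp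
  also have "\<dots> = (\<integral>\<^sup>+x. g x \<partial>lborel)" by (rule nn_integral_lborel_shift) measurable
  also have "(\<integral>\<^sup>+x. f x * indicator {y. \<not> a \<bullet> y + b > 0} x \<partial>lborel) + (\<integral>\<^sup>+x. g x \<partial>lborel)
     = (\<integral>\<^sup>+x. f x * indicator {y. \<not> a \<bullet> y + b > 0} x + g x \<partial>lborel)"
    by (rule nn_integral_add[symmetric]) auto
  also have "\<dots> = (\<integral>\<^sup>+x. f x \<partial>lborel)"
    by (intro nn_integral_cong) (auto simp: g_def split: split_indicator)
  finally show ?thesis .
qed

text \<open>\<open>\<Psi>\<close> stands for the inverse of a flow map. The Jacobian
  \<open>J\<close> is carried along by the chain rule instead of being derived from
  \<open>\<Psi>\<close>, which has no derivative on the kinks. A new elementary map is applied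
  first, before \<open>\<Psi>\<close>.\<close>

inductive pl :: "(real^'n \<Rightarrow> real^'n) \<Rightarrow> (real^'n \<Rightarrow> real) \<Rightarrow> bool" where
  pl_id: "pl (\<lambda>x. x) (\<lambda>_. 1)"
| pl_step: "pl \<Psi> J \<Longrightarrow> 1 + a \<bullet> w > 0 \<Longrightarrow>
    pl (\<lambda>x. \<Psi> (el w a b x)) (\<lambda>x. J (el w a b x) * el_jac w a b x)"

lemma pl_el: "1 + a \<bullet> w > 0 \<Longrightarrow> pl (el w a b) (el_jac w a b)"
  using pl_step[OF pl_id, of a w b] by simp

lemma pl_comp:
  assumes "pl \<Psi>2 J2" "pl \<Psi>1 J1"
  shows "pl (\<lambda>x. \<Psi>1 (\<Psi>2 x)) (\<lambda>x. J1 (\<Psi>2 x) * J2 x)"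
  using assms
proof (induction rule: pl.induct)
  case (pl_step \<Psi> J a w b)
  from pl.pl_step[OF pl_step.IH[OF pl_step.prems] pl_step.hyps(2), of b]
  show ?case by (simp add: mult.assoc)
qed simp

lemma pl_measurable:
  assumes "pl \<Psi> J"
  shows "\<Psi> \<in> borel_measurable borel" "J \<in> borel_measurable borel"
  using assms
proof (induction rule: pl.induct)
  case (pl_step \<Psi> J a w b)
  note [measurable] = pl_step.IH
  { case 1 show ?case by measurable }
  { case 2 show ?case by measurable }
qed simp_all

lemma pl_pos: "pl \<Psi> J \<Longrightarrow> J x > 0"
  by (induction arbitrary: x rule: pl.induct) (auto simp: el_jac_def)

lemma pl_inverse:
  assumes "pl \<Psi> J"
  obtains \<Phi> where "\<Phi> \<in> borel_measurable borel" "\<And>x. \<Phi> (\<Psi> x) = x" "\<And>x. \<Psi> (\<Phi> x) = x"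
proof -
  have "\<exists>\<Phi>\<in>borel_measurable borel. (\<forall>x. \<Phi> (\<Psi> x) = x \<and> \<Psi> (\<Phi> x) = x)"
    using assms
  proof (induction rule: pl.induct)
    case (pl_step \<Psi> J a w b)
    then obtain \<Phi> where [measurable]: "\<Phi>\<in>borel_measurable borel" and *: "\<And>x. \<Phi> (\<Psi> x) = x" "\<And>x. \<Psi> (\<Phi> x) = x"
      by blast
    show ?case
      by (rule bexI[where x="\<lambda>x. el ((- 1 / (1 + a \<bullet> w)) *\<^sub>R w) a b (\<Phi> x)"])
        (simp_all only: el_inverse[OF pl_step.hyps(2)] *, simp_all, measurable)
  qed (auto intro!: bexI[where x="\<lambda>x. x"])
  with that show thesis by blast
qed

lemma nn_integral_pl:
  assumes "pl \<Psi> J" and "f \<in> borel_measurable borel"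
  shows "(\<integral>\<^sup>+x. f (\<Psi> x) * ennreal (J x) \<partial>lborel) = (\<integral>\<^sup>+x. f x \<partial>lborel)"
  using assms
proof (induction rule: pl.induct)
  case (pl_step \<Psi> J a w b)
  note [measurable] = pl_measurable[OF pl_step.hyps(1)] pl_step.prems
  have "(\<integral>\<^sup>+x. f (\<Psi> (el w a b x)) * ennreal (J (el w a b x) * el_jac w a b x) \<partial>lborel)
     = (\<integral>\<^sup>+x. (\<lambda>y. f (\<Psi> y) * ennreal (J y)) (el w a b x) * ennreal (el_jac w a b x) \<partial>lborel)"
    by (intro nn_integral_cong)
      (simp add: ennreal_mult' less_imp_le[OF pl_pos[OF pl_step.hyps(1)]] mult.assoc)
  also have "\<dots> = (\<integral>\<^sup>+y. f (\<Psi> y) * ennreal (J y) \<partial>lborel)"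
    by (rule nn_integral_el[OF pl_step.hyps(2)]) measurable
  finally show ?case using pl_step by simp
qed simp

section \<open>Realisation by piecewise constant controls\<close>

text \<open>The values other than \<open>f t\<close> are finitely many, hence form a closed set,
  which continuity at \<open>t\<close> avoids near \<open>t\<close>.\<close>

lemma eventually_eq_of_continuous_finite_range:
  fixes f :: "'b::t2_space \<Rightarrow> 'a::t1_space"
  assumes "continuous (at t within A) f" "finite (f ` A)"
  shows "eventually (\<lambda>s. f s = f t) (at t within A)"
proof -
  let ?S = "- (f ` A - {f t})"
  have "open ?S" using assms(2) by (intro open_Compl finite_imp_closed) simp
  moreover have "f t \<in> ?S" by simp
  ultimately have "eventually (\<lambda>s. f s \<in> ?S) (at t within A)"
    using assms(1) by (auto simp: continuous_within tendsto_def)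
  then show ?thesis unfolding eventually_at_filter by eventually_elim auto
qed

text \<open>A finite connected set of values is a single point, so nothing changes on an interval
  without switches.\<close>

lemma piecewise_constant_if_finite_range:
  fixes f :: "real \<Rightarrow> 'a::metric_space"
  assumes fin: "finite (f ` {0..T})" and sw: "finite (switches T f)"
  shows "piecewise_constant_finite_switches T f"
  unfolding piecewise_constant_finite_switches_def
proof (intro conjI ballI impI sw)
  fix s t assume st: "s \<in> {0..T}" "t \<in> {0..T}" "s \<le> t \<and> {s..t} \<inter> switches T f = {}"
  then have sub: "{s..t} \<subseteq> {0..T}" by auto
  have "continuous_on {s..t} f"
    unfolding continuous_on_eq_continuous_within
  proof
    fix x assume x: "x \<in> {s..t}"
    then have "continuous (at x within {0..T}) f" using st sub unfolding switches_def by blast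
    then show "continuous (at x within {s..t}) f" using sub by (rule continuous_within_subset)
  qed
  then have "connected (f ` {s..t})" by (rule connected_continuous_image) simp
  moreover have "finite (f ` {s..t})" using fin sub by (meson finite_subset image_mono)
  ultimately obtain c where "f ` {s..t} = {c}" using st connected_finite_iff_sing by fastforce
  then show "f s = f t" using st by (metis atLeastAtMost_iff imageI order_refl singletonD)
qed

text \<open>Concatenating controls can produce or remove a switch at the junction, so it is easier to
  work with curves that solve the equation off an arbitrary finite set of times.\<close>

definition almost_solves ::
    "real \<Rightarrow> (real \<Rightarrow> real^'n) \<Rightarrow> (real \<Rightarrow> real^'n) \<Rightarrow> (real \<Rightarrow> real) \<Rightarrow> (real \<Rightarrow> real^'n) \<Rightarrow> bool" where
  "almost_solves T w a b x \<longleftrightarrow> continuous_on {0..T} x \<and>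
     (\<exists>S. finite S \<and> (\<forall>t \<in> {0..T} - S.
        (x has_vector_derivative (max (a t \<bullet> x t + b t) 0 *\<^sub>R w t)) (at t within {0..T})))"

text \<open>An exceptional time in \<open>S\<close> that is not a switch is harmless: the control is
  constant near it, so there the curve is the integral of the continuous function \<open>g\<close>
  and is differentiable.\<close>

lemma almost_solves_imp_solves_ode:
  assumes T: "0 < T" and fin: "finite ((\<lambda>s. (w s, a s, b s)) ` {0..T})"
    and x: "almost_solves T w a b x"
  shows "solves_ode T w a b (x 0) x"
proof -
  define \<theta> where "\<theta> = (\<lambda>s. (w s, a s, b s))"
  from x obtain S where cont: "continuous_on {0..T} x" and S: "finite S" and der: "\<And>t. t \<in> {0..T} - S \<Longrightarrow>
        (x has_vector_derivative (max (a t \<bullet> x t + b t) 0 *\<^sub>R w t)) (at t within {0..T})"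
    unfolding almost_solves_def by blast
  have "(x has_vector_derivative (max (a t \<bullet> x t + b t) 0 *\<^sub>R w t)) (at t within {0..T})"
    if t: "t \<in> {0..T}" "t \<notin> switches T \<theta>" for t
  proof -
    have "continuous (at t within {0..T}) \<theta>" using t by (auto simp: switches_def)
    then have "eventually (\<lambda>s. \<theta> s = \<theta> t) (at t within {0..T})"
      by (rule eventually_eq_of_continuous_finite_range) (use fin in \<open>simp add: \<theta>_def\<close>)
    then obtain d where d0: "d > 0" "\<forall>s\<in>{0..T}. s \<noteq> t \<and> dist s t < d \<longrightarrow> \<theta> s = \<theta> t"
      unfolding eventually_at by auto
    then have d: "d > 0" "\<theta> s = \<theta> t" if "s \<in> {0..T}" "dist s t < d" for s
      using that by (cases "s = t", auto)
    define l u where "l = max 0 (t - d / 2)" and "u = min T (t + d / 2)"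
    have lu: "l \<le> t" "t \<le> u" "0 \<le> l" "u \<le> T" "t - d < l" "u < t + d"
      using t d0(1) by (auto simp: l_def u_def)
    define g where "g s = max (a t \<bullet> x s + b t) 0 *\<^sub>R w t" for s
    have \<theta>: "w s = w t" "a s = a t" "b s = b t" if "s \<in> {l..u}" for s
      using d(2)[of s] that lu by (auto simp: dist_real_def \<theta>_def)
    have cx: "continuous_on {l..u} x" by (rule continuous_on_subset[OF cont]) (use lu in auto)
    then have cg: "continuous_on {l..u} g"
      unfolding g_def by (intro continuous_intros)
    have int: "(g has_integral (x v - x l)) {l..v}" if v: "v \<in> {l..u}" for v
    proof (rule fundamental_theorem_of_calculus_interior_strong[OF S])
      show "continuous_on {l..v} x" by (rule continuous_on_subset[OF cx]) (use v in auto)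
      fix s assume s: "s \<in> {l<..<v} - S"
      then have "s \<in> {0..T} - S" "0 < s" "s < T" "s \<in> {l..u}" using lu v by auto
      with der[of s] \<theta>[of s] show "(x has_vector_derivative g s) (at s)"
        by (simp add: g_def at_within_Icc_at)
    qed (use v in auto)
    have "((\<lambda>v. integral {l..v} g) has_vector_derivative g t) (at t within {l..u})"
      by (rule integral_has_vector_derivative[OF cg]) (use lu in auto)
    then have "((\<lambda>v. x l + integral {l..v} g) has_vector_derivative g t) (at t within {l..u})"
      by (auto intro!: derivative_eq_intros)
    then have "(x has_vector_derivative g t) (at t within {l..u})"
    proof (rule has_vector_derivative_transform[rotated 2])
      show "x v = x l + integral {l..v} g" if "v \<in> {l..u}" for v
        using integral_unique[OF int[OF that]] by simp
    qed (use lu in simp)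
    moreover have "at t within {l..u} = at t within {0..T}"
      by (rule at_within_nhd[of _ "{t - d / 2<..<t + d / 2}"])
        (use d0(1) in \<open>auto simp: l_def u_def\<close>)
    ultimately show ?thesis by (simp add: g_def)
  qed
  with cont show ?thesis by (auto simp: solves_ode_def \<theta>_def)
qed

text \<open>A Gronwall argument: \<open>L\<close> bounds the Lipschitz constants of the finitely
  many fields, so the squared distance of two solutions, weighted by
  \<open>exp (- (2 * L * s))\<close>, has nonpositive derivative off the switches and starts at
  0.\<close>

lemma solves_ode_unique:
  assumes fin: "finite ((\<lambda>s. (w s, a s, b s)) ` {0..T})" and sw: "finite (switches T (\<lambda>s. (w s, a s, b s)))"
    and x: "solves_ode T w a b x0 x" and y: "solves_ode T w a b x0 y" and t: "t \<in> {0..T}"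
  shows "x t = y t"
proof -
  define S where "S = switches T (\<lambda>s. (w s, a s, b s))"
  have "finite ((\<lambda>(w, a, b). norm w * norm a) ` (\<lambda>s. (w s, a s, b s)) ` {0..T})" using fin by simp
  then have "finite ((\<lambda>s. norm (w s) * norm (a s)) ` {0..T})" by (simp add: image_image)
  then have "bdd_above ((\<lambda>s. norm (w s) * norm (a s)) ` {0..T})" by (rule bdd_above_finite)
  then obtain L where L: "\<And>s. s \<in> {0..T} \<Longrightarrow> norm (w s) * norm (a s) \<le> L"
    unfolding bdd_above_def by (metis imageI)
  define z where "z s = x s - y s" for s
  define z' where "z' s = (max (a s \<bullet> x s + b s) 0 - max (a s \<bullet> y s + b s) 0) *\<^sub>R w s" for s
  define D where "D s = exp (- (2 * L * s)) * (z s \<bullet> z s)" for s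
  define D' where "D' s = exp (- (2 * L * s)) * (2 * (z s \<bullet> z' s) - 2 * L * (z s \<bullet> z s))" for s
  have D': "D' s \<le> 0" if s: "s \<in> {0..T}" for s
  proof -
    have "\<bar>max (a s \<bullet> x s + b s) 0 - max (a s \<bullet> y s + b s) 0\<bar> \<le> \<bar>a s \<bullet> z s\<bar>"
      by (simp add: z_def inner_diff_right)
    also have "\<dots> \<le> norm (a s) * norm (z s)" by (rule Cauchy_Schwarz_ineq2)
    finally have 1: "\<bar>max (a s \<bullet> x s + b s) 0 - max (a s \<bullet> y s + b s) 0\<bar> \<le> norm (a s) * norm (z s)" .
    have "z s \<bullet> z' s \<le> norm (z s) * norm (z' s)" by (rule norm_cauchy_schwarz)
    also have "\<dots> \<le> norm (z s) * (norm (a s) * norm (z s) * norm (w s))"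
      unfolding z'_def using 1 by (simp add: mult_left_mono mult_right_mono)
    also have "\<dots> = (norm (w s) * norm (a s)) * (norm (z s))\<^sup>2" by (simp add: power2_eq_square)
    also have "\<dots> \<le> L * (norm (z s))\<^sup>2" using L[OF s] by (simp add: mult_right_mono)
    finally show ?thesis by (simp add: D'_def mult_nonneg_nonpos power2_norm_eq_inner)
  qed
  have "(D' has_integral (D t - D 0)) {0..t}"
  proof (rule fundamental_theorem_of_calculus_interior_strong[of S])
    show "finite S" using sw by (simp add: S_def)
    show "continuous_on {0..t} D"
    proof -
      have "continuous_on {0..t} x" "continuous_on {0..t} y"
        using x y t continuous_on_subset[of "{0..T}" _ "{0..t}"] by (auto simp: solves_ode_def)
      then show ?thesis unfolding D_def z_def by (intro continuous_intros)
    qed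
    fix s assume s: "s \<in> {0<..<t} - S"
    then have s': "s \<in> {0..T} - S" "0 < s" "s < T" using t by auto
    have "(y' has_vector_derivative (max (a s \<bullet> y' s + b s) 0 *\<^sub>R w s)) (at s)"
      if "solves_ode T w a b x0 y'" for y'
    proof -
      have "(y' has_vector_derivative (max (a s \<bullet> y' s + b s) 0 *\<^sub>R w s)) (at s within {0..T})"
        using that s'(1) unfolding solves_ode_def S_def by blast
      then show ?thesis using s' by (simp only: at_within_Icc_at)
    qed
    from has_vector_derivative_diff[OF this[OF x] this[OF y]]
    have "(z has_vector_derivative z' s) (at s)"
      by (simp add: z_def[abs_def] z'_def scaleR_left_diff_distrib)
    then have "((\<lambda>s. z s \<bullet> z s) has_vector_derivative (z s \<bullet> z' s + z' s \<bullet> z s)) (at s)"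
      by (intro bounded_bilinear.has_vector_derivative[OF bounded_bilinear_inner])
    moreover have "((\<lambda>s. exp (- (2 * L * s))) has_vector_derivative (- (2 * L) * exp (- (2 * L * s)))) (at s)"
      unfolding has_real_derivative_iff_has_vector_derivative[symmetric] by (auto intro!: derivative_eq_intros)
    ultimately have "(D has_vector_derivative (exp (- (2 * L * s)) * (z s \<bullet> z' s + z' s \<bullet> z s)
        + (- (2 * L) * exp (- (2 * L * s))) * (z s \<bullet> z s))) (at s)"
      unfolding D_def by (intro bounded_bilinear.has_vector_derivative[OF bounded_bilinear_mult])
    then show "(D has_vector_derivative D' s) (at s)"
      by (simp add: D'_def algebra_simps inner_commute)
  qed (use t in auto)
  then have "D t - D 0 \<le> 0"
    by (rule has_integral_le[where g="\<lambda>_. 0" and j=0]) (use D' t in auto)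
  moreover have "D 0 = 0" using x y by (simp add: D_def z_def solves_ode_def)
  ultimately have "z t \<bullet> z t \<le> 0" by (simp add: D_def mult_le_0_iff)
  then have "(norm (z t))\<^sup>2 \<le> 0" by (simp only: power2_norm_eq_inner)
  then show ?thesis by (simp add: z_def)
qed

lemma flow_map_eq:
  assumes T: "0 < T" and fin: "finite ((\<lambda>s. (w s, a s, b s)) ` {0..T})"
    and sw: "finite (switches T (\<lambda>s. (w s, a s, b s)))"
    and X: "almost_solves T w a b (\<lambda>t. X t x0)" "X 0 x0 = x0" and t: "t \<in> {0..T}"
  shows "flow_map T w a b t x0 = X t x0"
  unfolding flow_map_def
proof (rule the_equality)
  have s: "solves_ode T w a b x0 (\<lambda>t. X t x0)"
    using almost_solves_imp_solves_ode[OF T fin X(1)] X(2) by simp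
  then show "\<exists>x. solves_ode T w a b x0 x \<and> X t x0 = x t" by blast
  show "y = X t x0" if "\<exists>x. solves_ode T w a b x0 x \<and> y = x t" for y
    using that solves_ode_unique[OF fin sw _ s t] by blast
qed

text \<open>With \<open>\<psi>' = 1 + (a \<bullet> w1) \<psi>\<close> and \<open>\<psi> 0 = 0\<close>, the flow of the constant control \<open>(w1, a, b)\<close>
  at time \<open>t\<close> is \<open>el (\<psi> t *\<^sub>R w1) a b\<close>.\<close>

lemma el_time_profile:
  fixes a w :: "real^'n"
  assumes \<tau>: "\<tau> > 0" and w: "1 + a \<bullet> w > 0"
  obtains w1 \<psi> where "\<psi> 0 = 0" "\<And>t. (\<psi> has_real_derivative (1 + (a \<bullet> w1) * \<psi> t)) (at t)"
    "\<And>t. 1 + (a \<bullet> w1) * \<psi> t > 0" "\<psi> \<tau> *\<^sub>R w1 = (- 1 / (1 + a \<bullet> w)) *\<^sub>R w"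
proof (cases "a \<bullet> w = 0")
  case True
  show ?thesis
    by (rule that[of "\<lambda>t. t" "(- 1 / \<tau>) *\<^sub>R w"]) (use True \<tau> in auto)
next
  case False
  \<comment> \<open>With \<open>a \<bullet> w1 = k1\<close> the flow multiplies positive values of
    \<open>a \<bullet> x + b\<close> by \<open>exp (k1 * \<tau>)\<close> in time
    \<open>\<tau>\<close>; this is to equal \<open>1 / (1 + a \<bullet> w)\<close>, the factor of
    the inverse of \<open>el w a b\<close>.\<close>
  define k1 where "k1 = - ln (1 + a \<bullet> w) / \<tau>"
  have k1: "k1 \<noteq> 0" using False w \<tau> by (auto simp: k1_def)
  have aw: "a \<bullet> ((k1 / (a \<bullet> w)) *\<^sub>R w) = k1" using False by simp
  have "exp (k1 * \<tau>) = 1 / (1 + a \<bullet> w)" using \<tau> w by (simp add: k1_def exp_minus field_simps)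
  then have e: "(exp (k1 * \<tau>) - 1) / k1 * (k1 / (a \<bullet> w)) = - 1 / (1 + a \<bullet> w)"
    using False k1 w by (simp add: field_simps)
  show ?thesis
  proof (rule that[of "\<lambda>t. (exp (k1 * t) - 1) / k1" "(k1 / (a \<bullet> w)) *\<^sub>R w"], unfold aw)
    show "((\<lambda>t. (exp (k1 * t) - 1) / k1) has_real_derivative 1 + k1 * ((exp (k1 * t) - 1) / k1)) (at t)" for t
      using k1 by (auto intro!: derivative_eq_intros)
  qed (use k1 e in auto)
qed

lemma has_vector_derivative_el_profile:
  assumes \<psi>: "(\<psi> has_real_derivative (1 + (a \<bullet> w1) * \<psi> t)) (at t)" and pos: "1 + (a \<bullet> w1) * \<psi> t > 0"
  shows "((\<lambda>t. el (\<psi> t *\<^sub>R w1) a b x) has_vector_derivative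
     (max (a \<bullet> el (\<psi> t *\<^sub>R w1) a b x + b) 0 *\<^sub>R w1)) (at t within A)"
proof -
  define s where "s = a \<bullet> x + b"
  have "a \<bullet> el (\<psi> t *\<^sub>R w1) a b x + b = s + max s 0 * ((a \<bullet> w1) * \<psi> t)"
    by (simp add: el_def s_def inner_right_distrib)
  also have "max \<dots> 0 = max s 0 * (1 + (a \<bullet> w1) * \<psi> t)"
  proof (cases "s > 0")
    case True
    have "s + s * ((a \<bullet> w1) * \<psi> t) = s * (1 + (a \<bullet> w1) * \<psi> t)" by (simp add: algebra_simps)
    moreover have "s * (1 + (a \<bullet> w1) * \<psi> t) > 0" using True pos by simp
    ultimately show ?thesis using True by simp
  qed auto
  finally have e: "max (a \<bullet> el (\<psi> t *\<^sub>R w1) a b x + b) 0 = max s 0 * (1 + (a \<bullet> w1) * \<psi> t)" .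
  have "((\<lambda>t. max s 0 * \<psi> t) has_real_derivative max s 0 * (1 + (a \<bullet> w1) * \<psi> t)) (at t within A)"
    using DERIV_cmult[OF \<psi>] has_field_derivative_at_within by blast
  from has_vector_derivative_scaleR[OF this has_vector_derivative_const]
  have "((\<lambda>t. (max s 0 * \<psi> t) *\<^sub>R w1) has_vector_derivative (max s 0 * (1 + (a \<bullet> w1) * \<psi> t)) *\<^sub>R w1) (at t within A)"
    by simp
  from has_vector_derivative_add[OF has_vector_derivative_const[of x] this]
  show ?thesis unfolding e by (simp add: el_def s_def)
qed

section \<open>Flows that realise compositions of elementary maps\<close>

text \<open>The last clause concerns every time, not only the final one: it provides a density of
  the transported measure throughout the interval.\<close>

definition realizes ::
    "real \<Rightarrow> (real \<Rightarrow> real^'n) \<Rightarrow> (real \<Rightarrow> real^'n) \<Rightarrow> (real \<Rightarrow> real) \<Rightarrow> (real \<Rightarrow> real^'n \<Rightarrow> real^'n) \<Rightarrow> bool" where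
  "realizes T w a b X \<longleftrightarrow>
     finite ((\<lambda>s. (w s, a s, b s)) ` {0..T}) \<and> finite (switches T (\<lambda>s. (w s, a s, b s))) \<and>
     (\<forall>x. X 0 x = x \<and> almost_solves T w a b (\<lambda>t. X t x)) \<and>
     (\<forall>t\<in>{0..T}. \<exists>\<Psi> J. pl \<Psi> J \<and> (\<forall>x. \<Psi> (X t x) = x \<and> X t (\<Psi> x) = x))"

lemma switches_concat_subset:
  fixes f :: "real \<Rightarrow> 'a::topological_space"
  assumes "0 < \<tau>" "\<tau> < T"
  shows "switches T (\<lambda>t. if t < \<tau> then f t else c) \<subseteq> insert \<tau> (switches \<tau> f)"
proof
  fix t assume t: "t \<in> switches T (\<lambda>t. if t < \<tau> then f t else c)"
  then have tT: "t \<in> {0..T}" and nc: "\<not> continuous (at t within {0..T}) (\<lambda>t. if t < \<tau> then f t else c)"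
    by (auto simp: switches_def)
  consider "t < \<tau>" | "t = \<tau>" | "t > \<tau>" by linarith
  then show "t \<in> insert \<tau> (switches \<tau> f)"
  proof cases
    case 1
    have at: "at t within {0..T} = at t within {0..\<tau>}"
      by (rule at_within_nhd[of _ "{..<\<tau>}"]) (use 1 assms in auto)
    have "\<not> continuous (at t within {0..\<tau>}) f"
    proof
      assume "continuous (at t within {0..\<tau>}) f"
      then have "continuous (at t within {0..T}) f" by (simp only: at)
      moreover have "eventually (\<lambda>s. f s = (if s < \<tau> then f s else c)) (at t within {0..T})"
        using 1 by (auto simp: eventually_at dist_real_def intro!: exI[of _ "\<tau> - t"])
      ultimately have "continuous (at t within {0..T}) (\<lambda>t. if t < \<tau> then f t else c)"
        using 1 tendsto_cong unfolding continuous_within by fastforce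
      with nc show False by blast
    qed
    with 1 tT show ?thesis by (auto simp: switches_def)
  next
    case 3
    have "((\<lambda>t. if t < \<tau> then f t else c) \<longlongrightarrow> c) (at t within {0..T})"
      by (rule tendsto_eventually) (use 3 in \<open>auto simp: eventually_at dist_real_def intro!: exI[of _ "t - \<tau>"]\<close>)
    with nc 3 show ?thesis by (simp add: continuous_within)
  qed simp
qed

text \<open>\<open>X T\<close> is the inverse of \<open>\<Psi>\<close>. In \<open>pl_step\<close>
  the elementary map is applied before \<open>\<Psi>\<close>, so its inverse acts last: the control
  for \<open>\<Psi>\<close> runs on the first half of the time interval and the inverse elementary
  map takes the second half. Hence the induction is over all \<open>T\<close>.\<close>

lemma pl_realizable:
  fixes \<Psi> :: "real^'n \<Rightarrow> real^'n"
  assumes "pl \<Psi> J" "0 < T"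
  shows "\<exists>w a b X. realizes T w a b X \<and> (\<forall>x. \<Psi> (X T x) = x \<and> X T (\<Psi> x) = x)"
  using assms
proof (induction arbitrary: T rule: pl.induct)
  case pl_id
  have "switches T (\<lambda>s. (0, 0, 0) :: (real^'n) \<times> (real^'n) \<times> real) = {}" by (auto simp: switches_def)
  moreover have "finite ((\<lambda>s. (0, 0, 0) :: (real^'n) \<times> (real^'n) \<times> real) ` {0..T})" by (rule finite_subset[of _ "{(0,0,0)}"]) auto
  ultimately have "realizes T (\<lambda>_. 0) (\<lambda>_. 0) (\<lambda>_. 0) (\<lambda>_ x :: real^'n. x)"
    unfolding realizes_def
  proof (intro conjI allI ballI)
    show "almost_solves T (\<lambda>_. 0) (\<lambda>_. 0) (\<lambda>_. 0) (\<lambda>_. x)" for x :: "real^'n"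
      unfolding almost_solves_def by (intro conjI exI[of _ "{}"]) auto
    show "\<exists>\<Psi> J. pl \<Psi> J \<and> (\<forall>x :: real^'n. \<Psi> x = x \<and> \<Psi> x = x)"
      using pl.pl_id by blast
  qed auto
  then show ?case by (intro exI) auto
next
  case (pl_step \<Psi> J a1 w0 b1)
  define \<tau> where "\<tau> = T / 2"
  have \<tau>: "0 < \<tau>" "\<tau> < T" "T - \<tau> = \<tau>" using pl_step.prems by (auto simp: \<tau>_def)
  from pl_step.IH[OF \<tau>(1)] obtain w a b X where R: "realizes \<tau> w a b X"
    and X\<tau>: "\<And>x. \<Psi> (X \<tau> x) = x" "\<And>x. X \<tau> (\<Psi> x) = x" by blast
  obtain w1 \<psi> where \<psi>: "\<psi> 0 = 0" "\<And>t. (\<psi> has_real_derivative (1 + (a1 \<bullet> w1) * \<psi> t)) (at t)"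
    "\<And>t. 1 + (a1 \<bullet> w1) * \<psi> t > 0" "\<psi> \<tau> *\<^sub>R w1 = (- 1 / (1 + a1 \<bullet> w0)) *\<^sub>R w0"
    using el_time_profile[OF \<tau>(1) pl_step.hyps(2)] by metis
  define w' where "w' t = (if t < \<tau> then w t else w1)" for t
  define a' where "a' t = (if t < \<tau> then a t else a1)" for t
  define b' where "b' t = (if t < \<tau> then b t else b1)" for t
  define Y where "Y t x = el (\<psi> (t - \<tau>) *\<^sub>R w1) a1 b1 (X \<tau> x)" for t x
  define X' where "X' t x = (if t \<le> \<tau> then X t x else Y t x)" for t x
  have \<theta>': "(\<lambda>s. (w' s, a' s, b' s)) = (\<lambda>s. if s < \<tau> then (w s, a s, b s) else (w1, a1, b1))"
    by (auto simp: w'_def a'_def b'_def fun_eq_iff)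
  have fin: "finite ((\<lambda>s. (w' s, a' s, b' s)) ` {0..T})"
  proof (rule finite_subset)
    show "(\<lambda>s. (w' s, a' s, b' s)) ` {0..T} \<subseteq> insert (w1, a1, b1) ((\<lambda>s. (w s, a s, b s)) ` {0..\<tau>})"
      by (auto simp: w'_def a'_def b'_def)
  qed (use R in \<open>simp add: realizes_def\<close>)
  have sw: "finite (switches T (\<lambda>s. (w' s, a' s, b' s)))"
    unfolding \<theta>' by (rule finite_subset[OF switches_concat_subset[OF \<tau>(1,2)]])
      (use R in \<open>simp add: realizes_def\<close>)
  have Yd: "((\<lambda>t. Y t x) has_vector_derivative (max (a1 \<bullet> Y t x + b1) 0 *\<^sub>R w1)) (at t within A)" for t x A
  proof -
    have "((\<lambda>t. \<psi> (t - \<tau>)) has_real_derivative (1 + (a1 \<bullet> w1) * \<psi> (t - \<tau>))) (at t)"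
      using DERIV_shift[of \<psi> "1 + (a1 \<bullet> w1) * \<psi> (t - \<tau>)" t "- \<tau>"] \<psi>(2)[of "t - \<tau>"] by simp
    from has_vector_derivative_el_profile[OF this \<psi>(3)] show ?thesis by (simp add: Y_def)
  qed
  have Y\<tau>: "Y \<tau> x = X \<tau> x" for x by (simp add: Y_def \<psi>(1) el_def)
  have sol: "almost_solves T w' a' b' (\<lambda>t. X' t x)" for x
  proof -
    have "almost_solves \<tau> w a b (\<lambda>t. X t x)" using R by (simp add: realizes_def)
    then obtain S where cX: "continuous_on {0..\<tau>} (\<lambda>t. X t x)" and S: "finite S" and dX: "\<And>t. t \<in> {0..\<tau>} - S \<Longrightarrow>
        ((\<lambda>t. X t x) has_vector_derivative (max (a t \<bullet> X t x + b t) 0 *\<^sub>R w t)) (at t within {0..\<tau>})"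
      unfolding almost_solves_def by blast
    have cY: "continuous_on A (\<lambda>t. Y t x)" for A
      using Yd[of x _ A] by (meson continuous_on_eq_continuous_within has_vector_derivative_continuous)
    have "continuous_on {0..T} (\<lambda>t. X' t x)"
      unfolding X'_def
      by (rule continuous_on_cases_le) (auto intro!: cY continuous_on_subset[OF cX] simp: Y\<tau> continuous_on_id)
    moreover have "((\<lambda>t. X' t x) has_vector_derivative (max (a' t \<bullet> X' t x + b' t) 0 *\<^sub>R w' t)) (at t within {0..T})"
      if t: "t \<in> {0..T} - insert \<tau> S" for t
    proof (cases "t < \<tau>")
      case True
      have at: "at t within {0..T} = at t within {0..\<tau>}"
        by (rule at_within_nhd[of _ "{..<\<tau>}"]) (use True \<tau> in auto)
      have "((\<lambda>t. X t x) has_vector_derivative (max (a' t \<bullet> X' t x + b' t) 0 *\<^sub>R w' t)) (at t within {0..T})"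
        unfolding at using dX[of t] t True by (simp add: X'_def a'_def w'_def b'_def)
      then show ?thesis
        by (rule has_vector_derivative_transform_within[of _ _ _ _ "\<tau> - t"])
          (use t True in \<open>auto simp: X'_def dist_real_def\<close>)
    next
      case False
      then have "t > \<tau>" using t by auto
      have "((\<lambda>t. Y t x) has_vector_derivative (max (a' t \<bullet> X' t x + b' t) 0 *\<^sub>R w' t)) (at t within {0..T})"
        using Yd[of x t] False \<open>t > \<tau>\<close> by (simp add: X'_def a'_def w'_def b'_def)
      then show ?thesis
        by (rule has_vector_derivative_transform_within[of _ _ _ _ "t - \<tau>"])
          (use t \<open>t > \<tau>\<close> in \<open>auto simp: X'_def dist_real_def\<close>)
    qed
    ultimately show ?thesis unfolding almost_solves_def using S by (intro conjI exI[of _ "insert \<tau> S"]) auto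
  qed
  have inv: "\<exists>\<Psi> J. pl \<Psi> J \<and> (\<forall>x. \<Psi> (X' t x) = x \<and> X' t (\<Psi> x) = x)" if t: "t \<in> {0..T}" for t
  proof (cases "t \<le> \<tau>")
    case True
    then show ?thesis using R t by (simp add: realizes_def X'_def)
  next
    case False
    \<comment> \<open>After time \<open>\<tau>\<close> the last elementary flow is completed only in
      part: so far it is \<open>el v a1 b1\<close>, and its inverse is
      \<open>el v' a1 b1\<close>.\<close>
    define v where "v = \<psi> (t - \<tau>) *\<^sub>R w1"
    have v: "1 + a1 \<bullet> v > 0" using \<psi>(3)[of "t - \<tau>"] by (simp add: v_def mult.commute)
    define v' where "v' = (- 1 / (1 + a1 \<bullet> v)) *\<^sub>R v"
    have v': "1 + a1 \<bullet> v' > 0" using v by (simp add: v'_def field_simps)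
    have "pl (\<lambda>x. \<Psi> (el v' a1 b1 x)) (\<lambda>x. J (el v' a1 b1 x) * el_jac v' a1 b1 x)"
      by (rule pl.pl_step[OF pl_step.hyps(1) v'])
    moreover have "\<Psi> (el v' a1 b1 (X' t x)) = x" "X' t (\<Psi> (el v' a1 b1 x)) = x" for x
      using False el_inverse[OF v, of b1] by (simp_all add: X'_def Y_def v_def[symmetric] v'_def X\<tau>)
    ultimately show ?thesis by blast
  qed
  have "realizes T w' a' b' X'"
    unfolding realizes_def using fin sw sol inv R \<tau> by (auto simp: realizes_def X'_def)
  moreover have "\<Psi> (el w0 a1 b1 (X' T x)) = x" "X' T (\<Psi> (el w0 a1 b1 x)) = x" for x
    using \<tau> el_inverse[OF pl_step.hyps(2), of b1] by (simp_all add: X'_def Y_def \<psi>(4) X\<tau>)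
  ultimately show ?case by blast
qed

section \<open>Relative entropy under transport\<close>

text \<open>The terms \<open>- u + r\<close> cancel when probability densities are integrated, and
  they make the integrand nonnegative. Relative entropy thus becomes a nonnegative integral in
  \<open>ennreal\<close>, for which integrability need not be carried along.\<close>

definition rel_ent :: "real \<Rightarrow> real \<Rightarrow> real" where
  "rel_ent u r = u * ln (u / r) - u + r"

lemma rel_ent_nonneg:
  assumes "0 \<le> u" "0 < r" shows "0 \<le> rel_ent u r"
proof (cases "u = 0")
  case False
  with assms have u: "u > 0" by simp
  have "ln (r / u) \<le> r / u - 1" using u assms by (intro ln_le_minus_one) simp
  then have "u * ln (r / u) \<le> u * (r / u - 1)" using u by (intro mult_left_mono) auto
  then show ?thesis using u assms by (simp add: rel_ent_def ln_div algebra_simps)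
qed (use assms in \<open>simp add: rel_ent_def\<close>)

lemma rel_ent_scale:
  assumes "0 < j" shows "rel_ent (u / j) r * j = rel_ent u (r * j)"
proof -
  have "u / j / r = u / (r * j)" by (simp add: mult.commute)
  with assms show ?thesis by (simp add: rel_ent_def algebra_simps)
qed

definition KLnn :: "(real^'n \<Rightarrow> real) \<Rightarrow> (real^'n \<Rightarrow> real) \<Rightarrow> ennreal" where
  "KLnn \<nu> \<rho> = (\<integral>\<^sup>+x. ennreal (rel_ent (\<nu> x) (\<rho> x)) \<partial>lborel)"

lemma rel_ent_measurable [measurable]:
  assumes [measurable]: "\<nu> \<in> borel_measurable M" "\<rho> \<in> borel_measurable M"
  shows "(\<lambda>x. rel_ent (\<nu> x) (\<rho> x)) \<in> borel_measurable M"
  unfolding rel_ent_def by measurable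

definition push :: "(real^'n \<Rightarrow> real^'n) \<Rightarrow> (real^'n \<Rightarrow> real) \<Rightarrow> (real^'n \<Rightarrow> real) \<Rightarrow> real^'n \<Rightarrow> real" where
  "push \<Psi> J \<rho> x = \<rho> (\<Psi> x) * J x"

lemma push_measurable:
  assumes "pl \<Psi> J" "\<rho> \<in> borel_measurable borel" shows "push \<Psi> J \<rho> \<in> borel_measurable borel"
proof -
  note [measurable] = pl_measurable[OF assms(1)] assms(2)
  show ?thesis unfolding push_def[abs_def] by measurable
qed

lemma push_pos: "pl \<Psi> J \<Longrightarrow> (\<And>x. \<rho> x > 0) \<Longrightarrow> push \<Psi> J \<rho> x > 0"
  by (simp add: push_def pl_pos)

lemma nn_integral_push:
  assumes "pl \<Psi> J" "\<rho> \<in> borel_measurable borel" "\<And>x. 0 \<le> \<rho> x"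
  shows "(\<integral>\<^sup>+x. ennreal (push \<Psi> J \<rho> x) \<partial>lborel) = (\<integral>\<^sup>+x. ennreal (\<rho> x) \<partial>lborel)"
  using nn_integral_pl[OF assms(1), of "\<lambda>x. ennreal (\<rho> x)"] assms(2,3)
  by (simp add: push_def ennreal_mult' less_imp_le[OF pl_pos[OF assms(1)]])

text \<open>Transporting both densities by the same bijection leaves relative entropy unchanged;
  here the map is shifted from the second density to the target. The pointwise reason is
  \<open>rel_ent_scale\<close>.\<close>

lemma KLnn_push:
  assumes pl: "pl \<Psi> J" and [measurable]: "\<nu> \<in> borel_measurable borel" "\<rho> \<in> borel_measurable borel"
    and \<Phi> [measurable]: "\<Phi> \<in> borel_measurable borel" and inv: "\<And>x. \<Phi> (\<Psi> x) = x"
  shows "KLnn \<nu> (push \<Psi> J \<rho>) = KLnn (\<lambda>y. \<nu> (\<Phi> y) / J (\<Phi> y)) \<rho>"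
proof -
  note [measurable] = pl_measurable[OF pl]
  note J = pl_pos[OF pl]
  have "KLnn \<nu> (push \<Psi> J \<rho>)
      = (\<integral>\<^sup>+x. (\<lambda>y. ennreal (rel_ent (\<nu> (\<Phi> y) / J (\<Phi> y)) (\<rho> y))) (\<Psi> x) * ennreal (J x) \<partial>lborel)"
    unfolding KLnn_def push_def
    by (intro nn_integral_cong) (simp add: inv ennreal_mult''[symmetric] less_imp_le[OF J] rel_ent_scale[OF J])
  also have "\<dots> = KLnn (\<lambda>y. \<nu> (\<Phi> y) / J (\<Phi> y)) \<rho>"
    unfolding KLnn_def by (rule nn_integral_pl[OF pl]) measurable
  finally show ?thesis .
qed

text \<open>The integrand inequality is \<open>\<nu> y \<le> rel_ent \<nu> \<rho> - \<rho> + \<rho> exp y\<close> (Young) for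
  \<open>y = ln (\<rho> / \<rho>') / h\<close>, a one-sided version of the Donsker--Varadhan bound.\<close>

lemma KLnn_step:
  assumes [measurable]: "\<nu> \<in> borel_measurable borel" "\<rho> \<in> borel_measurable borel" "\<rho>' \<in> borel_measurable borel"
    and \<nu>: "\<And>x. 0 \<le> \<nu> x" and \<rho>: "\<And>x. 0 < \<rho> x" and \<rho>': "\<And>x. 0 < \<rho>' x"
    and i\<rho>: "(\<integral>\<^sup>+x. ennreal (\<rho> x) \<partial>lborel) = 1" and i\<rho>': "(\<integral>\<^sup>+x. ennreal (\<rho>' x) \<partial>lborel) = 1"
    and h: "0 < h" and d: "0 \<le> \<delta>"
    and le: "(\<integral>\<^sup>+x. ennreal (\<rho> x * exp (ln (\<rho> x / \<rho>' x) / h)) \<partial>lborel) \<le> ennreal (1 + \<delta>)"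
  shows "KLnn \<nu> \<rho>' + ennreal \<delta> \<le> ennreal (exp h) * (KLnn \<nu> \<rho> + ennreal \<delta>)"
proof (cases "KLnn \<nu> \<rho> = \<infinity>")
  case True
  then show ?thesis by (simp add: ennreal_mult_top)
next
  case False
  define E where "E x = \<rho> x * exp (ln (\<rho> x / \<rho>' x) / h)" for x
  have [measurable]: "E \<in> borel_measurable borel" unfolding E_def[abs_def] by measurable
  have E: "E x > 0" for x using \<rho> by (simp add: E_def)
  \<comment> \<open>The slack is exactly \<open>h * rel_ent (\<nu> x) (E x)\<close>. The terms are
    placed so that all summands on both sides are nonnegative and can be integrated in
    \<open>ennreal\<close>.\<close>
  have pt: "rel_ent (\<nu> x) (\<rho>' x) + (1 + h) * \<rho> x \<le> (1 + h) * rel_ent (\<nu> x) (\<rho> x) + h * E x + \<rho>' x" for x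
  proof -
    have "h * rel_ent (\<nu> x) (E x) \<ge> 0" using h \<nu> E by (simp add: rel_ent_nonneg)
    moreover have "(1 + h) * rel_ent (\<nu> x) (\<rho> x) + h * E x + \<rho>' x - (rel_ent (\<nu> x) (\<rho>' x) + (1 + h) * \<rho> x)
       = h * rel_ent (\<nu> x) (E x)"
    proof (cases "\<nu> x = 0")
      case True then show ?thesis by (simp add: rel_ent_def algebra_simps)
    next
      case False
      then have n: "\<nu> x > 0" using \<nu>[of x] by simp
      define l where "l = (ln (\<rho> x) - ln (\<rho>' x)) / h"
      have "ln (E x) = ln (\<rho> x) + l"
        using \<rho>[of x] \<rho>'[of x] by (simp add: E_def ln_mult ln_div l_def)
      moreover have "ln (\<rho>' x) = ln (\<rho> x) - h * l" using h by (simp add: l_def)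
      ultimately show ?thesis using n \<rho>[of x] \<rho>'[of x] E[of x]
        by (simp add: rel_ent_def ln_div) (simp add: algebra_simps)
    qed
    ultimately show ?thesis by linarith
  qed
  have "KLnn \<nu> \<rho>' + ennreal (1 + h) = (\<integral>\<^sup>+x. ennreal (rel_ent (\<nu> x) (\<rho>' x)) + ennreal (1 + h) * ennreal (\<rho> x) \<partial>lborel)"
    by (simp add: KLnn_def nn_integral_add nn_integral_cmult i\<rho>)
  also have "\<dots> \<le> (\<integral>\<^sup>+x. ennreal (1 + h) * ennreal (rel_ent (\<nu> x) (\<rho> x)) + ennreal h * ennreal (E x) + ennreal (\<rho>' x) \<partial>lborel)"
  proof (intro nn_integral_mono)
    fix x
    have "ennreal (rel_ent (\<nu> x) (\<rho>' x)) + ennreal (1 + h) * ennreal (\<rho> x) = ennreal (rel_ent (\<nu> x) (\<rho>' x) + (1 + h) * \<rho> x)"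
      using h \<rho>[of x] \<rho>'[of x] \<nu>[of x] by (simp add: ennreal_plus ennreal_mult' rel_ent_nonneg)
    also have "\<dots> \<le> ennreal ((1 + h) * rel_ent (\<nu> x) (\<rho> x) + h * E x + \<rho>' x)" by (rule ennreal_leI[OF pt])
    also have "\<dots> = ennreal (1 + h) * ennreal (rel_ent (\<nu> x) (\<rho> x)) + ennreal h * ennreal (E x) + ennreal (\<rho>' x)"
      using h \<rho>[of x] \<rho>'[of x] \<nu>[of x] E[of x] by (simp add: ennreal_plus ennreal_mult' rel_ent_nonneg)
    finally show "ennreal (rel_ent (\<nu> x) (\<rho>' x)) + ennreal (1 + h) * ennreal (\<rho> x)
      \<le> ennreal (1 + h) * ennreal (rel_ent (\<nu> x) (\<rho> x)) + ennreal h * ennreal (E x) + ennreal (\<rho>' x)" .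
  qed
  also have "\<dots> = ennreal (1 + h) * KLnn \<nu> \<rho> + ennreal h * (\<integral>\<^sup>+x. ennreal (E x) \<partial>lborel) + 1"
    by (simp add: KLnn_def nn_integral_add nn_integral_cmult i\<rho>')
  also have "\<dots> \<le> ennreal (1 + h) * KLnn \<nu> \<rho> + ennreal h * ennreal (1 + \<delta>) + 1"
    using le by (intro add_mono mult_left_mono) (auto simp: E_def)
  finally have *: "KLnn \<nu> \<rho>' + ennreal (1 + h) \<le> ennreal (1 + h) * KLnn \<nu> \<rho> + ennreal h * ennreal (1 + \<delta>) + 1" .
  from False obtain k where k: "KLnn \<nu> \<rho> = ennreal k" "k \<ge> 0" by (cases "KLnn \<nu> \<rho>") auto
  have eq: "ennreal (1 + h) * ennreal k + ennreal h * ennreal (1 + \<delta>) + 1 = ennreal ((1 + h) * k + h * (1 + \<delta>) + 1)"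
    using h d k by (simp add: ennreal_plus ennreal_mult' ennreal_1[symmetric] del: ennreal_1)
  have "KLnn \<nu> \<rho>' \<noteq> \<infinity>" using * unfolding k eq by (auto simp: top_unique)
  then obtain k' where k': "KLnn \<nu> \<rho>' = ennreal k'" "k' \<ge> 0" by (cases "KLnn \<nu> \<rho>'") auto
  have "ennreal (k' + (1 + h)) \<le> ennreal ((1 + h) * k + h * (1 + \<delta>) + 1)"
    using * h k' unfolding k eq by (simp add: ennreal_plus)
  then have "k' + (1 + h) \<le> (1 + h) * k + h * (1 + \<delta>) + 1"
    using h d k by (subst (asm) ennreal_le_iff) (auto intro!: add_nonneg_nonneg)
  \<comment> \<open>With \<open>\<delta>\<close> added on both sides the estimate is purely
    multiplicative, so over consecutive steps the factors \<open>exp h\<close> multiply to the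
    exponential of the total time.\<close>
  then have "k' + \<delta> \<le> (1 + h) * (k + \<delta>)" by (simp add: algebra_simps)
  also have "\<dots> \<le> exp h * (k + \<delta>)" using k d by (intro mult_right_mono exp_ge_add_one_self) auto
  finally have "ennreal (k' + \<delta>) \<le> ennreal (exp h * (k + \<delta>))" by (rule ennreal_leI)
  then show ?thesis using k k' d by (simp add: ennreal_plus ennreal_mult')
qed

section \<open>Piecewise linear ridge maps\<close>

text \<open>Beyond \<open>s0\<close> the given ridge map has slope \<open>m0\<close>. Applying first
  an elementary map along the same \<open>a\<close> and \<open>w\<close>, with its kink at
  \<open>s0\<close>, changes this slope to \<open>m1\<close> and nothing on the other side.\<close>

lemma pl_add_kink:
  fixes a w :: "real^'n" and g m :: "real \<Rightarrow> real"
  assumes pl: "pl (\<lambda>x. x + g (a \<bullet> x + b) *\<^sub>R w) (\<lambda>x. 1 + (a \<bullet> w) * m (a \<bullet> x + b))"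
    and g: "\<And>s. s \<ge> s0 \<Longrightarrow> g s = g s0 + m0 * (s - s0)" and m: "\<And>s. s > s0 \<Longrightarrow> m s = m0"
    and m0: "1 + (a \<bullet> w) * m0 > 0" and m1: "1 + (a \<bullet> w) * m1 > 0"
  shows "pl (\<lambda>x. x + (if a \<bullet> x + b \<le> s0 then g (a \<bullet> x + b) else g s0 + m1 * (a \<bullet> x + b - s0)) *\<^sub>R w)
     (\<lambda>x. 1 + (a \<bullet> w) * (if a \<bullet> x + b \<le> s0 then m (a \<bullet> x + b) else m1))"
proof -
  define k where "k = a \<bullet> w"
  \<comment> \<open>An elementary map of strength \<open>c\<close> multiplies the excess over
    \<open>s0\<close> by \<open>1 + k * c\<close>, so the new slope is
    \<open>c + m0 * (1 + k * c)\<close>; equating it to \<open>m1\<close> gives this value.\<close>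
  define c where "c = (m1 - m0) / (1 + k * m0)"
  note k = m0[folded k_def] m1[folded k_def]
  have ck: "1 + k * c = (1 + k * m1) / (1 + k * m0)" using k by (simp add: c_def field_simps)
  have ck': "c * (1 + k * m0) = m1 - m0" using k by (simp add: c_def)
  have pos: "1 + a \<bullet> (c *\<^sub>R w) > 0" using k ck by (simp add: k_def[symmetric] mult.commute)
  define e where "e = el (c *\<^sub>R w) a (b - s0)"
  have s': "a \<bullet> e x + b = (a \<bullet> x + b) + max (a \<bullet> x + b - s0) 0 * (c * k)" for x
    by (simp add: e_def el_def inner_right_distrib k_def algebra_simps)
  have lo: "e x = x" "el_jac (c *\<^sub>R w) a (b - s0) x = 1" if "a \<bullet> x + b \<le> s0" for x
    using that by (auto simp: e_def el_def el_jac_def)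
  have hi: "e x + g (a \<bullet> e x + b) *\<^sub>R w = x + (g s0 + m1 * (a \<bullet> x + b - s0)) *\<^sub>R w"
    "(1 + k * m (a \<bullet> e x + b)) * el_jac (c *\<^sub>R w) a (b - s0) x = 1 + k * m1"
    if s: "a \<bullet> x + b > s0" for x
  proof -
    define r where "r = a \<bullet> x + b - s0"
    have r: "r > 0" using s by (simp add: r_def)
    have "max (a \<bullet> x + b - s0) 0 = r" "a \<bullet> x + b = s0 + r" using r by (simp_all add: r_def)
    then have s1: "a \<bullet> e x + b = s0 + r * (1 + k * c)" using s'[of x] by (simp add: algebra_simps)
    have gt: "r * (1 + k * c) > 0" using r k ck by simp
    have "g (a \<bullet> e x + b) = g s0 + m0 * (r * (1 + k * c))" using g[of "a \<bullet> e x + b"] gt by (simp add: s1)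
    moreover have "e x = x + (r * c) *\<^sub>R w" using s by (simp add: e_def el_def r_def add_diff_eq)
    moreover have "r * c + m0 * (r * (1 + k * c)) = m1 * r"
    proof -
      have "r * c + m0 * (r * (1 + k * c)) = r * (c * (1 + k * m0) + m0)" by (simp add: algebra_simps)
      also have "\<dots> = m1 * r" unfolding ck' by simp
      finally show ?thesis .
    qed
    moreover have "x + (r * c) *\<^sub>R w + (g s0 + m0 * (r * (1 + k * c))) *\<^sub>R w
       = x + (g s0 + (r * c + m0 * (r * (1 + k * c)))) *\<^sub>R w"
      by (simp only: scaleR_left_distrib add.assoc) (simp add: algebra_simps)
    ultimately show "e x + g (a \<bullet> e x + b) *\<^sub>R w = x + (g s0 + m1 * (a \<bullet> x + b - s0)) *\<^sub>R w"
      unfolding r_def[symmetric] by metis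
    have "m (a \<bullet> e x + b) = m0" using m gt by (simp add: s1)
    then show "(1 + k * m (a \<bullet> e x + b)) * el_jac (c *\<^sub>R w) a (b - s0) x = 1 + k * m1"
      using s k ck by (simp add: el_jac_def k_def[symmetric] mult.commute)
  qed
  have "pl (\<lambda>x. e x + g (a \<bullet> e x + b) *\<^sub>R w)
     (\<lambda>x. (1 + k * m (a \<bullet> e x + b)) * el_jac (c *\<^sub>R w) a (b - s0) x)"
    using pl_step[OF pl pos, of "b - s0"] by (simp add: e_def k_def)
  also have "(\<lambda>x. e x + g (a \<bullet> e x + b) *\<^sub>R w)
      = (\<lambda>x. x + (if a \<bullet> x + b \<le> s0 then g (a \<bullet> x + b) else g s0 + m1 * (a \<bullet> x + b - s0)) *\<^sub>R w)"
    using lo hi by (auto simp: fun_eq_iff)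
  also have "(\<lambda>x. (1 + k * m (a \<bullet> e x + b)) * el_jac (c *\<^sub>R w) a (b - s0) x)
      = (\<lambda>x. 1 + k * (if a \<bullet> x + b \<le> s0 then m (a \<bullet> x + b) else m1))"
    using lo hi by (auto simp: fun_eq_iff)
  finally show ?thesis by (simp add: k_def)
qed

text \<open>The piecewise linear function vanishing on the negative half line with slope \<open>c k\<close> on
  \<open>(k \<mu>, (k + 1) \<mu>]\<close>, the last slope continuing to infinity; \<open>pl_slope\<close> is its derivative.\<close>

fun pl_fun :: "real \<Rightarrow> (nat \<Rightarrow> real) \<Rightarrow> nat \<Rightarrow> real \<Rightarrow> real" where
  "pl_fun \<mu> c 0 s = 0"
| "pl_fun \<mu> c (Suc n) s = (if s \<le> real n * \<mu> then pl_fun \<mu> c n s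
     else pl_fun \<mu> c n (real n * \<mu>) + c n * (s - real n * \<mu>))"

fun pl_slope :: "real \<Rightarrow> (nat \<Rightarrow> real) \<Rightarrow> nat \<Rightarrow> real \<Rightarrow> real" where
  "pl_slope \<mu> c 0 s = 0"
| "pl_slope \<mu> c (Suc n) s = (if s \<le> real n * \<mu> then pl_slope \<mu> c n s else c n)"

lemma pl_ridge:
  fixes a w :: "real^'n"
  assumes \<mu>: "\<mu> > 0" and c: "\<And>k. 1 + (a \<bullet> w) * c k > 0"
  shows "pl (\<lambda>x. x + pl_fun \<mu> c n (a \<bullet> x + b) *\<^sub>R w) (\<lambda>x. 1 + (a \<bullet> w) * pl_slope \<mu> c n (a \<bullet> x + b))"
proof (induction n)
  case 0 then show ?case using pl_id by simp
next
  case (Suc n)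
  \<comment> \<open>The slope to the right of the last kink of the function with \<open>n\<close>
    pieces, and 0 if there is no kink yet.\<close>
  define m0 where "m0 = (case n of 0 \<Rightarrow> 0 | Suc k \<Rightarrow> c k)"
  have m0: "1 + (a \<bullet> w) * m0 > 0" using c by (cases n) (auto simp: m0_def)
  have lt: "real k * \<mu> < (1 + real k) * \<mu>" for k using \<mu> by (simp add: distrib_right)
  have 1: "pl_fun \<mu> c n s = pl_fun \<mu> c n (real n * \<mu>) + m0 * (s - real n * \<mu>)" if "s \<ge> real n * \<mu>" for s
  proof (cases n)
    case (Suc k)
    then have "s > real k * \<mu>" "\<not> (1 + real k) * \<mu> \<le> real k * \<mu>" using that lt[of k] by auto
    then show ?thesis using Suc by (simp add: m0_def algebra_simps)
  qed (simp add: m0_def)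
  have 2: "pl_slope \<mu> c n s = m0" if "s > real n * \<mu>" for s
  proof (cases n)
    case (Suc k)
    then have "s > real k * \<mu>" using that lt[of k] by auto
    then show ?thesis using Suc by (simp add: m0_def)
  qed (simp add: m0_def)
  from pl_add_kink[OF Suc.IH 1 2 m0 c[of n]] show ?case by simp
qed

lemma pl_fun_mult: "pl_fun \<mu> (\<lambda>k. r * c k) n s = r * pl_fun \<mu> c n s"
  by (induction n arbitrary: s) (auto simp: algebra_simps)

lemma pl_slope_mult: "pl_slope \<mu> (\<lambda>k. r * c k) n s = r * pl_slope \<mu> c n s"
  by (induction n arbitrary: s) auto

lemma abs_pl_slope_le: "(\<And>k. \<bar>c k\<bar> \<le> 1) \<Longrightarrow> \<bar>pl_slope \<mu> c n s\<bar> \<le> 1"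
  by (induction n arbitrary: s) auto

section \<open>Piecewise linear approximation of the sine\<close>

lemma sin_linear_approx: "\<bar>sin s - sin t - cos t * (s - t)\<bar> \<le> (s - t)\<^sup>2" if "t \<le> s" for s t :: real
proof (cases "t = s")
  case False
  with that obtain z where z: "t < z" "z < s" "sin s - sin t = (s - t) * cos z"
    using MVT2[of t s sin cos] by (auto intro!: derivative_eq_intros)
  have "\<bar>cos z - cos t\<bar> \<le> \<bar>z - t\<bar>"
  proof -
    obtain y where "cos z - cos t = (z - t) * (- sin y)"
      using MVT2[of t z cos "\<lambda>x. - sin x"] z by (auto intro!: derivative_eq_intros)
    then have "\<bar>cos z - cos t\<bar> = \<bar>z - t\<bar> * \<bar>sin y\<bar>" by (simp add: abs_mult)
    then show ?thesis by (simp add: mult_left_le)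
  qed
  moreover have "sin s - sin t - cos t * (s - t) = (s - t) * (cos z - cos t)" using z by (simp add: algebra_simps)
  ultimately show ?thesis using z by (simp add: abs_mult power2_eq_square mult_left_mono)
qed simp

lemma abs_cos_diff_le: "\<bar>cos s - cos t\<bar> \<le> \<bar>s - t\<bar>" for s t :: real
proof -
  have *: "\<bar>cos s - cos t\<bar> \<le> \<bar>s - t\<bar>" if ts: "t < s" for s t :: real
  proof -
    obtain y where "cos s - cos t = (s - t) * (- sin y)"
      using MVT2[of t s cos "\<lambda>x. - sin x"] ts by (auto intro!: derivative_eq_intros)
    then have "\<bar>cos s - cos t\<bar> = \<bar>s - t\<bar> * \<bar>sin y\<bar>" by (simp add: abs_mult)
    then show ?thesis by (simp add: mult_left_le)
  qed
  show ?thesis using *[of s t] *[of t s] by (cases s t rule: linorder_cases) (auto simp: abs_minus_commute)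
qed

text \<open>The slope on each cell is the cosine at its left end. A cell contributes an error of at
  most \<open>\<mu>\<close> times its length, and these add up to at most
  \<open>\<mu> * s\<close>.\<close>

lemma pl_fun_sin:
  assumes \<mu>: "\<mu> > 0" and c: "\<And>k. k < n \<Longrightarrow> c k = cos (real k * \<mu>)" and s: "0 \<le> s" "s \<le> real n * \<mu>"
  shows "\<bar>pl_fun \<mu> c n s - sin s\<bar> \<le> \<mu> * s" "s > 0 \<Longrightarrow> \<bar>pl_slope \<mu> c n s - cos s\<bar> \<le> \<mu>"
proof -
  have "\<bar>pl_fun \<mu> c n s - sin s\<bar> \<le> \<mu> * s \<and> (s > 0 \<longrightarrow> \<bar>pl_slope \<mu> c n s - cos s\<bar> \<le> \<mu>)"
    using c s
  proof (induction n arbitrary: s)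
    case (Suc n)
    show ?case
    proof (cases "s \<le> real n * \<mu>")
      case True
      then show ?thesis using Suc.IH[of s] Suc.prems by simp
    next
      case False
      define t where "t = real n * \<mu>"
      have t: "t \<ge> 0" "t < s" "s - t \<le> \<mu>" using False Suc.prems \<mu> by (auto simp: t_def algebra_simps)
      have "\<bar>pl_fun \<mu> c n t - sin t\<bar> \<le> \<mu> * t" using Suc.IH[of t] Suc.prems t by (simp add: t_def)
      moreover have "\<bar>sin s - sin t - cos t * (s - t)\<bar> \<le> \<mu> * (s - t)"
        by (rule order_trans[OF sin_linear_approx]) (use t in \<open>auto simp: power2_eq_square intro: mult_right_mono\<close>)
      ultimately have "\<bar>(pl_fun \<mu> c n t - sin t) - (sin s - sin t - cos t * (s - t))\<bar> \<le> \<mu> * t + \<mu> * (s - t)"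
        by linarith
      moreover have "\<bar>cos t - cos s\<bar> \<le> \<mu>" using abs_cos_diff_le[of t s] t by simp
      moreover have "pl_fun \<mu> c (Suc n) s - sin s = (pl_fun \<mu> c n t - sin t) - (sin s - sin t - cos t * (s - t))"
        "pl_slope \<mu> c (Suc n) s = cos t"
        using False Suc.prems(1)[of n] by (simp_all add: t_def)
      moreover have "\<mu> * t + \<mu> * (s - t) = \<mu> * s" by (simp add: algebra_simps)
      ultimately show ?thesis by (simp only:) simp
    qed
  qed simp
  then show "\<bar>pl_fun \<mu> c n s - sin s\<bar> \<le> \<mu> * s" "s > 0 \<Longrightarrow> \<bar>pl_slope \<mu> c n s - cos s\<bar> \<le> \<mu>" by auto
qed

lemma abs_ln_one_plus_le:
  fixes x :: real assumes "\<bar>x\<bar> \<le> 1 / 2" shows "\<bar>ln (1 + x)\<bar> \<le> 2 * \<bar>x\<bar>"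
proof -
  have "\<bar>ln (1 + x) - x\<bar> \<le> 2 * x\<^sup>2" using assms by (rule abs_ln_one_plus_x_minus_x_bound)
  also have "\<dots> = 2 * \<bar>x\<bar> * \<bar>x\<bar>" by (simp add: power2_eq_square)
  also have "\<dots> \<le> 1 * \<bar>x\<bar>" using assms by (intro mult_right_mono) auto
  finally show ?thesis by linarith
qed

section \<open>Superpositions of ridge fields\<close>

text \<open>The signs reflect that \<open>\<Psi>\<close> is the inverse of the flow of
  \<open>p\<close> over time \<open>h\<close>: \<open>x - \<Psi> x\<close> is close to
  \<open>h *\<^sub>R p x\<close>, and \<open>ln (J x)\<close> to \<open>- h * q x\<close>. Accuracy
  \<open>\<delta> * h\<close> is demanded on the ball, bounds of order \<open>h\<close>
  everywhere.\<close>

definition pl_step_near ::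
    "real \<Rightarrow> (real^'n \<Rightarrow> real^'n) \<Rightarrow> (real^'n \<Rightarrow> real) \<Rightarrow> real \<Rightarrow> real \<Rightarrow> real \<Rightarrow> bool" where
  "pl_step_near C p q \<delta> R h \<longleftrightarrow>
     (\<exists>\<Psi> J. pl \<Psi> J \<and> (\<forall>x. norm (\<Psi> x - x) \<le> C * h \<and> \<bar>ln (J x)\<bar> \<le> C * h) \<and>
        (\<forall>x. norm x \<le> R \<longrightarrow> norm (x - \<Psi> x - h *\<^sub>R p x) \<le> \<delta> * h \<and> \<bar>ln (J x) + h * q x\<bar> \<le> \<delta> * h))"

text \<open>\<open>flowable p q\<close>: the vector field \<open>p\<close> with divergence \<open>q\<close> is approximated by piecewise linear
  maps up to \<open>o(h)\<close> on balls. The global bound \<open>C\<close> must not depend on the ball.\<close>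

definition flowable :: "(real^'n \<Rightarrow> real^'n) \<Rightarrow> (real^'n \<Rightarrow> real) \<Rightarrow> bool" where
  "flowable p q \<longleftrightarrow> continuous_on UNIV p \<and> continuous_on UNIV q \<and>
     (\<exists>C\<ge>0. \<forall>\<delta>>0. \<forall>R. \<exists>h0>0. \<forall>h. 0 < h \<and> h \<le> h0 \<longrightarrow> pl_step_near C p q \<delta> R h)"

lemma pl_fun_nonpos: "0 \<le> \<mu> \<Longrightarrow> s \<le> 0 \<Longrightarrow> pl_fun \<mu> c n s = 0"
  by (induction n) (auto intro: order_trans)

text \<open>Along \<open>a\<close> the sine is replaced by a piecewise linear profile that is
  accurate on the range of arguments seen by the ball and constant outside a bounded interval.
  Displacement and Jacobian then have global bounds independent of the ball.\<close>

lemma flowable_sin: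
  fixes a w :: "real^'n"
  shows "flowable (\<lambda>x. sin (a \<bullet> x + b) *\<^sub>R w) (\<lambda>x. (a \<bullet> w) * cos (a \<bullet> x + b))"
proof -
  define k where "k = a \<bullet> w"
  define C where "C = 2 * norm w + 2 * \<bar>k\<bar>"
  have main: "\<exists>h0>0. \<forall>h. 0 < h \<and> h \<le> h0 \<longrightarrow>
      pl_step_near C (\<lambda>x. sin (a \<bullet> x + b) *\<^sub>R w) (\<lambda>x. k * cos (a \<bullet> x + b)) \<delta> R h" if \<delta>: "\<delta> > 0" for \<delta> R
  proof -
    \<comment> \<open>The profiles vanish on the negative half line. A phase shift by a multiple of
      \<open>2 * pi\<close> leaves the field unchanged and brings the arguments into the interval
      from 1 to \<open>S\<close> on the whole ball.\<close>
    obtain n :: nat where n: "(norm a * \<bar>R\<bar> + 1 - b) / (2 * pi) < real n" using reals_Archimedean2 by blast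
    define b' where "b' = b + 2 * real n * pi"
    have b': "norm a * \<bar>R\<bar> + 1 \<le> b'" using n by (simp add: b'_def field_simps)
    have per: "sin (a \<bullet> x + b) = sin (a \<bullet> x + b')" "cos (a \<bullet> x + b) = cos (a \<bullet> x + b')" for x
      using sin_add[of "a \<bullet> x + b" "2 * real n * pi"] cos_add[of "a \<bullet> x + b" "2 * real n * pi"]
      by (simp_all add: b'_def add.assoc)
    define S where "S = norm a * \<bar>R\<bar> + \<bar>b'\<bar> + 1"
    have S: "S > 0" by (simp add: S_def add_nonneg_pos)
    \<comment> \<open>Three conditions on the mesh: the profile stays within 2 in absolute value,
      the displacement error is at most \<open>\<delta> * h\<close>, and the slope error takes half
      of the tolerance for the Jacobian.\<close>
    define \<eta> where "\<eta> = min (1 / S) (min (\<delta> / ((norm w + 1) * S)) (\<delta> / (2 * (\<bar>k\<bar> + 1))))"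
    have w1: "norm w + 1 > 0" by (simp add: add_nonneg_pos)
    have \<eta>: "\<eta> > 0" using S \<delta> w1 by (simp add: \<eta>_def)
    obtain N :: nat where N: "S / \<eta> < real N" using reals_Archimedean2 by blast
    then have Npos: "real N > 0" using S \<eta> by (meson divide_pos_pos less_trans)
    define \<mu> where "\<mu> = S / real N"
    have \<mu>: "\<mu> > 0" "\<mu> < \<eta>" "real N * \<mu> = S"
      using S \<eta> N Npos by (auto simp: \<mu>_def field_simps)
    have \<mu>S: "\<mu> * S \<le> 1" "norm w * (\<mu> * S) \<le> \<delta>" "\<bar>k\<bar> * \<mu> \<le> \<delta> / 2"
    proof -
      have "\<mu> \<le> 1 / S" "\<mu> \<le> \<delta> / ((norm w + 1) * S)" "\<mu> \<le> \<delta> / (2 * (\<bar>k\<bar> + 1))"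
        using \<mu>(2) by (auto simp: \<eta>_def)
      then have 1: "\<mu> * S \<le> 1" "(norm w + 1) * (\<mu> * S) \<le> \<delta>" "(\<bar>k\<bar> + 1) * \<mu> \<le> \<delta> / 2"
        using S w1 by (simp_all add: pos_le_divide_eq mult.commute mult.left_commute)
      then show "\<mu> * S \<le> 1" by simp
      have "0 \<le> \<mu> * S" using \<mu> S by simp
      then show "norm w * (\<mu> * S) \<le> \<delta>" using 1(2) by (simp add: distrib_right)
      show "\<bar>k\<bar> * \<mu> \<le> \<delta> / 2" using 1(3) \<mu>(1) by (simp add: distrib_right)
    qed
    define c where "c i = (if i < N then cos (real i * \<mu>) else 0)" for i
    have c1: "\<bar>c i\<bar> \<le> 1" for i by (simp add: c_def)
    \<comment> \<open>One piece more than the mesh has cells: its slope is \<open>c N = 0\<close>,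
      so the profile is constant beyond \<open>S = real N * \<mu>\<close>.\<close>
    define G where "G s = pl_fun \<mu> c (Suc N) s" for s
    define G' where "G' s = pl_slope \<mu> c (Suc N) s" for s
    have G'1: "\<bar>G' s\<bar> \<le> 1" for s unfolding G'_def by (rule abs_pl_slope_le[OF c1])
    have Gsin: "\<bar>G s - sin s\<bar> \<le> \<mu> * S" if "0 \<le> s" "s \<le> S" for s
    proof -
      have "\<bar>pl_fun \<mu> c N s - sin s\<bar> \<le> \<mu> * s"
        by (rule pl_fun_sin(1)) (use that \<mu> in \<open>auto simp: c_def\<close>)
      also have "\<dots> \<le> \<mu> * S" using that \<mu> by simp
      finally show ?thesis using that by (simp add: G_def \<mu>(3))
    qed
    have Gcos: "\<bar>G' s - cos s\<bar> \<le> \<mu>" if "0 < s" "s \<le> S" for s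
    proof -
      have "\<bar>pl_slope \<mu> c N s - cos s\<bar> \<le> \<mu>"
        by (rule pl_fun_sin(2)) (use that \<mu> in \<open>auto simp: c_def\<close>)
      then show ?thesis using that by (simp add: G'_def \<mu>(3))
    qed
    have G2': "\<bar>G s\<bar> \<le> 2" if "s \<le> S" for s
    proof (cases "s \<le> 0")
      case True then show ?thesis using \<mu>(1) pl_fun_nonpos[of \<mu> s c "Suc N"] by (simp add: G_def del: pl_fun.simps)
    next
      case False
      then show ?thesis using Gsin[of s] that \<mu>S(1) abs_sin_le_one[of s] by linarith
    qed
    have G2: "\<bar>G s\<bar> \<le> 2" for s
    proof (cases "s \<le> S")
      case False
      then have "G s = G S" by (simp add: G_def \<mu>(3) c_def)
      then show ?thesis using G2'[of S] by simp
    qed (rule G2')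
    \<comment> \<open>The first bound keeps \<open>1 + y x\<close> above 1/2, where the logarithm is
      linearised; the second makes the quadratic remainder at most
      \<open>\<delta> / 2 * h\<close>.\<close>
    define h0 where "h0 = min (1 / (2 * (\<bar>k\<bar> + 1))) (\<delta> / (4 * k\<^sup>2 + 4))"
    have kk: "4 * k\<^sup>2 + 4 > 0" by (simp add: add_nonneg_pos)
    have h0: "h0 > 0" using \<delta> kk by (simp add: h0_def)
    show ?thesis
    proof (intro exI[of _ h0] conjI allI impI h0)
      fix h assume h: "0 < h \<and> h \<le> h0"
      have kh: "\<bar>k\<bar> * h \<le> 1 / 2"
      proof -
        have "h \<le> 1 / (2 * (\<bar>k\<bar> + 1))" using h by (simp add: h0_def)
        then have "(\<bar>k\<bar> + 1) * h \<le> 1 / 2" by (simp add: field_simps)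
        then show ?thesis using h by (simp add: distrib_right)
      qed
      have kkh: "2 * k\<^sup>2 * h \<le> \<delta> / 2"
      proof -
        have "h \<le> \<delta> / (4 * k\<^sup>2 + 4)" using h by (simp add: h0_def)
        then have "(4 * k\<^sup>2 + 4) * h \<le> \<delta>" using kk by (simp add: field_simps)
        then show ?thesis using h by (simp add: distrib_right)
      qed
      define \<Psi> where "\<Psi> x = x + (- h * G (a \<bullet> x + b')) *\<^sub>R w" for x
      define y where "y x = k * (- h * G' (a \<bullet> x + b'))" for x
      have yle: "\<bar>y x\<bar> \<le> \<bar>k\<bar> * h" for x
        using G'1[of "a \<bullet> x + b'"] h by (simp add: y_def abs_mult mult_left_mono mult_left_le)
      have "pl \<Psi> (\<lambda>x. 1 + y x)"
      proof -
        have "1 + (a \<bullet> w) * (- h * c i) > 0" for i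
        proof -
          have "\<bar>(a \<bullet> w) * (- h * c i)\<bar> = (\<bar>k\<bar> * h) * \<bar>c i\<bar>" using h by (simp add: abs_mult k_def)
          also have "\<dots> \<le> (\<bar>k\<bar> * h) * 1" using c1[of i] h by (intro mult_left_mono) auto
          finally show ?thesis using kh by linarith
        qed
        from pl_ridge[where c = "\<lambda>i. - h * c i" and n = "Suc N" and b = b', OF \<mu>(1) this] show ?thesis
          unfolding pl_fun_mult pl_slope_mult G_def[symmetric] G'_def[symmetric]
          by (simp only: \<Psi>_def[abs_def] y_def[abs_def] k_def)
      qed
      moreover have "norm (\<Psi> x - x) \<le> C * h" for x
      proof -
        have "norm (\<Psi> x - x) = h * \<bar>G (a \<bullet> x + b')\<bar> * norm w" using h by (simp add: \<Psi>_def abs_mult)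
        also have "\<dots> \<le> h * 2 * norm w" using G2 h by (intro mult_right_mono mult_left_mono) auto
        also have "\<dots> \<le> C * h" using h by (simp add: C_def algebra_simps)
        finally show ?thesis .
      qed
      moreover have "\<bar>ln (1 + y x)\<bar> \<le> C * h" for x
      proof -
        have "\<bar>ln (1 + y x)\<bar> \<le> 2 * \<bar>y x\<bar>" by (rule abs_ln_one_plus_le) (use yle[of x] kh in linarith)
        also have "\<dots> \<le> 2 * (\<bar>k\<bar> * h)" using yle by simp
        also have "\<dots> \<le> C * h" using h by (simp add: C_def algebra_simps)
        finally show ?thesis .
      qed
      moreover have "norm (x - \<Psi> x - h *\<^sub>R (sin (a \<bullet> x + b) *\<^sub>R w)) \<le> \<delta> * h \<and>
              \<bar>ln (1 + y x) + h * (k * cos (a \<bullet> x + b))\<bar> \<le> \<delta> * h" if x: "norm x \<le> R" for x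
      proof -
        define s where "s = a \<bullet> x + b'"
        have "\<bar>a \<bullet> x\<bar> \<le> norm a * norm x" by (rule Cauchy_Schwarz_ineq2)
        also have "\<dots> \<le> norm a * \<bar>R\<bar>" using x by (intro mult_left_mono) auto
        finally have s: "0 < s" "s \<le> S" using b' by (auto simp: s_def S_def)
        have "x - \<Psi> x - h *\<^sub>R (sin (a \<bullet> x + b) *\<^sub>R w) = (h * (G s - sin s)) *\<^sub>R w"
          unfolding per[of x] \<Psi>_def s_def[symmetric] by (simp add: algebra_simps)
        then have "norm (x - \<Psi> x - h *\<^sub>R (sin (a \<bullet> x + b) *\<^sub>R w)) = h * \<bar>G s - sin s\<bar> * norm w"
          using h by (simp add: abs_mult)
        also have "\<dots> \<le> h * (\<mu> * S) * norm w"
          using Gsin[of s] s h by (intro mult_right_mono mult_left_mono) auto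
        also have "\<dots> \<le> \<delta> * h" using \<mu>S(2) h by (simp add: mult.commute mult.left_commute)
        finally have 1: "norm (x - \<Psi> x - h *\<^sub>R (sin (a \<bullet> x + b) *\<^sub>R w)) \<le> \<delta> * h" .
        have "\<bar>ln (1 + y x) - y x\<bar> \<le> 2 * (y x)\<^sup>2"
          by (rule abs_ln_one_plus_x_minus_x_bound) (use yle[of x] kh in linarith)
        also have "\<dots> \<le> 2 * (\<bar>k\<bar> * h)\<^sup>2" using power_mono[OF yle[of x], of 2] by simp
        also have "\<dots> = (2 * k\<^sup>2 * h) * h" by (simp add: power2_eq_square)
        also have "\<dots> \<le> \<delta> / 2 * h" using kkh h by (intro mult_right_mono) auto
        finally have 2: "\<bar>ln (1 + y x) - y x\<bar> \<le> \<delta> / 2 * h" .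
        have "y x + h * (k * cos (a \<bullet> x + b)) = - (h * k * (G' s - cos s))"
          unfolding per[of x] y_def s_def[symmetric] by (simp add: algebra_simps)
        then have "\<bar>y x + h * (k * cos (a \<bullet> x + b))\<bar> = h * \<bar>k\<bar> * \<bar>G' s - cos s\<bar>" using h by (simp add: abs_mult)
        also have "\<dots> \<le> h * \<bar>k\<bar> * \<mu>" using Gcos[of s] s h by (intro mult_left_mono) auto
        also have "\<dots> = (\<bar>k\<bar> * \<mu>) * h" by simp
        also have "\<dots> \<le> \<delta> / 2 * h" using \<mu>S(3) h by (intro mult_right_mono) auto
        finally have 3: "\<bar>y x + h * (k * cos (a \<bullet> x + b))\<bar> \<le> \<delta> / 2 * h" .
        have "\<delta> / 2 * h + \<delta> / 2 * h = \<delta> * h" by simp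
        then show ?thesis using 1 2 3 by (intro conjI) linarith+
      qed
      ultimately show "pl_step_near C (\<lambda>x. sin (a \<bullet> x + b) *\<^sub>R w) (\<lambda>x. k * cos (a \<bullet> x + b)) \<delta> R h"
        unfolding pl_step_near_def by blast
    qed
  qed
  have "C \<ge> 0" by (simp add: C_def)
  with main have "\<exists>C\<ge>0. \<forall>\<delta>>0. \<forall>R. \<exists>h0>0. \<forall>h. 0 < h \<and> h \<le> h0 \<longrightarrow>
      pl_step_near C (\<lambda>x. sin (a \<bullet> x + b) *\<^sub>R w) (\<lambda>x. k * cos (a \<bullet> x + b)) \<delta> R h" by blast
  moreover have "continuous_on UNIV (\<lambda>x. sin (a \<bullet> x + b) *\<^sub>R w)" "continuous_on UNIV (\<lambda>x. k * cos (a \<bullet> x + b))"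
    by (intro continuous_intros)+
  ultimately show ?thesis
    unfolding flowable_def k_def[symmetric] by blast
qed

text \<open>The second step starts at \<open>\<Psi>1 x\<close> instead of \<open>x\<close>. This
  displacement is at most \<open>C1 * h\<close>, so uniform continuity of \<open>p2\<close> and
  \<open>q2\<close> on the ball of radius \<open>R + 1\<close> controls the change. The tolerance is
  split into thirds: two for the steps, one for this shift.\<close>

lemma flowable_add:
  assumes "flowable p1 q1" "flowable p2 q2"
  shows "flowable (\<lambda>x. p1 x + p2 x) (\<lambda>x. q1 x + q2 x)"
proof -
  from assms(1) obtain C1 where C1: "C1 \<ge> 0" and
    f1: "\<And>\<delta> R. \<delta> > 0 \<Longrightarrow> \<exists>h0>0. \<forall>h. 0 < h \<and> h \<le> h0 \<longrightarrow> pl_step_near C1 p1 q1 \<delta> R h"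
    unfolding flowable_def by blast
  from assms(2) obtain C2 where C2: "C2 \<ge> 0" and
    f2: "\<And>\<delta> R. \<delta> > 0 \<Longrightarrow> \<exists>h0>0. \<forall>h. 0 < h \<and> h \<le> h0 \<longrightarrow> pl_step_near C2 p2 q2 \<delta> R h"
    unfolding flowable_def by blast
  have cont: "continuous_on UNIV p1" "continuous_on UNIV q1" "continuous_on UNIV p2" "continuous_on UNIV q2"
    using assms by (auto simp: flowable_def)
  have main: "\<exists>h0>0. \<forall>h. 0 < h \<and> h \<le> h0 \<longrightarrow>
      pl_step_near (C1 + C2) (\<lambda>x. p1 x + p2 x) (\<lambda>x. q1 x + q2 x) \<delta> R h" if \<delta>: "\<delta> > 0" for \<delta> R
  proof -
    have d3: "\<delta> / 3 > 0" using \<delta> by simp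
    obtain h1 where h1: "h1 > 0" and F1: "\<And>h. 0 < h \<Longrightarrow> h \<le> h1 \<Longrightarrow> pl_step_near C1 p1 q1 (\<delta> / 3) R h"
      using f1[OF d3, of R] by blast
    obtain h2 where h2: "h2 > 0" and F2: "\<And>h. 0 < h \<Longrightarrow> h \<le> h2 \<Longrightarrow> pl_step_near C2 p2 q2 (\<delta> / 3) (R + 1) h"
      using f2[OF d3, of "R + 1"] by blast
    have "uniformly_continuous_on (cball 0 (R + 1)) p2" "uniformly_continuous_on (cball 0 (R + 1)) q2"
      by (auto intro!: compact_uniformly_continuous continuous_on_subset[OF cont(3)] continuous_on_subset[OF cont(4)])
    then have U: "\<forall>e>0. \<exists>d>0. \<forall>x\<in>cball 0 (R + 1). \<forall>y\<in>cball 0 (R + 1). dist y x < d \<longrightarrow> dist (p2 y) (p2 x) < e"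
        "\<forall>e>0. \<exists>d>0. \<forall>x\<in>cball 0 (R + 1). \<forall>y\<in>cball 0 (R + 1). dist y x < d \<longrightarrow> dist (q2 y) (q2 x) < e"
      unfolding uniformly_continuous_on_def by (simp_all add: dist_commute)
    obtain e1 where e1: "e1 > 0"
      and up: "\<And>x y. x \<in> cball 0 (R + 1) \<Longrightarrow> y \<in> cball 0 (R + 1) \<Longrightarrow> dist y x < e1 \<Longrightarrow> dist (p2 y) (p2 x) < \<delta> / 3"
      using U(1)[rule_format, OF d3] by blast
    obtain e2 where e2: "e2 > 0"
      and uq: "\<And>x y. x \<in> cball 0 (R + 1) \<Longrightarrow> y \<in> cball 0 (R + 1) \<Longrightarrow> dist y x < e2 \<Longrightarrow> dist (q2 y) (q2 x) < \<delta> / 3"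
      using U(2)[rule_format, OF d3] by blast
    note e = e1 e2
    define h0 where "h0 = min (min h1 h2) (min 1 (min e1 e2) / (2 * (C1 + 1)))"
    have h0: "h0 > 0" using h1 h2 e C1 by (simp add: h0_def)
    show ?thesis
    proof (intro exI[of _ h0] conjI allI impI h0)
      fix h assume h: "0 < h \<and> h \<le> h0"
      then have hh: "0 < h" "h \<le> h1" "h \<le> h2" by (auto simp: h0_def)
      have "h \<le> min 1 (min e1 e2) / (2 * (C1 + 1))" using h by (simp add: h0_def)
      then have "h * (2 * (C1 + 1)) \<le> min 1 (min e1 e2)" using C1 by (simp add: pos_le_divide_eq)
      then have "2 * (C1 * h) + 2 * h \<le> 1" "2 * (C1 * h) + 2 * h \<le> e1" "2 * (C1 * h) + 2 * h \<le> e2"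
        by (simp_all add: algebra_simps)
      then have C1h: "C1 * h < 1" "C1 * h < e1" "C1 * h < e2"
        using hh(1) mult_nonneg_nonneg[OF C1, of h] by linarith+
      from F1[OF hh(1,2)] obtain \<Psi>1 J1 where pl1: "pl \<Psi>1 J1" and g1: "\<And>x. norm (\<Psi>1 x - x) \<le> C1 * h" "\<And>x. \<bar>ln (J1 x)\<bar> \<le> C1 * h"
        and l1: "\<And>x. norm x \<le> R \<Longrightarrow> norm (x - \<Psi>1 x - h *\<^sub>R p1 x) \<le> \<delta> / 3 * h" "\<And>x. norm x \<le> R \<Longrightarrow> \<bar>ln (J1 x) + h * q1 x\<bar> \<le> \<delta> / 3 * h"
        unfolding pl_step_near_def by blast
      from F2[OF hh(1,3)] obtain \<Psi>2 J2 where pl2: "pl \<Psi>2 J2" and g2: "\<And>x. norm (\<Psi>2 x - x) \<le> C2 * h" "\<And>x. \<bar>ln (J2 x)\<bar> \<le> C2 * h"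
        and l2: "\<And>x. norm x \<le> R + 1 \<Longrightarrow> norm (x - \<Psi>2 x - h *\<^sub>R p2 x) \<le> \<delta> / 3 * h" "\<And>x. norm x \<le> R + 1 \<Longrightarrow> \<bar>ln (J2 x) + h * q2 x\<bar> \<le> \<delta> / 3 * h"
        unfolding pl_step_near_def by blast
      have ln: "ln (J2 (\<Psi>1 x) * J1 x) = ln (J2 (\<Psi>1 x)) + ln (J1 x)" for x
        using pl_pos[OF pl1] pl_pos[OF pl2] by (simp add: ln_mult less_imp_neq[symmetric])
      have "pl (\<lambda>x. \<Psi>2 (\<Psi>1 x)) (\<lambda>x. J2 (\<Psi>1 x) * J1 x)" by (rule pl_comp[OF pl1 pl2])
      moreover have "norm (\<Psi>2 (\<Psi>1 x) - x) \<le> (C1 + C2) * h" for x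
        using norm_triangle_le[of "\<Psi>2 (\<Psi>1 x) - \<Psi>1 x" "\<Psi>1 x - x" "(C1 + C2) * h"] g1(1)[of x] g2(1)[of "\<Psi>1 x"]
        by (simp add: distrib_right)
      moreover have "\<bar>ln (J2 (\<Psi>1 x) * J1 x)\<bar> \<le> (C1 + C2) * h" for x
        unfolding ln using g1(2)[of x] g2(2)[of "\<Psi>1 x"] by (simp add: distrib_right)
      moreover have "norm (x - \<Psi>2 (\<Psi>1 x) - h *\<^sub>R (p1 x + p2 x)) \<le> \<delta> * h \<and> \<bar>ln (J2 (\<Psi>1 x) * J1 x) + h * (q1 x + q2 x)\<bar> \<le> \<delta> * h"
        if x: "norm x \<le> R" for x
      proof -
        define y where "y = \<Psi>1 x"
        have yx: "dist y x < 1" "dist y x < e1" "dist y x < e2"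
          using g1(1)[of x] C1h by (auto simp: y_def dist_norm)
        have y: "norm y \<le> R + 1" using x yx norm_triangle_ineq[of "y - x" x] by (simp add: dist_norm)
        have P: "norm (p2 y - p2 x) \<le> \<delta> / 3" "\<bar>q2 y - q2 x\<bar> \<le> \<delta> / 3"
          using up[of x y] uq[of x y] x y yx by (auto simp: dist_norm)
        have "norm (x - \<Psi>2 y - h *\<^sub>R (p1 x + p2 x))
          = norm ((x - \<Psi>1 x - h *\<^sub>R p1 x) + ((y - \<Psi>2 y - h *\<^sub>R p2 y) + h *\<^sub>R (p2 y - p2 x)))"
          by (simp add: y_def algebra_simps)
        also have "\<dots> \<le> norm (x - \<Psi>1 x - h *\<^sub>R p1 x) + (norm (y - \<Psi>2 y - h *\<^sub>R p2 y) + norm (h *\<^sub>R (p2 y - p2 x)))"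
          by (intro order_trans[OF norm_triangle_ineq] add_left_mono norm_triangle_ineq)
        also have "\<dots> \<le> \<delta> / 3 * h + (\<delta> / 3 * h + h * (\<delta> / 3))"
          using l1(1)[OF x] l2(1)[OF y] P(1) hh(1) by (intro add_mono) (simp_all add: mult_left_mono)
        also have "\<dots> = \<delta> * h" by simp
        finally have 1: "norm (x - \<Psi>2 y - h *\<^sub>R (p1 x + p2 x)) \<le> \<delta> * h" .
        have "\<bar>h * (q2 y - q2 x)\<bar> \<le> h * (\<delta> / 3)" using P(2) h by (simp add: abs_mult mult_left_mono)
        moreover have "ln (J2 y) + ln (J1 x) + h * (q1 x + q2 x)
          = (ln (J1 x) + h * q1 x) + (ln (J2 y) + h * q2 y) - h * (q2 y - q2 x)" by (simp add: algebra_simps)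
        ultimately have "\<bar>ln (J2 y) + ln (J1 x) + h * (q1 x + q2 x)\<bar> \<le> \<delta> / 3 * h + \<delta> / 3 * h + h * (\<delta> / 3)"
          using l1(2)[OF x] l2(2)[OF y] by linarith
        then show ?thesis using 1 by (simp add: ln y_def)
      qed
      ultimately show "pl_step_near (C1 + C2) (\<lambda>x. p1 x + p2 x) (\<lambda>x. q1 x + q2 x) \<delta> R h"
        unfolding pl_step_near_def by blast
    qed
  qed
  have "C1 + C2 \<ge> 0" using C1 C2 by simp
  with main have "\<exists>C\<ge>0. \<forall>\<delta>>0. \<forall>R. \<exists>h0>0. \<forall>h. 0 < h \<and> h \<le> h0 \<longrightarrow>
      pl_step_near C (\<lambda>x. p1 x + p2 x) (\<lambda>x. q1 x + q2 x) \<delta> R h" by blast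
  then show ?thesis
    unfolding flowable_def by (intro conjI continuous_on_add cont)
qed

lemma flowable_zero: "flowable (\<lambda>_. 0) (\<lambda>_. 0)"
  using flowable_sin[of 0 0 0] by simp

section \<open>Trigonometric polynomials and their uniform limits\<close>

text \<open>The second argument is the gradient of the first. The phase \<open>b\<close> covers
  cosines, and \<open>a = 0\<close> with \<open>b = pi / 2\<close> gives the constants.\<close>

inductive trig_poly :: "(real^'n \<Rightarrow> real) \<Rightarrow> (real^'n \<Rightarrow> real^'n) \<Rightarrow> bool" where
  sin: "trig_poly (\<lambda>x. \<alpha> * sin (a \<bullet> x + b)) (\<lambda>x. (\<alpha> * cos (a \<bullet> x + b)) *\<^sub>R a)"
| add: "trig_poly f F \<Longrightarrow> trig_poly g G \<Longrightarrow> trig_poly (\<lambda>x. f x + g x) (\<lambda>x. F x + G x)"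

lemma flowable_trig_poly: "trig_poly f F \<Longrightarrow> flowable (\<lambda>x. f x *\<^sub>R w) (\<lambda>x. F x \<bullet> w)"
proof (induction rule: trig_poly.induct)
  case (sin \<alpha> a b)
  show ?case using flowable_sin[of a b "\<alpha> *\<^sub>R w"] by (simp add: ac_simps)
next
  case (add f F g G)
  then show ?case using flowable_add[OF add.IH] by (simp add: scaleR_left_distrib inner_left_distrib)
qed

text \<open>By \<open>2 * sin u * sin v = cos (u - v) - cos (u + v)\<close>, with the cosines
  written as sines shifted by \<open>pi / 2\<close>. Products lead to polynomials, and so to the
  exponentials and reciprocals in the softmax weights.\<close>

lemma trig_poly_mult:
  assumes "trig_poly f F" "trig_poly g G"
  shows "trig_poly (\<lambda>x. f x * g x) (\<lambda>x. f x *\<^sub>R G x + g x *\<^sub>R F x)"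
  using assms
proof (induction arbitrary: g G rule: trig_poly.induct)
  case (sin \<alpha> a b)
  show ?case using sin
  proof (induction rule: trig_poly.induct)
    case (sin \<beta> c d)
    define \<gamma> where "\<gamma> = \<alpha> * \<beta> / 2"
    have "trig_poly (\<lambda>x. \<gamma> * sin ((a - c) \<bullet> x + (b - d + pi / 2)) + \<gamma> * sin ((a + c) \<bullet> x + (b + d - pi / 2)))
      (\<lambda>x. (\<gamma> * cos ((a - c) \<bullet> x + (b - d + pi / 2))) *\<^sub>R (a - c) + (\<gamma> * cos ((a + c) \<bullet> x + (b + d - pi / 2))) *\<^sub>R (a + c))"
      by (intro trig_poly.intros)
    also have "(\<lambda>x. \<gamma> * sin ((a - c) \<bullet> x + (b - d + pi / 2)) + \<gamma> * sin ((a + c) \<bullet> x + (b + d - pi / 2)))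
       = (\<lambda>x. \<alpha> * sin (a \<bullet> x + b) * (\<beta> * sin (c \<bullet> x + d)))"
    proof
      fix x
      define u v where "u = a \<bullet> x + b" and "v = c \<bullet> x + d"
      have "(a - c) \<bullet> x + (b - d + pi / 2) = (u - v) + pi / 2" "(a + c) \<bullet> x + (b + d - pi / 2) = (u + v) - pi / 2"
        by (auto simp: u_def v_def inner_diff_left inner_add_left)
      then show "\<gamma> * sin ((a - c) \<bullet> x + (b - d + pi / 2)) + \<gamma> * sin ((a + c) \<bullet> x + (b + d - pi / 2)) = \<alpha> * sin (a \<bullet> x + b) * (\<beta> * sin (c \<bullet> x + d))"
        unfolding u_def[symmetric] v_def[symmetric]
        by (simp only: sin_add[of _ "pi / 2"] sin_diff[of _ "pi / 2"]) (simp add: cos_diff cos_add \<gamma>_def field_simps)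
    qed
    also have "(\<lambda>x. (\<gamma> * cos ((a - c) \<bullet> x + (b - d + pi / 2))) *\<^sub>R (a - c) + (\<gamma> * cos ((a + c) \<bullet> x + (b + d - pi / 2))) *\<^sub>R (a + c))
      = (\<lambda>x. (\<alpha> * sin (a \<bullet> x + b)) *\<^sub>R ((\<beta> * cos (c \<bullet> x + d)) *\<^sub>R c) + (\<beta> * sin (c \<bullet> x + d)) *\<^sub>R ((\<alpha> * cos (a \<bullet> x + b)) *\<^sub>R a))"
    proof
      fix x
      define u v where "u = a \<bullet> x + b" and "v = c \<bullet> x + d"
      have 1: "(a - c) \<bullet> x + (b - d + pi / 2) = (u - v) + pi / 2" "(a + c) \<bullet> x + (b + d - pi / 2) = (u + v) - pi / 2"
        by (auto simp: u_def v_def inner_diff_left inner_add_left)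
      define A B where "A = \<gamma> * cos (u - v + pi / 2)" and "B = \<gamma> * cos (u + v - pi / 2)"
      have 2: "A + B = \<beta> * sin v * (\<alpha> * cos u)" "B - A = \<alpha> * sin u * (\<beta> * cos v)"
        unfolding A_def B_def by (simp_all only: cos_add[of _ "pi / 2"] cos_diff[of _ "pi / 2"])
          (simp_all add: sin_diff sin_add \<gamma>_def field_simps)
      have "A *\<^sub>R (a - c) + B *\<^sub>R (a + c) = (B - A) *\<^sub>R c + (A + B) *\<^sub>R a"
        by (simp add: algebra_simps)
      then show "(\<gamma> * cos ((a - c) \<bullet> x + (b - d + pi / 2))) *\<^sub>R (a - c) + (\<gamma> * cos ((a + c) \<bullet> x + (b + d - pi / 2))) *\<^sub>R (a + c)
        = (\<alpha> * sin (a \<bullet> x + b)) *\<^sub>R ((\<beta> * cos (c \<bullet> x + d)) *\<^sub>R c) + (\<beta> * sin (c \<bullet> x + d)) *\<^sub>R ((\<alpha> * cos (a \<bullet> x + b)) *\<^sub>R a)"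
        unfolding 1 2 u_def[symmetric] v_def[symmetric] A_def[symmetric] B_def[symmetric] by simp
    qed
    finally show ?case .
  next
    case (add g G k K)
    from trig_poly.add[OF add.IH] show ?case by (simp add: algebra_simps)
  qed
next
  case (add f F k K)
  from trig_poly.add[OF add.IH(1)[OF add.prems] add.IH(2)[OF add.prems]] show ?case by (simp add: algebra_simps)
qed

lemma trig_poly_bounded:
  assumes "trig_poly f F"
  shows "\<exists>B. \<forall>x. \<bar>f x\<bar> \<le> B \<and> norm (F x) \<le> B"
  using assms
proof (induction rule: trig_poly.induct)
  case (sin \<alpha> a b)
  have 1: "\<bar>\<alpha> * sin (a \<bullet> x + b)\<bar> \<le> \<bar>\<alpha>\<bar>" for x by (simp add: abs_mult mult_left_le)
  have 2: "norm ((\<alpha> * cos (a \<bullet> x + b)) *\<^sub>R a) \<le> \<bar>\<alpha>\<bar> * norm a" for x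
    by (simp add: abs_mult mult_left_le mult_right_mono)
  show ?case
    by (intro exI[of _ "\<bar>\<alpha>\<bar> + \<bar>\<alpha>\<bar> * norm a"] allI conjI add_increasing add_increasing2 1 2) auto
next
  case (add f F g G)
  then obtain B C where "\<And>x. \<bar>f x\<bar> \<le> B \<and> norm (F x) \<le> B" "\<And>x. \<bar>g x\<bar> \<le> C \<and> norm (G x) \<le> C" by blast
  then show ?case
    by (intro exI[of _ "B + C"]) (metis abs_triangle_ineq add_mono norm_triangle_ineq order_trans)
qed

text \<open>Uniform \<open>C\<^sup>1\<close> approximability on the whole space; \<open>F\<close> plays the role of the gradient of \<open>f\<close>.\<close>

definition trig_approx :: "(real^'n \<Rightarrow> real) \<Rightarrow> (real^'n \<Rightarrow> real^'n) \<Rightarrow> bool" where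
  "trig_approx f F \<longleftrightarrow> (\<forall>\<delta>>0. \<exists>p P. trig_poly p P \<and> (\<forall>x. \<bar>f x - p x\<bar> \<le> \<delta> \<and> norm (F x - P x) \<le> \<delta>))"

lemma trig_poly_imp_approx: "trig_poly f F \<Longrightarrow> trig_approx f F"
  unfolding trig_approx_def by force

lemma trig_approx_const: "trig_approx (\<lambda>_. c) (\<lambda>_. 0)"
  using trig_poly_imp_approx[OF trig_poly.sin[of c 0 "pi / 2"]] by simp

lemma trig_approx_bounded:
  assumes "trig_approx f F"
  shows "\<exists>B>0. \<forall>x. \<bar>f x\<bar> \<le> B \<and> norm (F x) \<le> B"
proof -
  obtain p P where p: "trig_poly p P" "\<And>x. \<bar>f x - p x\<bar> \<le> 1 \<and> norm (F x - P x) \<le> 1"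
    using assms unfolding trig_approx_def by (metis zero_less_one)
  obtain B where B: "\<And>x. \<bar>p x\<bar> \<le> B \<and> norm (P x) \<le> B" using trig_poly_bounded[OF p(1)] by blast
  have "B + 1 > 0" using B[of 0] by linarith
  moreover have "\<bar>f x\<bar> \<le> B + 1 \<and> norm (F x) \<le> B + 1" for x
    using p(2)[of x] B[of x] norm_triangle_sub[of "F x" "P x"] by linarith
  ultimately show ?thesis by blast
qed

lemma trig_approx_add:
  assumes "trig_approx f F" "trig_approx g G"
  shows "trig_approx (\<lambda>x. f x + g x) (\<lambda>x. F x + G x)"
  unfolding trig_approx_def
proof (intro allI impI)
  fix \<delta> :: real assume "\<delta> > 0"
  then have d: "\<delta> / 2 > 0" by simp
  obtain p P where p: "trig_poly p P" "\<And>x. \<bar>f x - p x\<bar> \<le> \<delta> / 2 \<and> norm (F x - P x) \<le> \<delta> / 2"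
    using assms(1) d unfolding trig_approx_def by metis
  obtain q Q where q: "trig_poly q Q" "\<And>x. \<bar>g x - q x\<bar> \<le> \<delta> / 2 \<and> norm (G x - Q x) \<le> \<delta> / 2"
    using assms(2) d unfolding trig_approx_def by metis
  have "\<bar>f x + g x - (p x + q x)\<bar> \<le> \<delta>" for x using p(2)[of x] q(2)[of x] by linarith
  moreover have "norm (F x + G x - (P x + Q x)) \<le> \<delta>" for x
    using p(2)[of x] q(2)[of x] norm_triangle_ineq[of "F x - P x" "G x - Q x"] by (simp add: add_diff_add)
  ultimately show "\<exists>p P. trig_poly p P \<and> (\<forall>x. \<bar>f x + g x - p x\<bar> \<le> \<delta> \<and> norm (F x + G x - P x) \<le> \<delta>)"
    using trig_poly.add[OF p(1) q(1)] by blast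
qed

lemma trig_approx_mult:
  assumes "trig_approx f F" "trig_approx g G"
  shows "trig_approx (\<lambda>x. f x * g x) (\<lambda>x. f x *\<^sub>R G x + g x *\<^sub>R F x)"
  unfolding trig_approx_def
proof (intro allI impI)
  fix \<delta> :: real assume \<delta>: "\<delta> > 0"
  obtain Bf where "Bf > 0 \<and> (\<forall>x. \<bar>f x\<bar> \<le> Bf \<and> norm (F x) \<le> Bf)"
    using trig_approx_bounded[OF assms(1)] by blast
  then have Bf: "Bf > 0" "\<And>x. \<bar>f x\<bar> \<le> Bf" "\<And>x. norm (F x) \<le> Bf" by simp_all
  obtain Bg where "Bg > 0 \<and> (\<forall>x. \<bar>g x\<bar> \<le> Bg \<and> norm (G x) \<le> Bg)"
    using trig_approx_bounded[OF assms(2)] by blast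
  then have Bg: "Bg > 0" "\<And>x. \<bar>g x\<bar> \<le> Bg" "\<And>x. norm (G x) \<le> Bg" by simp_all
  define B where "B = Bf + Bg + 1"
  \<comment> \<open>\<open>B\<close> bounds \<open>f\<close>, its gradient and the approximants of
    \<open>g\<close> and of its gradient; the error of the product gradient consists of four terms
    of size at most \<open>B * d\<close>.\<close>
  define d where "d = min 1 (\<delta> / (4 * B))"
  have B: "B > 0" "Bf \<le> B" "Bg + 1 \<le> B" using Bf(1) Bg(1) by (simp_all add: B_def)
  have d: "d > 0" "d \<le> 1" "d \<le> \<delta> / (4 * B)" using \<delta> B(1) by (auto simp: d_def)
  then have d4: "4 * (B * d) \<le> \<delta>" using B(1) by (simp add: pos_le_divide_eq ac_simps)
  then have d2: "2 * (B * d) \<le> \<delta>" using B(1) d(1) mult_pos_pos[of B d] by linarith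
  obtain p P where p: "trig_poly p P" "\<And>x. \<bar>f x - p x\<bar> \<le> d \<and> norm (F x - P x) \<le> d"
    using assms(1)[unfolded trig_approx_def, rule_format, OF d(1)] by blast
  obtain q Q where q: "trig_poly q Q" "\<And>x. \<bar>g x - q x\<bar> \<le> d \<and> norm (G x - Q x) \<le> d"
    using assms(2)[unfolded trig_approx_def, rule_format, OF d(1)] by blast
  have qB: "\<bar>q x\<bar> \<le> B" "norm (Q x) \<le> B" for x
    using q(2)[of x] Bg(2,3)[of x] norm_triangle_sub[of "Q x" "G x"] d(2) B(3) norm_minus_commute[of "G x" "Q x"]
    by linarith+
  have pq: "\<bar>f x - p x\<bar> \<le> d" "norm (F x - P x) \<le> d" "\<bar>g x - q x\<bar> \<le> d" "norm (G x - Q x) \<le> d" for x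
    using p(2) q(2) by auto
  have fB: "\<bar>f x\<bar> \<le> B" "norm (F x) \<le> B" for x using order_trans[OF Bf(2) B(2)] order_trans[OF Bf(3) B(2)] by simp_all
  note bounds = pq fB qB abs_ge_zero norm_ge_zero less_imp_le[OF B(1)] less_imp_le[OF d(1)]
  have 1: "\<bar>f x * g x - p x * q x\<bar> \<le> \<delta>" for x
  proof -
    have "\<bar>f x * g x - p x * q x\<bar> = \<bar>f x * (g x - q x) + (f x - p x) * q x\<bar>" by (simp add: algebra_simps)
    also have "\<dots> \<le> \<bar>f x\<bar> * \<bar>g x - q x\<bar> + \<bar>f x - p x\<bar> * \<bar>q x\<bar>"
      using abs_triangle_ineq[of "f x * (g x - q x)" "(f x - p x) * q x"] by (simp only: abs_mult)
    also have "\<dots> \<le> B * d + d * B" by (intro add_mono mult_mono bounds)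
    also have "\<dots> \<le> \<delta>" using d2 by (simp add: mult.commute)
    finally show ?thesis .
  qed
  have 2: "norm (f x *\<^sub>R G x + g x *\<^sub>R F x - (p x *\<^sub>R Q x + q x *\<^sub>R P x)) \<le> \<delta>" for x
  proof -
    have "norm (f x *\<^sub>R G x + g x *\<^sub>R F x - (p x *\<^sub>R Q x + q x *\<^sub>R P x))
      = norm ((f x *\<^sub>R (G x - Q x) + (f x - p x) *\<^sub>R Q x) + ((g x - q x) *\<^sub>R F x + q x *\<^sub>R (F x - P x)))"
      by (simp add: algebra_simps)
    also have "\<dots> \<le> (norm (f x *\<^sub>R (G x - Q x)) + norm ((f x - p x) *\<^sub>R Q x))
        + (norm ((g x - q x) *\<^sub>R F x) + norm (q x *\<^sub>R (F x - P x)))"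
      by (rule order_trans[OF norm_triangle_ineq add_mono[OF norm_triangle_ineq norm_triangle_ineq]])
    also have "\<dots> \<le> (B * d + d * B) + (d * B + B * d)"
      unfolding norm_scaleR by (intro add_mono mult_mono bounds)
    also have "\<dots> \<le> \<delta>" using d4 by (simp add: mult.commute)
    finally show ?thesis .
  qed
  from 1 2 trig_poly_mult[OF p(1) q(1)]
  show "\<exists>p P. trig_poly p P \<and> (\<forall>x. \<bar>f x * g x - p x\<bar> \<le> \<delta> \<and> norm (f x *\<^sub>R G x + g x *\<^sub>R F x - P x) \<le> \<delta>)"
    by (intro exI conjI allI) assumption+
qed

lemma trig_approx_limit:
  assumes "\<And>\<delta>. \<delta> > 0 \<Longrightarrow> \<exists>g G. trig_approx g G \<and> (\<forall>x. \<bar>f x - g x\<bar> \<le> \<delta> \<and> norm (F x - G x) \<le> \<delta>)"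
  shows "trig_approx f F"
  unfolding trig_approx_def
proof (intro allI impI)
  fix \<delta> :: real assume "\<delta> > 0"
  then have d: "\<delta> / 2 > 0" by simp
  obtain g G where g: "trig_approx g G" "\<And>x. \<bar>f x - g x\<bar> \<le> \<delta> / 2 \<and> norm (F x - G x) \<le> \<delta> / 2"
    using assms[OF d] by blast
  obtain p P where p: "trig_poly p P" "\<And>x. \<bar>g x - p x\<bar> \<le> \<delta> / 2 \<and> norm (G x - P x) \<le> \<delta> / 2"
    using g(1) d unfolding trig_approx_def by metis
  have "\<bar>f x - p x\<bar> \<le> \<delta>" for x using g(2)[of x] p(2)[of x] by linarith
  moreover have "norm (F x - P x) \<le> \<delta>" for x
    using g(2)[of x] p(2)[of x] norm_triangle_ineq[of "F x - G x" "G x - P x"] by simp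
  ultimately show "\<exists>p P. trig_poly p P \<and> (\<forall>x. \<bar>f x - p x\<bar> \<le> \<delta> \<and> norm (F x - P x) \<le> \<delta>)"
    using p(1) by blast
qed

lemma trig_approx_sum:
  "finite I \<Longrightarrow> (\<And>i. i \<in> I \<Longrightarrow> trig_approx (f i) (F i)) \<Longrightarrow>
    trig_approx (\<lambda>x. \<Sum>i\<in>I. f i x) (\<lambda>x. \<Sum>i\<in>I. F i x)"
  by (induction rule: finite_induct) (auto intro: trig_approx_add trig_approx_const)

lemma trig_approx_cmult:
  "trig_approx f F \<Longrightarrow> trig_approx (\<lambda>x. c * f x) (\<lambda>x. c *\<^sub>R F x)"
  using trig_approx_mult[OF trig_approx_const[of c]] by simp

lemma trig_approx_power:
  assumes "trig_approx f F"
  shows "trig_approx (\<lambda>x. f x ^ n) (\<lambda>x. (real n * f x ^ (n - 1)) *\<^sub>R F x)"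
proof (induction n)
  case 0 then show ?case using trig_approx_const[of 1] by simp
next
  case (Suc n)
  have "f x *\<^sub>R ((real n * f x ^ (n - 1)) *\<^sub>R F x) + (f x ^ n) *\<^sub>R F x = (real (Suc n) * f x ^ n) *\<^sub>R F x" for x
    by (cases n) (simp_all add: scaleR_add_left[symmetric] ring_distribs mult.commute mult.left_commute)
  then show ?case using trig_approx_mult[OF assms Suc] by simp
qed

text \<open>The Weierstrass theorem is applied to \<open>\<theta>'\<close>, and the polynomial is
  integrated with the value of \<open>\<theta>\<close> at \<open>lo\<close>, so that function and
  derivative are approximated together.\<close>

lemma trig_approx_comp:
  fixes \<theta> \<theta>' :: "real \<Rightarrow> real"
  assumes f: "trig_approx f F" and le: "lo \<le> hi" and ran: "\<And>x. f x \<in> {lo..hi}"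
    and der: "\<And>y. y \<in> {lo..hi} \<Longrightarrow> (\<theta> has_real_derivative \<theta>' y) (at y within {lo..hi})"
    and cont: "continuous_on {lo..hi} \<theta>'"
  shows "trig_approx (\<lambda>x. \<theta> (f x)) (\<lambda>x. \<theta>' (f x) *\<^sub>R F x)"
proof (rule trig_approx_limit)
  fix \<delta> :: real assume \<delta>: "\<delta> > 0"
  obtain B where B: "B > 0" "\<And>x. norm (F x) \<le> B" using trig_approx_bounded[OF f] by blast
  define d where "d = min (\<delta> / B) (\<delta> / (hi - lo + 1))"
  have d: "d > 0" "d * B \<le> \<delta>" "d * (hi - lo) \<le> \<delta>"
  proof -
    show "d > 0" using \<delta> B le by (simp add: d_def)
    have "d \<le> \<delta> / B" "d \<le> \<delta> / (hi - lo + 1)" by (auto simp: d_def)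
    then show "d * B \<le> \<delta>" "d * (hi - lo) \<le> \<delta>" using B le \<open>d > 0\<close> by (auto simp: field_simps)
  qed
  obtain g where g: "real_polynomial_function g" "\<And>y. y \<in> {lo..hi} \<Longrightarrow> \<bar>\<theta>' y - g y\<bar> < d"
    using Stone_Weierstrass_real_polynomial_function[of "{lo..hi}" \<theta>' d] cont d by auto
  then obtain a n where gs: "g = (\<lambda>y. \<Sum>i\<le>n. a i * y ^ i)" by (auto simp: real_polynomial_function_iff_sum)
  define Q0 where "Q0 y = (\<Sum>i\<le>n. a i / real (Suc i) * y ^ Suc i)" for y
  define Q where "Q y = Q0 y + (\<theta> lo - Q0 lo)" for y
  have Qd: "(Q has_real_derivative g y) (at y within S)" for y S
    unfolding Q_def Q0_def gs
    by (auto intro!: derivative_eq_intros sum.cong simp del: power_Suc of_nat_Suc)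
  have Qapp: "\<bar>\<theta> y - Q y\<bar> \<le> \<delta>" if y: "y \<in> {lo..hi}" for y
  proof -
    have "norm ((\<theta> y - Q y) - (\<theta> lo - Q lo)) \<le> d * norm (y - lo)"
    proof (rule field_differentiable_bound[where S = "{lo..hi}" and f' = "\<lambda>y. \<theta>' y - g y"])
      show "((\<lambda>y. \<theta> y - Q y) has_field_derivative \<theta>' z - g z) (at z within {lo..hi})" if "z \<in> {lo..hi}" for z
        using der[OF that] Qd by (intro DERIV_diff)
    qed (use g(2) y le in \<open>auto intro: less_imp_le\<close>)
    also have "\<dots> \<le> d * (hi - lo)" using y d by (intro mult_left_mono) auto
    also have "\<dots> \<le> \<delta>" by (rule d)
    finally show ?thesis by (simp add: Q_def)
  qed
  have "trig_approx (\<lambda>x. (\<Sum>i\<le>n. a i / real (Suc i) * f x ^ Suc i) + (\<theta> lo - Q0 lo))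
    (\<lambda>x. (\<Sum>i\<le>n. (a i / real (Suc i)) *\<^sub>R ((real (Suc i) * f x ^ (Suc i - 1)) *\<^sub>R F x)) + 0)"
    by (intro trig_approx_add trig_approx_const trig_approx_sum trig_approx_cmult trig_approx_power f) auto
  also have "(\<lambda>x. (\<Sum>i\<le>n. (a i / real (Suc i)) *\<^sub>R ((real (Suc i) * f x ^ (Suc i - 1)) *\<^sub>R F x)) + 0)
      = (\<lambda>x. g (f x) *\<^sub>R F x)"
    by (simp add: gs scaleR_sum_left del: of_nat_Suc)
  finally have "trig_approx (\<lambda>x. Q (f x)) (\<lambda>x. g (f x) *\<^sub>R F x)" by (simp add: Q_def Q0_def)
  moreover have "\<bar>\<theta> (f x) - Q (f x)\<bar> \<le> \<delta>" for x by (rule Qapp[OF ran])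
  moreover have "norm (\<theta>' (f x) *\<^sub>R F x - g (f x) *\<^sub>R F x) \<le> \<delta>" for x
  proof -
    have "norm (\<theta>' (f x) *\<^sub>R F x - g (f x) *\<^sub>R F x) = \<bar>\<theta>' (f x) - g (f x)\<bar> * norm (F x)"
      by (simp add: scaleR_left_diff_distrib[symmetric])
    also have "\<dots> \<le> d * B" using g(2)[OF ran[of x]] B(2)[of x] d by (intro mult_mono) auto
    finally show ?thesis using d by simp
  qed
  ultimately show "\<exists>g G. trig_approx g G \<and> (\<forall>x. \<bar>\<theta> (f x) - g x\<bar> \<le> \<delta> \<and> norm (\<theta>' (f x) *\<^sub>R F x - G x) \<le> \<delta>)"
    by blast
qed

lemma trig_approx_exp:
  assumes f: "trig_approx f F" shows "trig_approx (\<lambda>x. exp (f x)) (\<lambda>x. exp (f x) *\<^sub>R F x)"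
proof -
  obtain B where B: "B > 0" "\<And>x. \<bar>f x\<bar> \<le> B" using trig_approx_bounded[OF f] by blast
  show ?thesis
    by (rule trig_approx_comp[OF f, of "- B" B])
      (use B in \<open>auto intro!: derivative_eq_intros continuous_intros simp: abs_le_iff minus_le_iff\<close>)
qed

lemma trig_approx_inverse:
  assumes f: "trig_approx f F" and c: "c > 0" "\<And>x. c \<le> f x"
  shows "trig_approx (\<lambda>x. inverse (f x)) (\<lambda>x. (- (inverse (f x))\<^sup>2) *\<^sub>R F x)"
proof -
  obtain B where B: "B > 0" "\<And>x. \<bar>f x\<bar> \<le> B" using trig_approx_bounded[OF f] by blast
  have "c \<le> B" using B(2)[of 0] c(2)[of 0] by linarith
  then show ?thesis
    by (intro trig_approx_comp[OF f, where lo = c and hi = B])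
      (use B c in \<open>auto intro!: derivative_eq_intros continuous_intros simp: abs_le_iff power2_eq_square\<close>)
qed

section \<open>Gaussian mixtures with common covariance\<close>

lemma nn_integral_exp_neg_square:
  assumes k: "0 < k"
  shows "(\<integral>\<^sup>+s. ennreal (exp (- k * s\<^sup>2)) \<partial>lborel) = ennreal (sqrt (pi / k))"
proof -
  define \<sigma> where "\<sigma> = sqrt (1 / (2 * k))"
  have \<sigma>: "\<sigma> > 0" "\<sigma>\<^sup>2 = 1 / (2 * k)" using k by (auto simp: \<sigma>_def)
  have eq: "exp (- k * s\<^sup>2) = sqrt (pi / k) * normal_density 0 \<sigma> s" for s
    using k by (simp add: normal_density_def \<sigma>(2) field_simps)
  have "(\<integral>\<^sup>+s. ennreal (normal_density 0 \<sigma> s) \<partial>lborel) = emeasure (density lborel (normal_density 0 \<sigma>)) UNIV"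
    by (simp add: emeasure_density)
  also have "\<dots> = 1" using prob_space.emeasure_space_1[OF prob_space_normal_density[OF \<sigma>(1), of 0]] by simp
  finally show ?thesis unfolding eq using k by (simp add: ennreal_mult' nn_integral_cmult)
qed

lemma nn_integral_exp_neg_norm_square:
  assumes k: "0 < k"
  shows "(\<integral>\<^sup>+x. ennreal (exp (- k * (norm x)\<^sup>2)) \<partial>(lborel :: 'a::euclidean_space measure)) = ennreal (sqrt (pi / k) ^ DIM('a))"
proof -
  have "ennreal (exp (- k * (norm x)\<^sup>2)) = (\<Prod>b\<in>Basis. ennreal (exp (- k * (x \<bullet> b)\<^sup>2)))" for x :: 'a
  proof -
    have "- k * (norm x)\<^sup>2 = (\<Sum>b\<in>Basis. - k * (x \<bullet> b)\<^sup>2)"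
      unfolding power2_norm_eq_inner using euclidean_inner[of x x]
      by (simp add: power2_eq_square sum_distrib_left[symmetric] sum_negf)
    then show ?thesis by (simp add: exp_sum prod_ennreal)
  qed
  then have "(\<integral>\<^sup>+x. ennreal (exp (- k * (norm x)\<^sup>2)) \<partial>(lborel :: 'a measure))
      = (\<Prod>b\<in>(Basis::'a set). \<integral>\<^sup>+s. ennreal (exp (- k * s\<^sup>2)) \<partial>lborel)"
    by (simp only:) (rule nn_integral_lborel_prod, auto)
  also have "\<dots> = ennreal (sqrt (pi / k) ^ DIM('a))"
    using k unfolding nn_integral_exp_neg_square[OF k] prod_constant by (simp add: ennreal_power)
  finally show ?thesis .
qed

text \<open>Completing the square absorbs the linear term at the price of half the Gaussian rate.
  Functions of this kind dominate the exponential moments of the time steps.\<close>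

lemma nn_integral_gaussian_tail_finite:
  fixes z :: "'a::euclidean_space"
  assumes c: "0 < c"
  shows "(\<integral>\<^sup>+x. ennreal (exp (- c * (norm (x - z))\<^sup>2 + A * norm (x - z) + B)) \<partial>lborel) < \<infinity>"
proof -
  have le: "- c * r\<^sup>2 + A * r + B \<le> - (c / 2) * r\<^sup>2 + (A\<^sup>2 / (2 * c) + B)" for r :: real
  proof -
    have "0 \<le> (c * r - A)\<^sup>2 / (2 * c)" using c by simp
    also have "\<dots> = c / 2 * r\<^sup>2 - A * r + A\<^sup>2 / (2 * c)" using c by (simp add: power2_eq_square field_simps)
    finally show ?thesis by (simp add: field_simps)
  qed
  have "(\<integral>\<^sup>+x. ennreal (exp (- c * (norm (x - z))\<^sup>2 + A * norm (x - z) + B)) \<partial>lborel)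
     \<le> (\<integral>\<^sup>+x. ennreal (exp (A\<^sup>2 / (2 * c) + B)) * ennreal (exp (- (c / 2) * (norm (x + - z))\<^sup>2)) \<partial>lborel)"
  proof (intro nn_integral_mono)
    fix x
    have "exp (- c * (norm (x - z))\<^sup>2 + A * norm (x - z) + B) \<le> exp (- (c / 2) * (norm (x - z))\<^sup>2 + (A\<^sup>2 / (2 * c) + B))"
      using le by simp
    then show "ennreal (exp (- c * (norm (x - z))\<^sup>2 + A * norm (x - z) + B))
      \<le> ennreal (exp (A\<^sup>2 / (2 * c) + B)) * ennreal (exp (- (c / 2) * (norm (x + - z))\<^sup>2))"
      by (simp add: ennreal_mult'[symmetric] exp_add[symmetric] add.commute ennreal_leI)
  qed
  also have "\<dots> = ennreal (exp (A\<^sup>2 / (2 * c) + B)) * (\<integral>\<^sup>+x. ennreal (exp (- (c / 2) * (norm (x + - z))\<^sup>2)) \<partial>lborel)"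
    by (rule nn_integral_cmult) measurable
  also have "(\<integral>\<^sup>+x. ennreal (exp (- (c / 2) * (norm (x + - z))\<^sup>2)) \<partial>lborel) = (\<integral>\<^sup>+x. ennreal (exp (- (c / 2) * (norm x)\<^sup>2)) \<partial>(lborel :: 'a measure))"
    by (rule nn_integral_lborel_shift[where f = "\<lambda>x. ennreal (exp (- (c / 2) * (norm x)\<^sup>2))"]) measurable
  also have "\<dots> = ennreal (sqrt (pi / (c / 2)) ^ DIM('a))"
    by (rule nn_integral_exp_neg_norm_square) (use c in simp)
  finally show ?thesis by (simp add: ennreal_mult_less_top top.not_eq_extremum order_le_less_trans)
qed

text \<open>The path \<open>\<rho> t = \<Sum>u\<in>I. wt u * N(z + t u, Q\<^sup>-\<^sup>1)\<close> of Gaussian mixtures with common covariance starts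
  at a single Gaussian and is transported by the bounded velocity \<open>v t\<close>, a softmax average of
  the directions \<open>u\<close> whose divergence is \<open>dv t\<close>.\<close>

locale gaussian_path =
  fixes Q :: "real^'n \<Rightarrow> real^'n" and K c :: real and z :: "real^'n"
    and I :: "(real^'n) set" and wt :: "real^'n \<Rightarrow> real"
  assumes linQ: "linear Q" and symQ: "\<And>x y. x \<bullet> Q y = y \<bullet> Q x"
    and c: "0 < c" and posQ: "\<And>x. c * (norm x)\<^sup>2 \<le> x \<bullet> Q x"
    and K: "0 < K" and total: "(\<integral>\<^sup>+x. ennreal (K * exp (- (x \<bullet> Q x) / 2)) \<partial>lborel) = 1"
    and I: "finite I" and wt: "\<And>u. u \<in> I \<Longrightarrow> 0 \<le> wt u" and sum_wt: "sum wt I = 1"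
begin

text \<open>The density of the Gaussian centred at \<open>z + t *\<^sub>R u\<close> relative to the
  one centred at \<open>z\<close>.\<close>

definition E :: "real^'n \<Rightarrow> real \<Rightarrow> real^'n \<Rightarrow> real" where
  "E u t x = exp (t * (u \<bullet> Q (x - z)) - t\<^sup>2 * (u \<bullet> Q u) / 2)"

definition D :: "real \<Rightarrow> real^'n \<Rightarrow> real" where
  "D t x = (\<Sum>u\<in>I. wt u * E u t x)"

definition \<rho> :: "real \<Rightarrow> real^'n \<Rightarrow> real" where
  "\<rho> t x = K * exp (- ((x - z) \<bullet> Q (x - z)) / 2) * D t x"

definition v :: "real \<Rightarrow> real^'n \<Rightarrow> real^'n" where
  "v t x = (\<Sum>u\<in>I. (wt u * E u t x / D t x) *\<^sub>R u)"

definition S :: "real \<Rightarrow> real^'n \<Rightarrow> real" where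
  "S t x = (\<Sum>u\<in>I. wt u * E u t x / D t x * (u \<bullet> Q u))"

text \<open>The gradient of the weight of \<open>u\<close> is \<open>t\<close> times this weight
  times \<open>Q u - Q (v t x)\<close>; summing the inner products with \<open>u\<close> gives the
  formula.\<close>

definition dv :: "real \<Rightarrow> real^'n \<Rightarrow> real" where
  "dv t x = t * S t x - t * (v t x \<bullet> Q (v t x))"

lemma Q_simps: "Q (x + y) = Q x + Q y" "Q (x - y) = Q x - Q y" "Q (r *\<^sub>R x) = r *\<^sub>R Q x" "Q 0 = 0"
  using linQ by (simp_all add: linear_add linear_diff linear_scale linear_0)

lemma Q_nonneg: "0 \<le> x \<bullet> Q x"
  using posQ[of x] c by (meson mult_nonneg_nonneg less_imp_le order_trans zero_le_power2)

lemma tendsto_Q [tendsto_intros]: "(f \<longlongrightarrow> l) F \<Longrightarrow> ((\<lambda>x. Q (f x)) \<longlongrightarrow> Q l) F"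
  using linQ by (simp add: bounded_linear.tendsto linear_conv_bounded_linear)

lemma Q_measurable [measurable]: "Q \<in> borel_measurable borel"
  by (rule linear_measurable_borel[OF linQ])

lemma Q_bound: "\<exists>L>0. \<forall>x. norm (Q x) \<le> L * norm x"
  using linear_bounded_pos[OF linQ] by (metis mult.commute)

lemma D_pos: "0 < D t x"
proof -
  have "\<exists>u\<in>I. wt u > 0"
    using sum_wt wt by (metis less_eq_real_def sum.neutral zero_neq_one)
  then show ?thesis unfolding D_def
    using I wt by (auto intro!: sum_pos2 simp: E_def)
qed

lemma \<rho>_pos: "0 < \<rho> t x"
  by (simp add: \<rho>_def K D_pos)

lemma E_measurable [measurable]: "E u t \<in> borel_measurable borel"
  unfolding E_def[abs_def] by measurable

lemma D_measurable [measurable]: "D t \<in> borel_measurable borel"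
  unfolding D_def[abs_def] by measurable

lemma \<rho>_measurable [measurable]: "\<rho> t \<in> borel_measurable borel"
  unfolding \<rho>_def[abs_def] by measurable

lemma \<rho>_eq: "\<rho> t x = (\<Sum>u\<in>I. wt u * (K * exp (- ((x - z - t *\<^sub>R u) \<bullet> Q (x - z - t *\<^sub>R u)) / 2)))"
proof -
  have "exp (- (y \<bullet> Q y) / 2) * exp (t * (u \<bullet> Q y) - t\<^sup>2 * (u \<bullet> Q u) / 2)
      = exp (- ((y - t *\<^sub>R u) \<bullet> Q (y - t *\<^sub>R u)) / 2)" for y u
    unfolding exp_add[symmetric]
    by (rule arg_cong[where f = exp]) (simp add: Q_simps inner_diff_left inner_diff_right symQ[of y u] power2_eq_square field_simps)
  then show ?thesis
    unfolding \<rho>_def D_def E_def sum_distrib_left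
    by (intro sum.cong refl) (metis (no_types, opaque_lifting) mult.assoc mult.left_commute)
qed

lemma nn_integral_\<rho>: "(\<integral>\<^sup>+x. ennreal (\<rho> t x) \<partial>lborel) = 1"
proof -
  define g where "g x = ennreal (K * exp (- (x \<bullet> Q x) / 2))" for x
  have [measurable]: "g \<in> borel_measurable borel" unfolding g_def[abs_def] by measurable
  have "(\<integral>\<^sup>+x. ennreal (\<rho> t x) \<partial>lborel) = (\<integral>\<^sup>+x. (\<Sum>u\<in>I. ennreal (wt u) * g (x + (- z - t *\<^sub>R u))) \<partial>lborel)"
    unfolding \<rho>_eq g_def using wt K
    by (intro nn_integral_cong) (simp add: ennreal_mult'[symmetric] sum_ennreal add_diff_eq)
  also have "\<dots> = (\<Sum>u\<in>I. ennreal (wt u) * (\<integral>\<^sup>+x. g (x + (- z - t *\<^sub>R u)) \<partial>lborel))"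
    by (simp add: nn_integral_sum nn_integral_cmult)
  also have "\<dots> = (\<Sum>u\<in>I. ennreal (wt u))"
    using total[folded g_def] by (simp add: nn_integral_lborel_shift)
  also have "\<dots> = 1" using wt sum_wt by (simp add: sum_ennreal)
  finally show ?thesis .
qed

lemma tendsto_E:
  assumes "(s \<longlongrightarrow> t) F" "(y \<longlongrightarrow> x) F" shows "((\<lambda>n. E u (s n) (y n)) \<longlongrightarrow> E u t x) F"
  unfolding E_def using assms by (intro tendsto_intros) simp_all

lemma tendsto_D:
  assumes "(s \<longlongrightarrow> t) F" "(y \<longlongrightarrow> x) F" shows "((\<lambda>n. D (s n) (y n)) \<longlongrightarrow> D t x) F"
  unfolding D_def using assms by (intro tendsto_intros tendsto_E)

lemma tendsto_v:
  assumes "(s \<longlongrightarrow> t) F" "(y \<longlongrightarrow> x) F" shows "((\<lambda>n. v (s n) (y n)) \<longlongrightarrow> v t x) F"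
  unfolding v_def using assms less_imp_neq[OF D_pos[of t x], symmetric] by (intro tendsto_intros tendsto_E tendsto_D)

lemma tendsto_S:
  assumes "(s \<longlongrightarrow> t) F" "(y \<longlongrightarrow> x) F" shows "((\<lambda>n. S (s n) (y n)) \<longlongrightarrow> S t x) F"
  unfolding S_def using assms less_imp_neq[OF D_pos[of t x], symmetric] by (intro tendsto_intros tendsto_E tendsto_D)

lemma tendsto_\<rho>:
  assumes "(s \<longlongrightarrow> t) F" "(y \<longlongrightarrow> x) F" shows "((\<lambda>n. \<rho> (s n) (y n)) \<longlongrightarrow> \<rho> t x) F"
  unfolding \<rho>_def using assms by (intro tendsto_intros tendsto_D) simp_all

lemma weights: "u \<in> I \<Longrightarrow> 0 \<le> wt u * E u t x / D t x" "(\<Sum>u\<in>I. wt u * E u t x / D t x) = 1"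
proof -
  show "u \<in> I \<Longrightarrow> 0 \<le> wt u * E u t x / D t x" using wt D_pos[of t x] by (simp add: E_def)
  show "(\<Sum>u\<in>I. wt u * E u t x / D t x) = 1"
    using D_pos[of t x] by (simp add: sum_divide_distrib[symmetric] D_def)
qed

lemma v_S_bounded: "\<exists>U>0. (\<forall>u\<in>I. norm u \<le> U) \<and> (\<forall>t x. norm (v t x) \<le> U \<and> \<bar>S t x\<bar> \<le> U)"
proof -
  define U where "U = 1 + (\<Sum>u\<in>I. norm u + \<bar>u \<bullet> Q u\<bar>)"
  have le: "norm u \<le> U" "\<bar>u \<bullet> Q u\<bar> \<le> U" if "u \<in> I" for u
  proof -
    have "norm u + \<bar>u \<bullet> Q u\<bar> \<le> (\<Sum>u\<in>I. norm u + \<bar>u \<bullet> Q u\<bar>)"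
      by (rule member_le_sum[OF that]) (use I in auto)
    then show "norm u \<le> U" "\<bar>u \<bullet> Q u\<bar> \<le> U"
      unfolding U_def using norm_ge_zero[of u] abs_ge_zero[of "u \<bullet> Q u"] by linarith+
  qed
  have "U > 0" unfolding U_def by (intro add_pos_nonneg sum_nonneg) auto
  moreover have "norm (v t x) \<le> U" for t x
  proof -
    have "norm (v t x) \<le> (\<Sum>u\<in>I. (wt u * E u t x / D t x) * U)"
      unfolding v_def
    proof (rule sum_norm_le)
      fix u assume u: "u \<in> I"
      show "norm ((wt u * E u t x / D t x) *\<^sub>R u) \<le> wt u * E u t x / D t x * U"
        unfolding norm_scaleR abs_of_nonneg[OF weights(1)[OF u]] by (rule mult_left_mono[OF le(1) weights(1)]) (rule u)+
    qed
    then show ?thesis using weights(2)[of t x] by (simp only: sum_distrib_right[symmetric] mult_1)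
  qed
  moreover have "\<bar>S t x\<bar> \<le> U" for t x
  proof -
    have "\<bar>S t x\<bar> \<le> (\<Sum>u\<in>I. (wt u * E u t x / D t x) * U)"
      unfolding S_def real_norm_def[symmetric]
    proof (rule sum_norm_le)
      fix u assume u: "u \<in> I"
      show "norm (wt u * E u t x / D t x * (u \<bullet> Q u)) \<le> wt u * E u t x / D t x * U"
        unfolding real_norm_def abs_mult[of "wt u * E u t x / D t x"] abs_of_nonneg[OF weights(1)[OF u]]
        by (rule mult_left_mono[OF le(2) weights(1)]) (rule u)+
    qed
    then show ?thesis using weights(2)[of t x] by (simp only: sum_distrib_right[symmetric] mult_1)
  qed
  ultimately show ?thesis using le by blast
qed

lemma \<rho>_bounded: "\<exists>A. \<forall>t x. 0 \<le> t \<and> t \<le> 1 \<longrightarrow> \<rho> t x \<le> K * exp (- (c / 2) * (norm (x - z))\<^sup>2 + A * norm (x - z))"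
proof -
  obtain L where L: "L > 0" "\<And>x. norm (Q x) \<le> L * norm x" using Q_bound by blast
  obtain U where U: "U > 0" "\<And>u. u \<in> I \<Longrightarrow> norm u \<le> U" using v_S_bounded by blast
  have "\<rho> t x \<le> K * exp (- (c / 2) * (norm (x - z))\<^sup>2 + (U * L) * norm (x - z))" if t: "0 \<le> t" "t \<le> 1" for t x
  proof -
    have "E u t x \<le> exp (U * L * norm (x - z))" if u: "u \<in> I" for u
    proof -
      have "u \<bullet> Q (x - z) \<le> norm u * norm (Q (x - z))" by (rule norm_cauchy_schwarz)
      also have "\<dots> \<le> U * (L * norm (x - z))" using U L u by (intro mult_mono) auto
      finally have 1: "u \<bullet> Q (x - z) \<le> U * L * norm (x - z)" by simp
      have "t * (u \<bullet> Q (x - z)) \<le> t * (U * L * norm (x - z))" using 1 t by (intro mult_left_mono) auto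
      also have "\<dots> \<le> U * L * norm (x - z)" using t U L by (intro mult_left_le_one_le) auto
      finally show ?thesis using Q_nonneg[of u] by (simp add: E_def add_increasing2 algebra_simps)
    qed
    then have "D t x \<le> (\<Sum>u\<in>I. wt u * exp (U * L * norm (x - z)))"
      unfolding D_def using wt by (intro sum_mono mult_left_mono) auto
    also have "\<dots> = exp (U * L * norm (x - z))" by (simp add: sum_distrib_right[symmetric] sum_wt)
    finally have "D t x \<le> exp (U * L * norm (x - z))" .
    moreover have "exp (- ((x - z) \<bullet> Q (x - z)) / 2) \<le> exp (- (c / 2) * (norm (x - z))\<^sup>2)"
      using posQ[of "x - z"] by simp
    ultimately have "exp (- ((x - z) \<bullet> Q (x - z)) / 2) * D t x \<le> exp (- (c / 2) * (norm (x - z))\<^sup>2) * exp (U * L * norm (x - z))"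
      using D_pos[of t x] by (intro mult_mono) auto
    then show ?thesis using K unfolding \<rho>_def exp_add by (simp add: mult.assoc)
  qed
  then show ?thesis by blast
qed

text \<open>The mean value theorem for \<open>ln \<rho>\<close> along the segment from
  \<open>(s, y)\<close> to \<open>(s + h, x)\<close>: the time derivative is
  \<open>v t x \<bullet> Q (x - z) - t * S t x\<close> and the gradient is
  \<open>t *\<^sub>R Q (v t x) - Q (x - z)\<close>. A single intermediate point reduces later limits
  to continuity of \<open>v\<close> and \<open>S\<close>.\<close>

lemma ln_\<rho>_diff:
  "\<exists>\<tau> t' x'. 0 < \<tau> \<and> \<tau> < 1 \<and> t' = s + \<tau> * h \<and> x' = y + \<tau> *\<^sub>R (x - y) \<and>
    ln (\<rho> (s + h) x) - ln (\<rho> s y) =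
      h * (v t' x' \<bullet> Q (x' - z) - t' * S t' x') - (x - y) \<bullet> Q (x' - z) + t' * (v t' x' \<bullet> Q (x - y))"
proof -
  define d where "d = x - y"
  define T where "T \<tau> = s + \<tau> * h" for \<tau>
  define X where "X \<tau> = y + \<tau> *\<^sub>R d" for \<tau>
  define G where "G \<tau> = ln (\<rho> (T \<tau>) (X \<tau>))" for \<tau>
  define G' where "G' \<tau> = h * (v (T \<tau>) (X \<tau>) \<bullet> Q (X \<tau> - z) - T \<tau> * S (T \<tau>) (X \<tau>)) - d \<bullet> Q (X \<tau> - z)
      + T \<tau> * (v (T \<tau>) (X \<tau>) \<bullet> Q d)" for \<tau>
  have "(G has_real_derivative G' \<tau>) (at \<tau>)" for \<tau>
  proof -
    define e where "e u \<tau> = T \<tau> * (u \<bullet> Q (X \<tau> - z)) - (T \<tau>)\<^sup>2 * (u \<bullet> Q u) / 2" for u \<tau>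
    define e' where "e' u = h * (u \<bullet> Q (X \<tau> - z)) + T \<tau> * (u \<bullet> Q d) - T \<tau> * h * (u \<bullet> Q u)" for u
    have Qlin: "Q (X \<tau> - z) = Q (y - z) + \<tau> *\<^sub>R Q d" for \<tau>
      by (simp add: X_def Q_simps)
    have "(e u has_real_derivative e' u) (at \<tau>)" for u
    proof -
      define \<alpha> \<beta> \<kappa> where "\<alpha> = u \<bullet> Q (y - z)" and "\<beta> = u \<bullet> Q d" and "\<kappa> = u \<bullet> Q u"
      have lin: "u \<bullet> Q (X \<tau> - z) = \<alpha> + \<tau> * \<beta>" for \<tau>
        unfolding Qlin \<alpha>_def \<beta>_def by (simp add: inner_add_right)
      have "((\<lambda>\<tau>. (s + \<tau> * h) * (\<alpha> + \<tau> * \<beta>) - (s + \<tau> * h)\<^sup>2 * \<kappa> / 2) has_real_derivative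
        h * (\<alpha> + \<tau> * \<beta>) + (s + \<tau> * h) * \<beta> - (s + \<tau> * h) * h * \<kappa>) (at \<tau>)"
        by (auto intro!: derivative_eq_intros simp: algebra_simps)
      then show ?thesis
        unfolding e_def[abs_def] e'_def lin \<beta>_def[symmetric] \<kappa>_def[symmetric] T_def .
    qed
    then have EE: "((\<lambda>\<tau>. E u (T \<tau>) (X \<tau>)) has_real_derivative E u (T \<tau>) (X \<tau>) * e' u) (at \<tau>)" for u
      unfolding E_def e_def[symmetric] by (intro DERIV_fun_exp)
    have DD: "((\<lambda>\<tau>. D (T \<tau>) (X \<tau>)) has_real_derivative (\<Sum>u\<in>I. wt u * (E u (T \<tau>) (X \<tau>) * e' u))) (at \<tau>)"
      unfolding D_def by (rule DERIV_sum) (rule DERIV_cmult[OF EE])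
    have q: "(X \<tau> - z) \<bullet> Q (X \<tau> - z) = (y - z) \<bullet> Q (y - z) + 2 * \<tau> * (d \<bullet> Q (y - z)) + \<tau>\<^sup>2 * (d \<bullet> Q d)" for \<tau>
    proof -
      have "X \<tau> - z = (y - z) + \<tau> *\<^sub>R d" by (simp add: X_def)
      then show ?thesis
        by (simp only: Q_simps(1,3) inner_add_left inner_add_right inner_scaleR_left inner_scaleR_right symQ[of "y - z" d])
          (simp add: power2_eq_square distrib_left)
    qed
    have q': "d \<bullet> Q (X \<tau> - z) = d \<bullet> Q (y - z) + \<tau> * (d \<bullet> Q d)"
      unfolding Qlin by (simp add: inner_add_right)
    have G_eq: "G = (\<lambda>\<tau>. ln K - ((X \<tau> - z) \<bullet> Q (X \<tau> - z)) / 2 + ln (D (T \<tau>) (X \<tau>)))"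
      using K D_pos by (auto simp: fun_eq_iff G_def \<rho>_def ln_mult less_imp_neq[symmetric])
    have 1: "(G has_real_derivative (- (d \<bullet> Q (X \<tau> - z)) + (\<Sum>u\<in>I. wt u * (E u (T \<tau>) (X \<tau>) * e' u)) / D (T \<tau>) (X \<tau>))) (at \<tau>)"
      unfolding G_eq q q' using D_pos[of "T \<tau>" "X \<tau>"]
      by (auto intro!: derivative_eq_intros DD simp: field_simps)
    define p where "p u = wt u * E u (T \<tau>) (X \<tau>) / D (T \<tau>) (X \<tau>)" for u
    have "(\<Sum>u\<in>I. wt u * (E u (T \<tau>) (X \<tau>) * e' u)) / D (T \<tau>) (X \<tau>) = (\<Sum>u\<in>I. p u * e' u)"
      by (simp add: p_def sum_divide_distrib mult.assoc)
    also have "\<dots> = h * ((\<Sum>u\<in>I. p u *\<^sub>R u) \<bullet> Q (X \<tau> - z)) + T \<tau> * ((\<Sum>u\<in>I. p u *\<^sub>R u) \<bullet> Q d) - T \<tau> * h * (\<Sum>u\<in>I. p u * (u \<bullet> Q u))"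
      unfolding e'_def inner_sum_left sum_distrib_left inner_scaleR_left
      by (simp add: ring_distribs sum.distrib sum_subtractf ac_simps)
    finally have 2: "(\<Sum>u\<in>I. wt u * (E u (T \<tau>) (X \<tau>) * e' u)) / D (T \<tau>) (X \<tau>)
      = h * (v (T \<tau>) (X \<tau>) \<bullet> Q (X \<tau> - z)) + T \<tau> * (v (T \<tau>) (X \<tau>) \<bullet> Q d) - T \<tau> * h * S (T \<tau>) (X \<tau>)"
      unfolding v_def S_def p_def .
    have 3: "- (d \<bullet> Q (X \<tau> - z)) + (\<Sum>u\<in>I. wt u * (E u (T \<tau>) (X \<tau>) * e' u)) / D (T \<tau>) (X \<tau>) = G' \<tau>"
      unfolding 2 G'_def by (simp add: right_diff_distrib)
    show ?thesis using 1 unfolding 3 .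
  qed
  then obtain \<tau> where \<tau>: "0 < \<tau>" "\<tau> < 1" "G 1 - G 0 = G' \<tau>"
    using MVT2[of 0 1 G G'] by auto
  have "G 1 = ln (\<rho> (s + h) x)" "G 0 = ln (\<rho> s y)"
    by (simp_all add: G_def T_def X_def d_def)
  with \<tau>(3) have eq: "ln (\<rho> (s + h) x) - ln (\<rho> s y) = G' \<tau>" by simp
  show ?thesis
  proof (intro exI conjI)
    show "0 < \<tau>" "\<tau> < 1" by (rule \<tau>)+
    show "T \<tau> = s + \<tau> * h" by (rule T_def)
    show "X \<tau> = y + \<tau> *\<^sub>R (x - y)" unfolding X_def d_def by (rule refl)
    show "ln (\<rho> (s + h) x) - ln (\<rho> s y) = h * (v (T \<tau>) (X \<tau>) \<bullet> Q (X \<tau> - z) - T \<tau> * S (T \<tau>) (X \<tau>))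
        - (x - y) \<bullet> Q (X \<tau> - z) + T \<tau> * (v (T \<tau>) (X \<tau>) \<bullet> Q (x - y))"
      using eq unfolding G'_def d_def .
  qed
qed

end

section \<open>Almost periodic approximation of the velocity\<close>

context gaussian_path
begin

text \<open>Replacing each coordinate \<open>y\<close> of \<open>x - z\<close> by \<open>L sin (y / L)\<close> makes the velocity almost periodic,
  hence approximable by ridge functions on all of space, with bounds that do not depend on \<open>L\<close>.\<close>

definition \<xi> :: "real \<Rightarrow> real^'n \<Rightarrow> real^'n" where
  "\<xi> L x = z + (\<chi> k. L * sin ((x - z) $ k / L))"

text \<open>The derivative of \<open>\<xi> L\<close> at \<open>x\<close> in direction
  \<open>y\<close>. Being diagonal, it equals its transpose and therefore also appears in
  gradients.\<close>

definition d\<xi> :: "real \<Rightarrow> real^'n \<Rightarrow> real^'n \<Rightarrow> real^'n" where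
  "d\<xi> L x y = (\<chi> k. cos ((x - z) $ k / L) * y $ k)"

lemma norm_d\<xi>_le: "norm (d\<xi> L x y) \<le> norm y"
  by (rule norm_le_componentwise_cart) (simp add: d\<xi>_def abs_mult mult_left_le_one_le)

lemma tendsto_L_sin: "(\<lambda>n. real (Suc n) * sin (y / real (Suc n))) \<longlonglongrightarrow> y"
proof -
  have "((\<lambda>h. sin (y * h) / h) \<longlongrightarrow> y) (at 0)"
  proof -
    have "((\<lambda>h. sin (y * h)) has_real_derivative y) (at 0)"
      by (auto intro!: derivative_eq_intros)
    then show ?thesis by (simp add: has_field_derivative_iff)
  qed
  moreover have "filterlim (\<lambda>n. inverse (real (Suc n))) (at 0) sequentially"
    using LIMSEQ_inverse_real_of_nat by (simp add: filterlim_at)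
  ultimately have "(\<lambda>n. sin (y * inverse (real (Suc n))) / inverse (real (Suc n))) \<longlonglongrightarrow> y"
    by (rule filterlim_compose)
  then show ?thesis by (simp add: divide_inverse mult.commute)
qed

lemma tendsto_\<xi>: "(\<lambda>n. \<xi> (real (Suc n)) x) \<longlonglongrightarrow> x"
proof -
  have "(\<lambda>n. (\<chi> k. real (Suc n) * sin ((x - z) $ k / real (Suc n)))) \<longlonglongrightarrow> (\<chi> k. (x - z) $ k)"
    by (intro tendsto_vec_lambda tendsto_L_sin)
  then have "(\<lambda>n. z + (\<chi> k. real (Suc n) * sin ((x - z) $ k / real (Suc n)))) \<longlonglongrightarrow> z + (\<chi> k. (x - z) $ k)"
    by (intro tendsto_add tendsto_const)
  moreover have "z + (\<chi> k. (x - z) $ k) = x" by (simp add: vec_eq_iff)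
  ultimately show ?thesis by (simp add: \<xi>_def)
qed

lemma tendsto_d\<xi>: "(\<lambda>n. d\<xi> (real (Suc n)) x y) \<longlonglongrightarrow> y"
proof -
  have "(\<lambda>n. cos ((x - z) $ k / real (Suc n)) * y $ k) \<longlonglongrightarrow> y $ k" for k
  proof -
    have "(\<lambda>n. (x - z) $ k * inverse (real (Suc n))) \<longlonglongrightarrow> (x - z) $ k * 0"
      by (intro tendsto_mult tendsto_const LIMSEQ_inverse_real_of_nat)
    then have "(\<lambda>n. cos ((x - z) $ k * inverse (real (Suc n))) * y $ k) \<longlonglongrightarrow> cos ((x - z) $ k * 0) * y $ k"
      by (rule tendsto_mult[OF tendsto_cos tendsto_const])
    then show ?thesis by (simp add: divide_inverse)
  qed
  then have "(\<lambda>n. (\<chi> k. cos ((x - z) $ k / real (Suc n)) * y $ k)) \<longlonglongrightarrow> (\<chi> k. y $ k)"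
    by (intro tendsto_vec_lambda)
  then show ?thesis by (simp add: d\<xi>_def)
qed

lemma trig_approx_linear_\<xi>:
  assumes "0 < L"
  shows "trig_approx (\<lambda>x. u \<bullet> Q (\<xi> L x - z)) (\<lambda>x. d\<xi> L x (Q u))"
proof -
  have coord: "trig_approx (\<lambda>x. L * sin ((x - z) $ k / L)) (\<lambda>x. cos ((x - z) $ k / L) *\<^sub>R axis k 1)" for k
  proof -
    have 1: "axis k (1 / L) \<bullet> x + (- z $ k / L) = (x - z) $ k / L" for x
      by (simp add: inner_axis' diff_divide_distrib)
    have 2: "(L * r) *\<^sub>R axis k (1 / L) = r *\<^sub>R (axis k 1 :: real^'n)" for r
      using assms by (simp add: vec_eq_iff axis_def)
    show ?thesis
      using trig_poly_imp_approx[OF trig_poly.sin[of L "axis k (1 / L)" "- z $ k / L"]]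
      unfolding 1 2 .
  qed
  have "trig_approx (\<lambda>x. \<Sum>k\<in>UNIV. (Q u) $ k * (L * sin ((x - z) $ k / L)))
     (\<lambda>x. \<Sum>k\<in>UNIV. (Q u) $ k *\<^sub>R (cos ((x - z) $ k / L) *\<^sub>R axis k 1))"
    by (intro trig_approx_sum trig_approx_cmult coord) auto
  moreover have "u \<bullet> Q (\<xi> L x - z) = (\<Sum>k\<in>UNIV. (Q u) $ k * (L * sin ((x - z) $ k / L)))" for x
    unfolding symQ[of u] by (simp add: \<xi>_def inner_vec_def mult.commute)
  moreover have "d\<xi> L x (Q u) = (\<Sum>k\<in>UNIV. (Q u) $ k *\<^sub>R (cos ((x - z) $ k / L) *\<^sub>R axis k 1))" for x
    by (simp add: vec_eq_iff d\<xi>_def axis_def if_distrib cong: if_cong)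
  ultimately show ?thesis by simp
qed

definition \<pi>\<xi> :: "real \<Rightarrow> real \<Rightarrow> real^'n \<Rightarrow> real^'n \<Rightarrow> real" where
  "\<pi>\<xi> L t u x = wt u * E u t (\<xi> L x) * inverse (D t (\<xi> L x))"

text \<open>The gradient of \<open>\<pi>\<xi>\<close> in the unsimplified form in which the rules
  for products, exponentials and reciprocals of \<open>trig_approx\<close> produce it; only its
  limit is simplified, in \<open>tendsto_grad\<pi>\<xi>\<close>.\<close>

definition grad\<pi>\<xi> :: "real \<Rightarrow> real \<Rightarrow> real^'n \<Rightarrow> real^'n \<Rightarrow> real^'n" where
  "grad\<pi>\<xi> L t u x = (wt u * E u t (\<xi> L x)) *\<^sub>R ((- (inverse (D t (\<xi> L x)))\<^sup>2) *\<^sub>R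
       (\<Sum>u\<in>I. wt u *\<^sub>R (E u t (\<xi> L x) *\<^sub>R (t *\<^sub>R d\<xi> L x (Q u)))))
     + inverse (D t (\<xi> L x)) *\<^sub>R (wt u *\<^sub>R (E u t (\<xi> L x) *\<^sub>R (t *\<^sub>R d\<xi> L x (Q u))))"

lemma trig_approx_\<pi>\<xi>:
  assumes L: "0 < L" and u: "u \<in> I"
  shows "trig_approx (\<pi>\<xi> L t u) (grad\<pi>\<xi> L t u)"
proof -
  have e: "trig_approx (\<lambda>x. t * (u \<bullet> Q (\<xi> L x - z)) + (- (t\<^sup>2 * (u \<bullet> Q u) / 2))) (\<lambda>x. t *\<^sub>R d\<xi> L x (Q u) + 0)" for u
    by (intro trig_approx_add trig_approx_cmult trig_approx_const trig_approx_linear_\<xi> L)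
  have E: "trig_approx (\<lambda>x. E u t (\<xi> L x)) (\<lambda>x. E u t (\<xi> L x) *\<^sub>R (t *\<^sub>R d\<xi> L x (Q u)))" for u
    using trig_approx_exp[OF e[of u]] by (simp add: E_def)
  have wE: "trig_approx (\<lambda>x. wt u * E u t (\<xi> L x)) (\<lambda>x. wt u *\<^sub>R (E u t (\<xi> L x) *\<^sub>R (t *\<^sub>R d\<xi> L x (Q u))))" for u
    by (rule trig_approx_cmult[OF E])
  have DD: "trig_approx (\<lambda>x. D t (\<xi> L x)) (\<lambda>x. \<Sum>u\<in>I. wt u *\<^sub>R (E u t (\<xi> L x) *\<^sub>R (t *\<^sub>R d\<xi> L x (Q u))))"
    unfolding D_def by (intro trig_approx_sum I wE)
  \<comment> \<open>The rule for reciprocals needs \<open>D\<close> bounded away from 0. On the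
    range of \<open>\<xi> L\<close> one component of positive weight provides this, because its
    exponent is bounded there.\<close>
  obtain u0 where u0: "u0 \<in> I" "wt u0 > 0"
    using sum_wt wt by (metis less_eq_real_def sum.neutral zero_neq_one)
  obtain B where B: "\<forall>x. \<bar>t * (u0 \<bullet> Q (\<xi> L x - z)) + (- (t\<^sup>2 * (u0 \<bullet> Q u0) / 2))\<bar> \<le> B"
    using trig_approx_bounded[OF e[of u0]] by blast
  have lower: "wt u0 * exp (- B) \<le> D t (\<xi> L x)" for x
  proof -
    have "exp (- B) \<le> E u0 t (\<xi> L x)" using B[rule_format, of x] by (simp add: E_def)
    then have "wt u0 * exp (- B) \<le> wt u0 * E u0 t (\<xi> L x)" using u0 by simp
    also have "\<dots> \<le> D t (\<xi> L x)"
      unfolding D_def using u0 I wt by (intro member_le_sum) (auto simp: E_def)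
    finally show ?thesis .
  qed
  have "trig_approx (\<lambda>x. inverse (D t (\<xi> L x))) (\<lambda>x. (- (inverse (D t (\<xi> L x)))\<^sup>2) *\<^sub>R
      (\<Sum>u\<in>I. wt u *\<^sub>R (E u t (\<xi> L x) *\<^sub>R (t *\<^sub>R d\<xi> L x (Q u)))))"
    by (rule trig_approx_inverse[OF DD _ lower]) (use u0 in simp)
  from trig_approx_mult[OF wE this] show ?thesis
    unfolding \<pi>\<xi>_def[abs_def] grad\<pi>\<xi>_def[abs_def] .
qed

lemma tendsto_\<pi>\<xi>: "(\<lambda>n. \<pi>\<xi> (real (Suc n)) t u x) \<longlonglongrightarrow> wt u * E u t x / D t x"
  unfolding \<pi>\<xi>_def divide_inverse using less_imp_neq[OF D_pos[of t x], symmetric]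
  by (intro tendsto_mult tendsto_inverse tendsto_E tendsto_D tendsto_const tendsto_\<xi>)

lemma tendsto_grad\<pi>\<xi>:
  "(\<lambda>n. grad\<pi>\<xi> (real (Suc n)) t u x) \<longlonglongrightarrow> (t * (wt u * E u t x / D t x)) *\<^sub>R (Q u - Q (v t x))"
proof -
  have D: "D t x \<noteq> 0" using D_pos[of t x] by simp
  define g where "g = (\<Sum>u\<in>I. wt u *\<^sub>R (E u t x *\<^sub>R (t *\<^sub>R Q u)))"
  have "(\<lambda>n. grad\<pi>\<xi> (real (Suc n)) t u x) \<longlonglongrightarrow>
    (wt u * E u t x) *\<^sub>R ((- (inverse (D t x))\<^sup>2) *\<^sub>R g)
     + inverse (D t x) *\<^sub>R (wt u *\<^sub>R (E u t x *\<^sub>R (t *\<^sub>R Q u)))"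
    unfolding grad\<pi>\<xi>_def g_def
    by (intro tendsto_add tendsto_scaleR tendsto_mult tendsto_minus tendsto_power tendsto_sum
        tendsto_inverse tendsto_E tendsto_D tendsto_const tendsto_\<xi> tendsto_d\<xi> D)
  moreover have "g = (t * D t x) *\<^sub>R Q (v t x)"
  proof -
    have "Q (v t x) = (\<Sum>u\<in>I. (wt u * E u t x / D t x) *\<^sub>R Q u)"
      unfolding v_def by (simp add: linear_sum[OF linQ] linear_scale[OF linQ])
    then show ?thesis using D by (simp add: g_def scaleR_sum_right mult.commute mult.left_commute)
  qed
  moreover have "(wt u * E u t x) *\<^sub>R ((- (inverse (D t x))\<^sup>2) *\<^sub>R ((t * D t x) *\<^sub>R Q (v t x)))
     + inverse (D t x) *\<^sub>R (wt u *\<^sub>R (E u t x *\<^sub>R (t *\<^sub>R Q u)))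
     = (t * (wt u * E u t x / D t x)) *\<^sub>R (Q u - Q (v t x))"
  proof -
    have a: "wt u * E u t x * (- (inverse (D t x))\<^sup>2 * (t * D t x)) = - (t * (wt u * E u t x / D t x))"
      "inverse (D t x) * (wt u * (E u t x * t)) = t * (wt u * E u t x / D t x)"
      using D by (simp_all add: field_simps power2_eq_square)
    show ?thesis unfolding scaleR_scaleR a by (simp add: scaleR_diff_right)
  qed
  ultimately show ?thesis by simp
qed

text \<open>The gradient is a weight, at most 1, times the difference of a vector
  \<open>t *\<^sub>R d\<xi> L x (Q u)\<close> and a weighted mean of such vectors, and
  \<open>d\<xi> L x\<close> does not increase norms whatever \<open>L\<close> is.\<close>

lemma grad\<pi>\<xi>_bounded:
  assumes t: "0 \<le> t" "t \<le> 1" shows "\<exists>C>0. \<forall>L x. \<forall>u\<in>I. norm (grad\<pi>\<xi> L t u x) \<le> C"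
proof -
  obtain M where M: "M > 0" "\<And>x. norm (Q x) \<le> M * norm x" using Q_bound by blast
  obtain U where U: "U > 0" "\<And>u. u \<in> I \<Longrightarrow> norm u \<le> U" using v_S_bounded by blast
  have dQ: "norm (t *\<^sub>R d\<xi> L x (Q u)) \<le> M * U" if "u \<in> I" for L x u
  proof -
    have "norm (t *\<^sub>R d\<xi> L x (Q u)) \<le> 1 * norm (d\<xi> L x (Q u))"
      unfolding norm_scaleR using t by (intro mult_right_mono) auto
    also have "\<dots> \<le> norm (Q u)" by (simp add: norm_d\<xi>_le)
    also have "\<dots> \<le> M * norm u" by (rule M)
    also have "\<dots> \<le> M * U" using M U(2)[OF that] by simp
    finally show ?thesis .
  qed
  have "norm (grad\<pi>\<xi> L t u x) \<le> 2 * (M * U)" if u: "u \<in> I" for L u x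
  proof -
    define y where "y = \<xi> L x"
    define p where "p = wt u * E u t y / D t y"
    define g where "g = (\<Sum>u\<in>I. wt u *\<^sub>R (E u t y *\<^sub>R (t *\<^sub>R d\<xi> L x (Q u))))"
    note D = D_pos[of t y]
    have Epos: "E u t y > 0" for u by (simp add: E_def)
    have p: "0 \<le> p" "p \<le> 1"
    proof -
      show "0 \<le> p" unfolding p_def by (rule weights(1)[OF u])
      have "wt u * E u t y \<le> D t y"
        unfolding D_def using u I wt Epos by (intro member_le_sum) (auto simp: less_imp_le)
      then show "p \<le> 1" using D by (simp add: p_def)
    qed
    have "norm g \<le> (\<Sum>u\<in>I. (wt u * E u t y) * (M * U))"
      unfolding g_def
    proof (rule sum_norm_le)
      fix u assume u: "u \<in> I"
      show "norm (wt u *\<^sub>R (E u t y *\<^sub>R (t *\<^sub>R d\<xi> L x (Q u)))) \<le> wt u * E u t y * (M * U)"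
        unfolding scaleR_scaleR[of "wt u"] norm_scaleR[of "wt u * E u t y"]
        using dQ[OF u] wt[OF u] Epos[of u] by (intro mult_mono) (auto simp: abs_mult)
    qed
    then have g: "norm g \<le> D t y * (M * U)" unfolding sum_distrib_right[symmetric] D_def .
    have eq: "grad\<pi>\<xi> L t u x = (- p / D t y) *\<^sub>R g + p *\<^sub>R (t *\<^sub>R d\<xi> L x (Q u))"
    proof -
      have "(wt u * E u t y) * (- (inverse (D t y))\<^sup>2) = - p / D t y" "inverse (D t y) * (wt u * E u t y) = p"
        using D by (simp_all add: p_def field_simps power2_eq_square)
      then have "(wt u * E u t y) *\<^sub>R ((- (inverse (D t y))\<^sup>2) *\<^sub>R g) = (- p / D t y) *\<^sub>R g"
        "inverse (D t y) *\<^sub>R (wt u *\<^sub>R (E u t y *\<^sub>R w)) = p *\<^sub>R w" for w :: "real^'n"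
        by (simp_all only: scaleR_scaleR mult.assoc)
      then show ?thesis by (simp only: grad\<pi>\<xi>_def y_def[symmetric] g_def[symmetric])
    qed
    have "norm (grad\<pi>\<xi> L t u x) \<le> norm ((- p / D t y) *\<^sub>R g) + norm (p *\<^sub>R (t *\<^sub>R d\<xi> L x (Q u)))"
      unfolding eq by (rule norm_triangle_ineq)
    also have "\<dots> = (p / D t y) * norm g + p * norm (t *\<^sub>R d\<xi> L x (Q u))"
      using p D by (simp add: abs_mult)
    also have "\<dots> \<le> (p / D t y) * (D t y * (M * U)) + p * (M * U)"
      using g dQ[OF u] p D by (intro add_mono mult_left_mono) auto
    also have "\<dots> = p * (2 * (M * U))" using D by simp
    also have "\<dots> \<le> 1 * (2 * (M * U))" using p M U by (intro mult_right_mono) auto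
    finally show ?thesis by simp
  qed
  then show ?thesis using M U by (intro exI[of _ "2 * (M * U)"]) auto
qed

lemma flowable_sum:
  "finite J \<Longrightarrow> (\<And>u. u \<in> J \<Longrightarrow> flowable (p u) (q u)) \<Longrightarrow> flowable (\<lambda>x. \<Sum>u\<in>J. p u x) (\<lambda>x. \<Sum>u\<in>J. q u x)"
  by (induction rule: finite_induct) (auto intro: flowable_add flowable_zero)

text \<open>The scale \<open>Suc n\<close> of the distortion and the trigonometric error
  \<open>1 / Suc n\<close> are tied to one index. Convergence is pointwise, while the bounds hold on
  all of space for all \<open>n\<close>, as dominated convergence requires.\<close>

lemma velocity_approx:
  assumes t: "0 \<le> t" "t \<le> 1"
  shows "\<exists>C p q. (\<forall>n::nat. flowable (p n) (q n)) \<and> (\<forall>n x. norm (p n x) \<le> C \<and> \<bar>q n x\<bar> \<le> C) \<and>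
     (\<forall>x. (\<lambda>n. p n x) \<longlonglongrightarrow> v t x \<and> (\<lambda>n. q n x) \<longlonglongrightarrow> dv t x)"
proof -
  obtain C where C: "C > 0" "\<And>L x u. u \<in> I \<Longrightarrow> norm (grad\<pi>\<xi> L t u x) \<le> C" using grad\<pi>\<xi>_bounded[OF t] by blast
  obtain U where U: "U > 0" "\<And>u. u \<in> I \<Longrightarrow> norm u \<le> U" using v_S_bounded by blast
  have "\<forall>n. \<forall>u\<in>I. \<exists>f F. trig_poly f F \<and> (\<forall>x. \<bar>\<pi>\<xi> (real (Suc n)) t u x - f x\<bar> \<le> inverse (real (Suc n)) \<and>
      norm (grad\<pi>\<xi> (real (Suc n)) t u x - F x) \<le> inverse (real (Suc n)))"
  proof (intro allI ballI)
    fix n u assume "u \<in> I"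
    then have "trig_approx (\<pi>\<xi> (real (Suc n)) t u) (grad\<pi>\<xi> (real (Suc n)) t u)" by (intro trig_approx_\<pi>\<xi>) auto
    then show "\<exists>f F. trig_poly f F \<and> (\<forall>x. \<bar>\<pi>\<xi> (real (Suc n)) t u x - f x\<bar> \<le> inverse (real (Suc n)) \<and>
      norm (grad\<pi>\<xi> (real (Suc n)) t u x - F x) \<le> inverse (real (Suc n)))"
      unfolding trig_approx_def by (metis inverse_positive_iff_positive of_nat_0_less_iff zero_less_Suc)
  qed
  then obtain f F where fF: "\<And>n u. u \<in> I \<Longrightarrow> trig_poly (f n u) (F n u)"
    and f: "\<And>n u x. u \<in> I \<Longrightarrow> \<bar>\<pi>\<xi> (real (Suc n)) t u x - f n u x\<bar> \<le> inverse (real (Suc n))"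
    and F: "\<And>n u x. u \<in> I \<Longrightarrow> norm (grad\<pi>\<xi> (real (Suc n)) t u x - F n u x) \<le> inverse (real (Suc n))"
    by metis
  have inv1: "inverse (real (Suc n)) \<le> 1" for n by (simp add: field_simps)
  have \<pi>1: "\<bar>\<pi>\<xi> L t u x\<bar> \<le> 1" if u: "u \<in> I" for L u x
  proof -
    have "\<pi>\<xi> L t u x \<ge> 0" using weights(1)[OF u, of t "\<xi> L x"] by (simp add: \<pi>\<xi>_def divide_inverse)
    moreover have "wt u * E u t (\<xi> L x) \<le> D t (\<xi> L x)"
      unfolding D_def using u I wt by (intro member_le_sum) (auto simp: E_def)
    then have "\<pi>\<xi> L t u x \<le> 1" using D_pos[of t "\<xi> L x"] by (simp add: \<pi>\<xi>_def field_simps)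
    ultimately show ?thesis by simp
  qed
  have fb: "\<bar>f n u x\<bar> \<le> 2" if "u \<in> I" for n u x
    using f[OF that, of n x] \<pi>1[OF that, of "real (Suc n)" x] inv1[of n] by linarith
  have Fb: "norm (F n u x) \<le> C + 1" if "u \<in> I" for n u x
    using F[OF that, of n x] C(2)[OF that, of "real (Suc n)" x] inv1[of n]
      norm_triangle_sub[of "F n u x" "grad\<pi>\<xi> (real (Suc n)) t u x"]
      norm_minus_commute[of "F n u x" "grad\<pi>\<xi> (real (Suc n)) t u x"] by linarith
  have flim: "(\<lambda>n. f n u x) \<longlonglongrightarrow> wt u * E u t x / D t x" if "u \<in> I" for u x
  proof -
    have "(\<lambda>n. \<pi>\<xi> (real (Suc n)) t u x - f n u x) \<longlonglongrightarrow> 0"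
      by (rule tendsto_rabs_zero_cancel, rule tendsto_sandwich[OF _ _ tendsto_const LIMSEQ_inverse_real_of_nat])
        (use f[OF that] in auto)
    from tendsto_diff[OF tendsto_\<pi>\<xi>[of t u x] this] show ?thesis by simp
  qed
  have Flim: "(\<lambda>n. F n u x) \<longlonglongrightarrow> (t * (wt u * E u t x / D t x)) *\<^sub>R (Q u - Q (v t x))" if "u \<in> I" for u x
  proof -
    have "(\<lambda>n. grad\<pi>\<xi> (real (Suc n)) t u x - F n u x) \<longlonglongrightarrow> 0"
      by (rule tendsto_norm_zero_cancel, rule tendsto_sandwich[OF _ _ tendsto_const LIMSEQ_inverse_real_of_nat])
        (use F[OF that] in auto)
    from tendsto_diff[OF tendsto_grad\<pi>\<xi>[of t u x] this] show ?thesis by simp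
  qed
  define p where "p n x = (\<Sum>u\<in>I. f n u x *\<^sub>R u)" for n x
  define q where "q n x = (\<Sum>u\<in>I. F n u x \<bullet> u)" for n x
  have 1: "flowable (p n) (q n)" for n
    unfolding p_def[abs_def] q_def[abs_def] by (intro flowable_sum I flowable_trig_poly fF)
  have 2: "norm (p n x) \<le> (\<Sum>u\<in>I. 2 * U)" for n x
    unfolding p_def
  proof (rule sum_norm_le)
    fix u assume u: "u \<in> I"
    show "norm (f n u x *\<^sub>R u) \<le> 2 * U"
      unfolding norm_scaleR using fb[OF u] U(2)[OF u] by (intro mult_mono) auto
  qed
  have 3: "\<bar>q n x\<bar> \<le> (\<Sum>u\<in>I. (C + 1) * U)" for n x
    unfolding q_def real_norm_def[symmetric]
  proof (rule sum_norm_le)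
    fix u assume u: "u \<in> I"
    have "norm (F n u x \<bullet> u) \<le> norm (F n u x) * norm u" by (simp add: Cauchy_Schwarz_ineq2)
    also have "\<dots> \<le> (C + 1) * U" using Fb[OF u] U(2)[OF u] C by (intro mult_mono) auto
    finally show "norm (F n u x \<bullet> u) \<le> (C + 1) * U" .
  qed
  have 4: "(\<lambda>n. p n x) \<longlonglongrightarrow> v t x" for x
    unfolding p_def v_def by (intro tendsto_sum tendsto_scaleR flim tendsto_const)
  have 5: "(\<lambda>n. q n x) \<longlonglongrightarrow> dv t x" for x
  proof -
    define r where "r u = wt u * E u t x / D t x" for u
    have "(\<lambda>n. q n x) \<longlonglongrightarrow> (\<Sum>u\<in>I. ((t * r u) *\<^sub>R (Q u - Q (v t x))) \<bullet> u)"
      unfolding q_def r_def by (intro tendsto_sum tendsto_inner Flim tendsto_const)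
    moreover have "((t * r u) *\<^sub>R (Q u - Q (v t x))) \<bullet> u = t * (r u * (u \<bullet> Q u)) - t * (r u * (u \<bullet> Q (v t x)))" for u
      by (simp add: inner_diff_right inner_commute[of _ u] right_diff_distrib mult.assoc)
    then have "(\<Sum>u\<in>I. ((t * r u) *\<^sub>R (Q u - Q (v t x))) \<bullet> u) = t * (\<Sum>u\<in>I. r u * (u \<bullet> Q u)) - t * ((\<Sum>u\<in>I. r u *\<^sub>R u) \<bullet> Q (v t x))"
      by (simp add: inner_sum_left sum_distrib_left sum_subtractf)
    ultimately show ?thesis unfolding dv_def S_def v_def[of t x, folded r_def] r_def[symmetric] by simp
  qed
  show ?thesis
    by (rule exI[of _ "max (\<Sum>u\<in>I. 2 * U) (\<Sum>u\<in>I. (C + 1) * U)"], rule exI[of _ p], rule exI[of _ q])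
      (use 1 2 3 4 5 in \<open>simp add: le_max_iff_disj\<close>)
qed

section \<open>Exponential moments over short time steps\<close>

lemma v_measurable [measurable]: "v t \<in> borel_measurable borel"
  and S_measurable [measurable]: "S t \<in> borel_measurable borel"
  unfolding v_def[abs_def] S_def[abs_def] by measurable

text \<open>\<open>rate t p q\<close> is the rate at which \<open>ln (\<rho> t)\<close> gains over the density transported by \<open>p\<close>;
  it vanishes for \<open>p = v t\<close>, \<open>q = dv t\<close>.\<close>

definition rate :: "real \<Rightarrow> (real^'n \<Rightarrow> real^'n) \<Rightarrow> (real^'n \<Rightarrow> real) \<Rightarrow> real^'n \<Rightarrow> real" where
  "rate t p q x = (v t x \<bullet> Q (x - z) - t * S t x) - p x \<bullet> Q (x - z) + t * (v t x \<bullet> Q (p x)) + q x"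

lemma tail_dominated:
  assumes t: "0 \<le> t" "t \<le> 1" and A: "\<And>t x. 0 \<le> t \<and> t \<le> 1 \<longrightarrow> \<rho> t x \<le> K * exp (- (c / 2) * (norm (x - z))\<^sup>2 + A * norm (x - z))"
    and e: "e \<le> A' * norm (x - z) + B"
  shows "\<rho> t x * exp e \<le> K * exp (- (c / 2) * (norm (x - z))\<^sup>2 + (A + A') * norm (x - z) + B)"
proof -
  have "\<rho> t x * exp e \<le> (K * exp (- (c / 2) * (norm (x - z))\<^sup>2 + A * norm (x - z))) * exp (A' * norm (x - z) + B)"
    using A[of t x] t e K \<rho>_pos[of t x] by (intro mult_mono) auto
  also have "\<dots> = K * exp (- (c / 2) * (norm (x - z))\<^sup>2 + (A + A') * norm (x - z) + B)"
    by (simp add: exp_add[symmetric] algebra_simps)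
  finally show ?thesis .
qed

lemma dominating_integral_finite:
  "(\<integral>\<^sup>+x. ennreal (K * exp (- (c / 2) * (norm (x - z))\<^sup>2 + A * norm (x - z) + B)) \<partial>lborel) < \<infinity>"
proof -
  have "(\<integral>\<^sup>+x. ennreal (K * exp (- (c / 2) * (norm (x - z))\<^sup>2 + A * norm (x - z) + B)) \<partial>lborel)
    = ennreal K * (\<integral>\<^sup>+x. ennreal (exp (- (c / 2) * (norm (x - z))\<^sup>2 + A * norm (x - z) + B)) \<partial>lborel)"
    using K by (subst nn_integral_cmult[symmetric]) (auto simp: ennreal_mult')
  also have "\<dots> < \<infinity>"
    using nn_integral_gaussian_tail_finite[of "c / 2" z A B] c by (simp add: ennreal_mult_less_top)
  finally show ?thesis .
qed

text \<open>The rates of the approximating fields grow at most linearly in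
  \<open>norm (x - z)\<close>, uniformly in \<open>n\<close>, so the Gaussian tail of
  \<open>\<rho> t\<close> dominates their exponentials. They tend to 0 pointwise, hence the moments
  tend to the total mass 1.\<close>

lemma exists_good_field:
  assumes t: "0 \<le> t" "t \<le> 1" and \<delta>: "\<delta> > 0"
  shows "\<exists>p q. flowable p q \<and> (\<integral>\<^sup>+x. ennreal (\<rho> t x * exp (rate t p q x)) \<partial>lborel) < ennreal (1 + \<delta>)"
proof -
  obtain C p q where flow: "\<And>n. flowable (p n) (q n)" and b: "\<And>n x. norm (p n x) \<le> C" "\<And>n x. \<bar>q n x\<bar> \<le> C"
    and lim: "\<And>x. (\<lambda>n. p n x) \<longlonglongrightarrow> v t x" "\<And>x. (\<lambda>n. q n x) \<longlonglongrightarrow> dv t x"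
    using velocity_approx[OF t] by blast
  obtain M where M: "M > 0" "\<And>x. norm (Q x) \<le> M * norm x" using Q_bound by blast
  obtain U where U: "U > 0" "\<And>t x. norm (v t x) \<le> U" "\<And>t x. \<bar>S t x\<bar> \<le> U" using v_S_bounded by blast
  obtain A where A: "\<And>t x. 0 \<le> t \<and> t \<le> 1 \<longrightarrow> \<rho> t x \<le> K * exp (- (c / 2) * (norm (x - z))\<^sup>2 + A * norm (x - z))"
    using \<rho>_bounded by blast
  have C0: "C \<ge> 0" using b(1)[of 0 0] norm_ge_zero order_trans by blast
  have rate_le: "rate t (p n) (q n) x \<le> ((U + C) * M) * norm (x - z) + (U + U * (M * C) + C)" for n x
  proof -
    have "\<bar>v t x \<bullet> Q (x - z)\<bar> \<le> U * (M * norm (x - z))"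
      by (rule order_trans[OF Cauchy_Schwarz_ineq2]) (use U M in \<open>auto intro!: mult_mono\<close>)
    moreover have "\<bar>p n x \<bullet> Q (x - z)\<bar> \<le> C * (M * norm (x - z))"
      by (rule order_trans[OF Cauchy_Schwarz_ineq2]) (use b C0 M in \<open>auto intro!: mult_mono\<close>)
    moreover have "\<bar>t * S t x\<bar> \<le> U"
      using U(3)[of t x] t mult_left_le_one_le[of "\<bar>S t x\<bar>" t] by (simp add: abs_mult)
    moreover have "\<bar>t * (v t x \<bullet> Q (p n x))\<bar> \<le> U * (M * C)"
    proof -
      have "norm (Q (p n x)) \<le> M * C" using M(2)[of "p n x"] mult_left_mono[OF b(1)[of n x], of M] M(1) by linarith
      then have "\<bar>v t x \<bullet> Q (p n x)\<bar> \<le> U * (M * C)"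
        by (intro order_trans[OF Cauchy_Schwarz_ineq2]) (use U in \<open>auto intro!: mult_mono\<close>)
      then show ?thesis using t mult_left_le_one_le[of "\<bar>v t x \<bullet> Q (p n x)\<bar>" t] by (simp add: abs_mult)
    qed
    moreover have "((U + C) * M) * norm (x - z) = U * (M * norm (x - z)) + C * (M * norm (x - z))" by (simp add: algebra_simps)
    ultimately show ?thesis using b(2)[of n x] unfolding rate_def by linarith
  qed
  have [measurable]: "p n \<in> borel_measurable borel" "q n \<in> borel_measurable borel" for n
    using flow[of n] by (auto simp: flowable_def intro: borel_measurable_continuous_onI)
  have ratem [measurable]: "rate t (p n) (q n) \<in> borel_measurable borel" for n
    unfolding rate_def[abs_def] by measurable
  have "(\<lambda>n. \<integral>\<^sup>+x. ennreal (\<rho> t x * exp (rate t (p n) (q n) x)) \<partial>lborel) \<longlonglongrightarrow> (\<integral>\<^sup>+x. ennreal (\<rho> t x) \<partial>lborel)"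
  proof (rule nn_integral_dominated_convergence[where w = "\<lambda>x. ennreal (K * exp (- (c / 2) * (norm (x - z))\<^sup>2
      + (A + (U + C) * M) * norm (x - z) + (U + U * (M * C) + C)))"])
    show "AE x in lborel. ennreal (\<rho> t x * exp (rate t (p n) (q n) x)) \<le> ennreal (K * exp (- (c / 2) * (norm (x - z))\<^sup>2
      + (A + (U + C) * M) * norm (x - z) + (U + U * (M * C) + C)))" for n
      by (intro AE_I2 ennreal_leI tail_dominated[OF t A rate_le])
    show "AE x in lborel. (\<lambda>n. ennreal (\<rho> t x * exp (rate t (p n) (q n) x))) \<longlonglongrightarrow> ennreal (\<rho> t x)"
    proof (rule AE_I2)
      fix x
      have "(\<lambda>n. rate t (p n) (q n) x) \<longlonglongrightarrow> (v t x \<bullet> Q (x - z) - t * S t x) - v t x \<bullet> Q (x - z) + t * (v t x \<bullet> Q (v t x)) + dv t x"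
        unfolding rate_def by (intro tendsto_add tendsto_diff tendsto_inner tendsto_mult tendsto_const lim tendsto_Q)
      then have "(\<lambda>n. rate t (p n) (q n) x) \<longlonglongrightarrow> 0" by (simp add: dv_def)
      then have "(\<lambda>n. \<rho> t x * exp (rate t (p n) (q n) x)) \<longlonglongrightarrow> \<rho> t x * exp 0"
        by (intro tendsto_mult tendsto_const tendsto_exp)
      then show "(\<lambda>n. ennreal (\<rho> t x * exp (rate t (p n) (q n) x))) \<longlonglongrightarrow> ennreal (\<rho> t x)"
        by (intro tendsto_ennrealI) simp
    qed
  qed (measurable, rule dominating_integral_finite)
  then have "(\<lambda>n. \<integral>\<^sup>+x. ennreal (\<rho> t x * exp (rate t (p n) (q n) x)) \<partial>lborel) \<longlonglongrightarrow> 1"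
    unfolding nn_integral_\<rho> .
  moreover have "1 < ennreal (1 + \<delta>)" using \<delta> by (simp add: ennreal_1[symmetric] ennreal_lessI del: ennreal_1)
  ultimately have "eventually (\<lambda>n. (\<integral>\<^sup>+x. ennreal (\<rho> t x * exp (rate t (p n) (q n) x)) \<partial>lborel) < ennreal (1 + \<delta>)) sequentially"
    by (rule order_tendstoD)
  then obtain n where "(\<integral>\<^sup>+x. ennreal (\<rho> t x * exp (rate t (p n) (q n) x)) \<partial>lborel) < ennreal (1 + \<delta>)"
    by (auto simp: eventually_sequentially)
  then show ?thesis using flow by blast
qed

text \<open>The moment condition of \<open>KLnn_step\<close> for \<open>\<rho> t\<close> against the
  transport of \<open>\<rho> s\<close>, with \<open>h = t - s\<close>. The target does not occur in
  it.\<close>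

definition good_step :: "real \<Rightarrow> real \<Rightarrow> real \<Rightarrow> bool" where
  "good_step \<delta> s t \<longleftrightarrow> (\<exists>\<Psi> J. pl \<Psi> J \<and>
      (\<integral>\<^sup>+x. ennreal (\<rho> t x * exp (ln (\<rho> t x / push \<Psi> J (\<rho> s) x) / (t - s))) \<partial>lborel) \<le> ennreal (1 + \<delta>))"

text \<open>One field, chosen at time \<open>t0\<close>, serves all short intervals around
  \<open>t0\<close>. Otherwise bad intervals would shrink to \<open>t0\<close>; along them the
  exponents converge pointwise to the rate of this field at \<open>t0\<close>, and dominated
  convergence contradicts badness. Intervals containing a given point are what the bisection
  argument asks for.\<close>

lemma local_step:
  assumes t0: "0 \<le> t0" "t0 \<le> 1" and \<delta>: "\<delta> > 0"
  shows "\<exists>d>0. \<forall>s t. 0 \<le> s \<and> s \<le> t0 \<and> t0 \<le> t \<and> t \<le> 1 \<and> s < t \<and> t - s < d \<longrightarrow> good_step \<delta> s t"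
proof (rule ccontr)
  assume contra: "\<not> ?thesis"
  obtain p q where flow: "flowable p q" and pq: "(\<integral>\<^sup>+x. ennreal (\<rho> t0 x * exp (rate t0 p q x)) \<partial>lborel) < ennreal (1 + \<delta>)"
    using exists_good_field[OF t0 \<delta>] by blast
  obtain C where C: "C \<ge> 0" and step: "\<forall>\<epsilon>>0. \<forall>R. \<exists>h0>0. \<forall>h. 0 < h \<and> h \<le> h0 \<longrightarrow> pl_step_near C p q \<epsilon> R h"
    using flow unfolding flowable_def by blast
  have "\<forall>n. \<exists>h0. h0 > 0 \<and> (\<forall>h. 0 < h \<and> h \<le> h0 \<longrightarrow> pl_step_near C p q (inverse (real (Suc n))) (real n) h)"
    using step by simp
  from choice[OF this] obtain h0 where h0': "\<forall>n. h0 n > 0 \<and> (\<forall>h. 0 < h \<and> h \<le> h0 n \<longrightarrow> pl_step_near C p q (inverse (real (Suc n))) (real n) h)"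
    by (elim exE)
  then have h0: "h0 n > 0" "0 < h \<Longrightarrow> h \<le> h0 n \<Longrightarrow> pl_step_near C p q (inverse (real (Suc n))) (real n) h" for n h
    using h0'[THEN spec, of n] by blast+
  have contra': "\<exists>s t. 0 \<le> s \<and> s \<le> t0 \<and> t0 \<le> t \<and> t \<le> 1 \<and> s < t \<and> t - s < d \<and> \<not> good_step \<delta> s t" if "d > 0" for d
    using contra that by blast
  \<comment> \<open>The intervals are also shorter than \<open>h0 n\<close>, so that on the n-th one
    a step of accuracy \<open>1 / Suc n\<close> on the ball of radius \<open>n\<close> is
    available.\<close>
  have "\<forall>n. \<exists>st. 0 \<le> fst st \<and> fst st \<le> t0 \<and> t0 \<le> snd st \<and> snd st \<le> 1 \<and> fst st < snd st \<and>
      snd st - fst st < min (h0 n) (inverse (real (Suc n))) \<and> \<not> good_step \<delta> (fst st) (snd st)"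
  proof
    fix n
    have "min (h0 n) (inverse (real (Suc n))) > 0" using h0(1) by simp
    from contra'[OF this] obtain s t where "0 \<le> s \<and> s \<le> t0 \<and> t0 \<le> t \<and> t \<le> 1 \<and> s < t \<and>
      t - s < min (h0 n) (inverse (real (Suc n))) \<and> \<not> good_step \<delta> s t" by (elim exE)
    then show "\<exists>st. 0 \<le> fst st \<and> fst st \<le> t0 \<and> t0 \<le> snd st \<and> snd st \<le> 1 \<and> fst st < snd st \<and>
      snd st - fst st < min (h0 n) (inverse (real (Suc n))) \<and> \<not> good_step \<delta> (fst st) (snd st)"
      by (intro exI[of _ "(s, t)"]) (simp only: fst_conv snd_conv simp_thms)
  qed
  from choice[OF this] obtain st' where st': "\<forall>n. 0 \<le> fst (st' n) \<and> fst (st' n) \<le> t0 \<and> t0 \<le> snd (st' n) \<and> snd (st' n) \<le> 1 \<and> fst (st' n) < snd (st' n) \<and>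
      snd (st' n) - fst (st' n) < min (h0 n) (inverse (real (Suc n))) \<and> \<not> good_step \<delta> (fst (st' n)) (snd (st' n))"
    by (elim exE)
  define s t where "s n = fst (st' n)" and "t n = snd (st' n)" for n
  have st: "0 \<le> s n" "s n \<le> t0" "t0 \<le> t n" "t n \<le> 1" "s n < t n"
    "t n - s n < min (h0 n) (inverse (real (Suc n)))" and bad: "\<not> good_step \<delta> (s n) (t n)" for n
    using st'[THEN spec, of n] unfolding s_def[symmetric] t_def[symmetric] by blast+
  define h where "h n = t n - s n" for n
  have h: "h n > 0" "h n \<le> h0 n" "h n < inverse (real (Suc n))" for n using st(5,6)[of n] by (auto simp: h_def)
  have h1: "h n \<le> 1" for n using h(3)[of n] inverse_le_1_iff[of "real (Suc n)"] by linarith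
  define Near where "Near n \<Psi> J \<longleftrightarrow> pl \<Psi> J \<and> (\<forall>x. norm (\<Psi> x - x) \<le> C * h n \<and> \<bar>ln (J x)\<bar> \<le> C * h n) \<and>
      (\<forall>x. norm x \<le> real n \<longrightarrow> norm (x - \<Psi> x - h n *\<^sub>R p x) \<le> inverse (real (Suc n)) * h n \<and> \<bar>ln (J x) + h n * q x\<bar> \<le> inverse (real (Suc n)) * h n)" for n \<Psi> J
  have "\<forall>n. \<exists>\<Psi>J. Near n (fst \<Psi>J) (snd \<Psi>J)"
    using h0(2)[OF h(1,2)] unfolding pl_step_near_def Near_def by simp
  from choice[OF this] obtain \<Psi>J where near: "\<forall>n. Near n (fst (\<Psi>J n)) (snd (\<Psi>J n))" by blast
  define \<Psi> J where "\<Psi> n = fst (\<Psi>J n)" and "J n = snd (\<Psi>J n)" for n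
  have near': "Near n (\<Psi> n) (J n)" for n using near by (simp add: \<Psi>_def J_def)
  have pl: "pl (\<Psi> n) (J n)"
    and b: "norm (\<Psi> n x - x) \<le> C * h n" "\<bar>ln (J n x)\<bar> \<le> C * h n"
    and l: "norm x \<le> real n \<Longrightarrow> norm (x - \<Psi> n x - h n *\<^sub>R p x) \<le> inverse (real (Suc n)) * h n"
      "norm x \<le> real n \<Longrightarrow> \<bar>ln (J n x) + h n * q x\<bar> \<le> inverse (real (Suc n)) * h n" for n x
    using near'[of n] by (simp_all add: Near_def)
  have hlim: "h \<longlonglongrightarrow> 0"
    by (rule tendsto_sandwich[OF _ _ tendsto_const LIMSEQ_inverse_real_of_nat]) (use h in \<open>auto intro!: always_eventually less_imp_le\<close>)
  have mid: "(\<lambda>n. r n) \<longlonglongrightarrow> t0" if "\<And>n. s n \<le> r n" "\<And>n. r n \<le> t n" for r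
  proof -
    have "\<bar>r n - t0\<bar> \<le> h n" for n using that[of n] st(2,3)[of n] by (auto simp: h_def)
    then have "(\<lambda>n. r n - t0) \<longlonglongrightarrow> 0"
      by (intro tendsto_rabs_zero_cancel[OF tendsto_sandwich[OF _ _ tendsto_const hlim]]) auto
    from tendsto_add[OF this tendsto_const[of t0]] show ?thesis by simp
  qed
  \<comment> \<open>\<open>e\<close> is the exponent in the moment condition and \<open>W\<close>
    the average velocity of the step. \<open>mean\<close> states that \<open>e\<close> has the form
    of \<open>rate\<close> at an intermediate time and point, with \<open>W\<close> as the field and
    \<open>- (ln (J n x) / h n)\<close> as its divergence.\<close>
  define e where "e n x = ln (\<rho> (t n) x / push (\<Psi> n) (J n) (\<rho> (s n)) x) / h n" for n x
  define W where "W n x = (1 / h n) *\<^sub>R (x - \<Psi> n x)" for n x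
  have W: "norm (W n x) \<le> C" for n x
  proof -
    have "norm (W n x) = norm (\<Psi> n x - x) / h n" using h(1)[of n] by (simp add: W_def norm_minus_commute)
    also have "\<dots> \<le> C" using b(1)[of n x] h(1)[of n] by (simp add: pos_divide_le_eq)
    finally show ?thesis .
  qed
  define mean where "mean n x T X \<longleftrightarrow> s n \<le> T \<and> T \<le> t n \<and> norm (X - x) \<le> C * h n \<and>
    e n x = (v T X \<bullet> Q (X - z) - T * S T X) - W n x \<bullet> Q (X - z) + T * (v T X \<bullet> Q (W n x)) + (- (ln (J n x) / h n))" for n x T X
  have "\<exists>T X. mean n x T X" for n x
  proof -
    obtain \<tau> T X where \<tau>: "0 < \<tau>" "\<tau> < 1" and T: "T = s n + \<tau> * h n" and X: "X = \<Psi> n x + \<tau> *\<^sub>R (x - \<Psi> n x)"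
      and eq: "ln (\<rho> (s n + h n) x) - ln (\<rho> (s n) (\<Psi> n x)) =
      h n * (v T X \<bullet> Q (X - z) - T * S T X) - (x - \<Psi> n x) \<bullet> Q (X - z) + T * (v T X \<bullet> Q (x - \<Psi> n x))"
      using ln_\<rho>_diff[of "s n" "h n" "\<Psi> n x" x] by blast
    have "\<tau> * h n \<le> h n" "0 \<le> \<tau> * h n" using \<tau> h(1)[of n] by (simp_all add: mult_left_le_one_le)
    then have T': "s n \<le> T" "T \<le> t n" by (auto simp: T h_def)
    have "X - x = (1 - \<tau>) *\<^sub>R (\<Psi> n x - x)" by (simp add: X scaleR_diff_left scaleR_diff_right)
    then have "norm (X - x) = (1 - \<tau>) * norm (\<Psi> n x - x)" using \<tau> by simp
    also have "\<dots> \<le> norm (\<Psi> n x - x)" using \<tau> by (intro mult_left_le_one_le) auto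
    finally have X': "norm (X - x) \<le> C * h n" using b(1)[of n x] by linarith
    have hW: "x - \<Psi> n x = h n *\<^sub>R W n x" using h(1)[of n] by (simp add: W_def)
    have sh: "s n + h n = t n" by (simp add: h_def)
    have "ln (\<rho> (t n) x / push (\<Psi> n) (J n) (\<rho> (s n)) x) = (ln (\<rho> (t n) x) - ln (\<rho> (s n) (\<Psi> n x))) - ln (J n x)"
      using \<rho>_pos[of "t n" x] \<rho>_pos[of "s n" "\<Psi> n x"] pl_pos[OF pl, of n x]
      by (simp add: push_def ln_div ln_mult less_imp_neq[symmetric])
    also have "\<dots> = h n * ((v T X \<bullet> Q (X - z) - T * S T X) - W n x \<bullet> Q (X - z) + T * (v T X \<bullet> Q (W n x)) + (- (ln (J n x) / h n)))"
      unfolding eq[unfolded sh] hW Q_simps using h(1)[of n] by (simp add: ring_distribs)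
    finally have "e n x = (v T X \<bullet> Q (X - z) - T * S T X) - W n x \<bullet> Q (X - z) + T * (v T X \<bullet> Q (W n x)) + (- (ln (J n x) / h n))"
      unfolding e_def using h(1)[of n] by simp
    with T' X' show ?thesis unfolding mean_def by blast
  qed
  then have ex: "\<exists>TX. mean n x (fst TX) (snd TX)" for n x by simp
  define TX where "TX n x = (SOME TX. mean n x (fst TX) (snd TX))" for n x
  define T X where "T n x = fst (TX n x)" and "X n x = snd (TX n x)" for n x
  have mean: "mean n x (T n x) (X n x)" for n x
    unfolding T_def X_def TX_def by (rule someI_ex[OF ex])
  then have T: "s n \<le> T n x" "T n x \<le> t n" and X: "norm (X n x - x) \<le> C * h n"
    and e: "e n x = (v (T n x) (X n x) \<bullet> Q (X n x - z) - T n x * S (T n x) (X n x)) - W n x \<bullet> Q (X n x - z)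
      + T n x * (v (T n x) (X n x) \<bullet> Q (W n x)) + (- (ln (J n x) / h n))" for n x
    by (simp_all add: mean_def)
  have Tlim: "(\<lambda>n. T n x) \<longlonglongrightarrow> t0" for x by (rule mid) (rule T)+
  have Xlim: "(\<lambda>n. X n x) \<longlonglongrightarrow> x" for x
  proof -
    have "(\<lambda>n. C * h n) \<longlonglongrightarrow> C * 0" by (rule tendsto_mult[OF tendsto_const hlim])
    then have Ch: "(\<lambda>n. C * h n) \<longlonglongrightarrow> 0" by simp
    have "(\<lambda>n. norm (X n x - x)) \<longlonglongrightarrow> 0"
      by (rule tendsto_sandwich[OF _ _ tendsto_const Ch]) (simp_all add: X)
    then have "(\<lambda>n. X n x - x) \<longlonglongrightarrow> 0" by (rule tendsto_norm_zero_cancel)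
    from tendsto_add[OF this tendsto_const[of x]] show ?thesis by simp
  qed
  have Wlim: "(\<lambda>n. W n x) \<longlonglongrightarrow> p x" for x
  proof -
    obtain N :: nat where N: "norm x \<le> real N" using real_arch_simple by blast
    have "(\<lambda>n. norm (W n x - p x)) \<longlonglongrightarrow> 0"
    proof (rule tendsto_sandwich[OF _ _ tendsto_const LIMSEQ_inverse_real_of_nat])
      show "eventually (\<lambda>n. norm (W n x - p x) \<le> inverse (real (Suc n))) sequentially"
      proof (rule eventually_sequentiallyI[of N])
        fix n assume "N \<le> n"
        then have "norm x \<le> real n" using N by simp
        note l(1)[OF this]
        moreover have "W n x - p x = (1 / h n) *\<^sub>R (x - \<Psi> n x - h n *\<^sub>R p x)"
          using h(1)[of n] by (simp add: W_def scaleR_diff_right)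
        ultimately show "norm (W n x - p x) \<le> inverse (real (Suc n))"
          using h(1)[of n] by (simp add: pos_divide_le_eq)
      qed
    qed simp
    then have "(\<lambda>n. W n x - p x) \<longlonglongrightarrow> 0" by (rule tendsto_norm_zero_cancel)
    from tendsto_add[OF this tendsto_const[of "p x"]] show ?thesis by simp
  qed
  have Jlim: "(\<lambda>n. - (ln (J n x) / h n)) \<longlonglongrightarrow> q x" for x
  proof -
    obtain N :: nat where N: "norm x \<le> real N" using real_arch_simple by blast
    have "(\<lambda>n. \<bar>ln (J n x) / h n + q x\<bar>) \<longlonglongrightarrow> 0"
    proof (rule tendsto_sandwich[OF _ _ tendsto_const LIMSEQ_inverse_real_of_nat])
      show "eventually (\<lambda>n. \<bar>ln (J n x) / h n + q x\<bar> \<le> inverse (real (Suc n))) sequentially"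
      proof (rule eventually_sequentiallyI[of N])
        fix n assume "N \<le> n"
        then have "norm x \<le> real n" using N by simp
        note l(2)[OF this]
        moreover have "ln (J n x) / h n + q x = (ln (J n x) + h n * q x) / h n"
          using h(1)[of n] by (simp add: add_divide_distrib)
        ultimately show "\<bar>ln (J n x) / h n + q x\<bar> \<le> inverse (real (Suc n))"
          using h(1)[of n] by (simp add: abs_divide pos_divide_le_eq)
      qed
    qed simp
    then have "(\<lambda>n. ln (J n x) / h n + q x) \<longlonglongrightarrow> 0" by (rule tendsto_rabs_zero_cancel)
    from tendsto_diff[OF tendsto_const[of "q x"] this] show ?thesis by simp
  qed
  have elim: "(\<lambda>n. e n x) \<longlonglongrightarrow> rate t0 p q x" for x
    unfolding e rate_def
    by (intro tendsto_add tendsto_diff tendsto_inner tendsto_mult tendsto_const tendsto_v tendsto_S tendsto_Q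
        Tlim Xlim Wlim Jlim)
  obtain M where M: "M > 0" "\<And>x. norm (Q x) \<le> M * norm x" using Q_bound by blast
  obtain U where U: "U > 0" "\<And>t x. norm (v t x) \<le> U" "\<And>t x. \<bar>S t x\<bar> \<le> U" using v_S_bounded by blast
  obtain A where A: "\<And>t x. 0 \<le> t \<and> t \<le> 1 \<longrightarrow> \<rho> t x \<le> K * exp (- (c / 2) * (norm (x - z))\<^sup>2 + A * norm (x - z))"
    using \<rho>_bounded by blast
  \<comment> \<open>Linear growth of the exponents, uniformly in \<open>n\<close>: the intermediate
    point is within \<open>C\<close> of \<open>x\<close>, because
    \<open>h n \<le> 1\<close>.\<close>
  define B1 where "B1 = (U + C) * M"
  define B0 where "B0 = (U + C) * (M * C) + (U + U * (M * C) + C)"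
  have e_le: "e n x \<le> B1 * norm (x - z) + B0" for n x
  proof -
    have "norm (X n x - z) \<le> norm (x - z) + norm (X n x - x)"
      using norm_triangle_ineq[of "X n x - x" "x - z"] by simp
    also have "norm (X n x - x) \<le> C" using X[of n x] h1[of n] C mult_left_mono[of "h n" 1 C] by linarith
    finally have Xz: "norm (Q (X n x - z)) \<le> M * (norm (x - z) + C)"
      using M(2)[of "X n x - z"] mult_left_mono[of "norm (X n x - z)" "norm (x - z) + C" M] M(1) by linarith
    have T01: "0 \<le> T n x" "T n x \<le> 1" using T[of n x] st(1,4)[of n] by linarith+
    have "\<bar>v (T n x) (X n x) \<bullet> Q (X n x - z)\<bar> \<le> U * (M * (norm (x - z) + C))"
      by (rule order_trans[OF Cauchy_Schwarz_ineq2]) (use U Xz in \<open>auto intro!: mult_mono\<close>)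
    moreover have "\<bar>W n x \<bullet> Q (X n x - z)\<bar> \<le> C * (M * (norm (x - z) + C))"
      by (rule order_trans[OF Cauchy_Schwarz_ineq2]) (use W C Xz in \<open>auto intro!: mult_mono\<close>)
    moreover have "\<bar>T n x * S (T n x) (X n x)\<bar> \<le> U"
      using U(3)[of "T n x" "X n x"] T01 mult_left_le_one_le[of "\<bar>S (T n x) (X n x)\<bar>" "T n x"] by (simp add: abs_mult)
    moreover have "\<bar>T n x * (v (T n x) (X n x) \<bullet> Q (W n x))\<bar> \<le> U * (M * C)"
    proof -
      have "norm (Q (W n x)) \<le> M * C" using M(2)[of "W n x"] mult_left_mono[OF W[of n x], of M] M(1) by linarith
      then have "\<bar>v (T n x) (X n x) \<bullet> Q (W n x)\<bar> \<le> U * (M * C)"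
        by (intro order_trans[OF Cauchy_Schwarz_ineq2]) (use U in \<open>auto intro!: mult_mono\<close>)
      then show ?thesis using T01 mult_left_le_one_le[of "\<bar>v (T n x) (X n x) \<bullet> Q (W n x)\<bar>" "T n x"] by (simp add: abs_mult)
    qed
    moreover have "\<bar>ln (J n x) / h n\<bar> \<le> C" using b(2)[of n x] h(1)[of n] by (simp add: abs_divide pos_divide_le_eq)
    moreover have "B1 * norm (x - z) + B0 = U * (M * (norm (x - z) + C)) + C * (M * (norm (x - z) + C)) + (U + U * (M * C) + C)"
      by (simp add: B1_def B0_def ring_distribs)
    ultimately show ?thesis unfolding e by linarith
  qed
  note [measurable] = push_measurable[OF pl \<rho>_measurable]
  have [measurable]: "p \<in> borel_measurable borel" "q \<in> borel_measurable borel"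
    using flow by (auto simp: flowable_def intro: borel_measurable_continuous_onI)
  have [measurable]: "rate t0 p q \<in> borel_measurable borel" "e n \<in> borel_measurable borel" for n
    unfolding rate_def[abs_def] e_def[abs_def] by measurable
  have "(\<lambda>n. \<integral>\<^sup>+x. ennreal (\<rho> (t n) x * exp (e n x)) \<partial>lborel) \<longlonglongrightarrow> (\<integral>\<^sup>+x. ennreal (\<rho> t0 x * exp (rate t0 p q x)) \<partial>lborel)"
  proof (rule nn_integral_dominated_convergence[where w = "\<lambda>x. ennreal (K * exp (- (c / 2) * (norm (x - z))\<^sup>2 + (A + B1) * norm (x - z) + B0))"])
    show "AE x in lborel. ennreal (\<rho> (t n) x * exp (e n x)) \<le> ennreal (K * exp (- (c / 2) * (norm (x - z))\<^sup>2 + (A + B1) * norm (x - z) + B0))" for n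
      by (intro AE_I2 ennreal_leI tail_dominated[OF _ st(4) A e_le]) (use st(3)[of n] t0 in linarith)
    show "AE x in lborel. (\<lambda>n. ennreal (\<rho> (t n) x * exp (e n x))) \<longlonglongrightarrow> ennreal (\<rho> t0 x * exp (rate t0 p q x))"
    proof (rule AE_I2)
      fix x
      have "(\<lambda>n. \<rho> (t n) x) \<longlonglongrightarrow> \<rho> t0 x"
        by (intro tendsto_\<rho> tendsto_const mid) (use st(5) in \<open>auto intro: less_imp_le\<close>)
      then show "(\<lambda>n. ennreal (\<rho> (t n) x * exp (e n x))) \<longlonglongrightarrow> ennreal (\<rho> t0 x * exp (rate t0 p q x))"
        by (intro tendsto_ennrealI tendsto_mult tendsto_exp elim)
    qed
  qed (measurable, rule dominating_integral_finite)
  then have "eventually (\<lambda>n. (\<integral>\<^sup>+x. ennreal (\<rho> (t n) x * exp (e n x)) \<partial>lborel) < ennreal (1 + \<delta>)) sequentially"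
    using pq by (rule order_tendstoD)
  then obtain n where "(\<integral>\<^sup>+x. ennreal (\<rho> (t n) x * exp (e n x)) \<partial>lborel) < ennreal (1 + \<delta>)"
    by (auto simp: eventually_sequentially)
  then have "good_step \<delta> (s n) (t n)"
    unfolding good_step_def e_def h_def using pl[of n] less_imp_le by blast
  with bad show False by simp
qed

text \<open>Bisection of the time interval: \<open>local_step\<close> supplies the short intervals,
  and for adjacent ones the exponential factors multiply.\<close>

lemma transport_KLnn:
  assumes \<delta>: "\<delta> > 0" and \<nu>: "\<nu> \<in> borel_measurable borel" "\<And>x. 0 \<le> \<nu> x"
  shows "\<exists>\<Psi> J. pl \<Psi> J \<and>
    KLnn \<nu> (push \<Psi> J (\<rho> 0)) + ennreal \<delta> \<le> ennreal (exp 1) * (KLnn \<nu> (\<rho> 1) + ennreal \<delta>)"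
proof -
  \<comment> \<open>The target is quantified inside \<open>P\<close>: when two intervals are joined,
    the map of the later one is absorbed into the target, so the earlier one is applied to a
    different target.\<close>
  define P where "P s t \<longleftrightarrow> (0 \<le> s \<and> s \<le> t \<and> t \<le> 1 \<longrightarrow> (\<forall>\<nu>\<in>borel_measurable borel. (\<forall>x. 0 \<le> \<nu> x) \<longrightarrow>
    (\<exists>\<Psi> J. pl \<Psi> J \<and> KLnn \<nu> (push \<Psi> J (\<rho> s)) + ennreal \<delta> \<le> ennreal (exp (t - s)) * (KLnn \<nu> (\<rho> t) + ennreal \<delta>))))" for s t
  have "(0::real) \<le> 1" by simp
  then have "P 0 1"
  proof (induction rule: Bolzano)
    case (trans r s t)
    show ?case unfolding P_def
    proof (intro impI ballI)
      fix \<nu> :: "real^'n \<Rightarrow> real"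
      assume rt: "0 \<le> r \<and> r \<le> t \<and> t \<le> 1" and \<nu> [measurable]: "\<nu> \<in> borel_measurable borel" and \<nu>0: "\<forall>x. 0 \<le> \<nu> x"
      have st: "0 \<le> s \<and> s \<le> t \<and> t \<le> 1" "0 \<le> r \<and> r \<le> s \<and> s \<le> 1" using rt trans(3,4) by auto
      obtain \<Psi>1 J1 where pl1: "pl \<Psi>1 J1" and le1: "KLnn \<nu> (push \<Psi>1 J1 (\<rho> s)) + ennreal \<delta> \<le> ennreal (exp (t - s)) * (KLnn \<nu> (\<rho> t) + ennreal \<delta>)"
        using trans(2)[unfolded P_def, rule_format, OF st(1) \<nu>] \<nu>0 by blast
      obtain \<Phi> where \<Phi> [measurable]: "\<Phi> \<in> borel_measurable borel" and inv: "\<And>x. \<Phi> (\<Psi>1 x) = x" "\<And>x. \<Psi>1 (\<Phi> x) = x"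
        by (rule pl_inverse[OF pl1]) (rule that)
      note [measurable] = pl_measurable[OF pl1]
      define \<nu>' where "\<nu>' = (\<lambda>y. \<nu> (\<Phi> y) / J1 (\<Phi> y))"
      have \<nu>'m: "\<nu>' \<in> borel_measurable borel" unfolding \<nu>'_def by measurable
      have \<nu>'0: "\<forall>x. 0 \<le> \<nu>' x" using \<nu>0 pl_pos[OF pl1] by (simp add: \<nu>'_def less_imp_le)
      obtain \<Psi>2 J2 where pl2: "pl \<Psi>2 J2" and le2: "KLnn \<nu>' (push \<Psi>2 J2 (\<rho> r)) + ennreal \<delta> \<le> ennreal (exp (s - r)) * (KLnn \<nu>' (\<rho> s) + ennreal \<delta>)"
        using trans(1)[unfolded P_def, rule_format, OF st(2) \<nu>'m] \<nu>'0 by blast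
      have "KLnn \<nu> (push \<Psi>1 J1 (push \<Psi>2 J2 (\<rho> r))) = KLnn \<nu>' (push \<Psi>2 J2 (\<rho> r))"
        unfolding \<nu>'_def by (rule KLnn_push[OF pl1 \<nu> push_measurable[OF pl2 \<rho>_measurable] \<Phi> inv(1)])
      moreover have "KLnn \<nu> (push \<Psi>1 J1 (\<rho> s)) = KLnn \<nu>' (\<rho> s)"
        unfolding \<nu>'_def by (rule KLnn_push[OF pl1 \<nu> \<rho>_measurable \<Phi> inv(1)])
      moreover have "push \<Psi>1 J1 (push \<Psi>2 J2 (\<rho> r)) = push (\<lambda>x. \<Psi>2 (\<Psi>1 x)) (\<lambda>x. J2 (\<Psi>1 x) * J1 x) (\<rho> r)"
        by (simp add: push_def fun_eq_iff mult.assoc)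
      ultimately have "KLnn \<nu> (push (\<lambda>x. \<Psi>2 (\<Psi>1 x)) (\<lambda>x. J2 (\<Psi>1 x) * J1 x) (\<rho> r)) + ennreal \<delta>
          \<le> ennreal (exp (s - r)) * (KLnn \<nu> (push \<Psi>1 J1 (\<rho> s)) + ennreal \<delta>)"
        using le2 by simp
      also have "\<dots> \<le> ennreal (exp (s - r)) * (ennreal (exp (t - s)) * (KLnn \<nu> (\<rho> t) + ennreal \<delta>))"
        by (intro mult_left_mono le1) simp
      also have "\<dots> = ennreal (exp (t - r)) * (KLnn \<nu> (\<rho> t) + ennreal \<delta>)"
        by (simp add: mult.assoc[symmetric] ennreal_mult'[symmetric] exp_add[symmetric])
      finally show "\<exists>\<Psi> J. pl \<Psi> J \<and> KLnn \<nu> (push \<Psi> J (\<rho> r)) + ennreal \<delta> \<le> ennreal (exp (t - r)) * (KLnn \<nu> (\<rho> t) + ennreal \<delta>)"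
        using pl_comp[OF pl1 pl2] by blast
    qed
  next
    case (local x)
    obtain d where d: "d > 0" and step: "\<And>s t. 0 \<le> s \<Longrightarrow> s \<le> x \<Longrightarrow> x \<le> t \<Longrightarrow> t \<le> 1 \<Longrightarrow> s < t \<Longrightarrow> t - s < d \<Longrightarrow> good_step \<delta> s t"
      using local_step[OF local \<delta>] by blast
    have "P a b" if ab: "a \<le> x" "x \<le> b" "b - a < d" for a b
      unfolding P_def
    proof (intro impI ballI)
      fix \<nu> :: "real^'n \<Rightarrow> real"
      assume st: "0 \<le> a \<and> a \<le> b \<and> b \<le> 1" and \<nu> [measurable]: "\<nu> \<in> borel_measurable borel" and \<nu>0: "\<forall>x. 0 \<le> \<nu> x"
      show "\<exists>\<Psi> J. pl \<Psi> J \<and> KLnn \<nu> (push \<Psi> J (\<rho> a)) + ennreal \<delta> \<le> ennreal (exp (b - a)) * (KLnn \<nu> (\<rho> b) + ennreal \<delta>)"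
      proof (cases "a = b")
        case True
        have "push (\<lambda>x. x) (\<lambda>_. 1) (\<rho> b) = \<rho> b" by (simp add: push_def fun_eq_iff)
        then show ?thesis using True pl_id by (metis diff_self dual_order.refl ennreal_1 exp_zero mult_1)
      next
        case False
        then have "good_step \<delta> a b" using step[of a b] ab st by simp
        then obtain \<Psi> J where pl: "pl \<Psi> J" and le: "(\<integral>\<^sup>+y. ennreal (\<rho> b y * exp (ln (\<rho> b y / push \<Psi> J (\<rho> a) y) / (b - a))) \<partial>lborel) \<le> ennreal (1 + \<delta>)"
          unfolding good_step_def by (elim exE conjE)
        have "KLnn \<nu> (push \<Psi> J (\<rho> a)) + ennreal \<delta> \<le> ennreal (exp (b - a)) * (KLnn \<nu> (\<rho> b) + ennreal \<delta>)"
        proof (rule KLnn_step[OF \<nu> \<rho>_measurable push_measurable[OF pl \<rho>_measurable] _ \<rho>_pos push_pos[OF pl \<rho>_pos] nn_integral_\<rho> _ _ _ le])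
          show "(\<integral>\<^sup>+x. ennreal (push \<Psi> J (\<rho> a) x) \<partial>lborel) = 1"
            using nn_integral_push[OF pl \<rho>_measurable] \<rho>_pos nn_integral_\<rho> by (simp add: less_imp_le)
        qed (use \<nu>0 False st \<delta> in auto)
        with pl show ?thesis by blast
      qed
    qed
    with d show ?case by blast
  qed
  with \<nu> show ?thesis unfolding P_def by simp
qed

end

section \<open>Gaussian densities and scalings\<close>

text \<open>Gram-Schmidt for the inner product \<open>x \<bullet> Q y\<close>: a vector outside the
  span of the first \<open>k\<close> ones is orthogonalised against them and normalised.\<close>

lemma exists_Q_orthonormal_family:
  fixes Q :: "real^'n \<Rightarrow> real^'n"
  assumes lin: "linear Q" and sym: "\<And>x y. x \<bullet> Q y = y \<bullet> Q x" and pos: "\<And>x. x \<noteq> 0 \<Longrightarrow> 0 < x \<bullet> Q x"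
  shows "k \<le> CARD('n) \<Longrightarrow> \<exists>b :: nat \<Rightarrow> real^'n. \<forall>i<k. \<forall>j<k. b i \<bullet> Q (b j) = (if i = j then 1 else 0)"
proof (induction k)
  case (Suc k)
  then obtain b :: "nat \<Rightarrow> real^'n" where b: "\<And>i j. i < k \<Longrightarrow> j < k \<Longrightarrow> b i \<bullet> Q (b j) = (if i = j then 1 else 0)"
    by (meson Suc_leD)
  have "dim (b ` {..<k}) \<le> card (b ` {..<k})" by (rule dim_le_card') simp
  also have "\<dots> \<le> k" by (metis card_image_le card_lessThan finite_lessThan)
  also have "k < DIM(real^'n)" using Suc.prems by simp
  finally have "span (b ` {..<k}) \<noteq> UNIV" by (metis dim_UNIV dim_span less_irrefl)
  then obtain x where x: "x \<notin> span (b ` {..<k})" by blast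
  define y where "y = x - (\<Sum>i<k. (x \<bullet> Q (b i)) *\<^sub>R b i)"
  have "(\<Sum>i<k. (x \<bullet> Q (b i)) *\<^sub>R b i) \<in> span (b ` {..<k})"
    by (intro span_sum span_scale span_base) auto
  then have y0: "y \<noteq> 0" using x by (auto simp: y_def)
  have orth: "y \<bullet> Q (b j) = 0" if j: "j < k" for j
  proof -
    have "y \<bullet> Q (b j) = x \<bullet> Q (b j) - (\<Sum>i<k. (x \<bullet> Q (b i)) * (b i \<bullet> Q (b j)))"
      by (simp add: y_def inner_diff_left inner_sum_left)
    also have "(\<Sum>i<k. (x \<bullet> Q (b i)) * (b i \<bullet> Q (b j))) = (\<Sum>i<k. if i = j then x \<bullet> Q (b i) else 0)"
      using b j by (intro sum.cong) auto
    also have "\<dots> = x \<bullet> Q (b j)" using j by simp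
    finally show ?thesis by simp
  qed
  define r where "r = sqrt (y \<bullet> Q y)"
  have r: "r > 0" "r * r = y \<bullet> Q y" using pos[OF y0] by (auto simp: r_def)
  define b' where "b' i = (if i = k then (1 / r) *\<^sub>R y else b i)" for i
  have "b' i \<bullet> Q (b' j) = (if i = j then 1 else 0)" if "i < Suc k" "j < Suc k" for i j
  proof -
    have "y \<bullet> Q y / (r * r) = 1" using r pos[OF y0] by simp
    moreover have "b i \<bullet> Q y = 0" if "i < k" for i using orth[OF that] sym[of "b i" y] by simp
    ultimately show ?thesis
      using that b orth by (auto simp: b'_def less_Suc_eq linear_scale[OF lin])
  qed
  then show ?case by blast
qed simp

lemma exists_Q_orthonormal_matrix:
  fixes Q :: "real^'n \<Rightarrow> real^'n"
  assumes lin: "linear Q" and sym: "\<And>x y. x \<bullet> Q y = y \<bullet> Q x" and pos: "\<And>x. x \<noteq> 0 \<Longrightarrow> 0 < x \<bullet> Q x"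
  shows "\<exists>A :: real^'n^'n. \<forall>x y. (A *v x) \<bullet> Q (A *v y) = x \<bullet> y"
proof -
  obtain b :: "nat \<Rightarrow> real^'n" where b: "\<And>i j. i < CARD('n) \<Longrightarrow> j < CARD('n) \<Longrightarrow> b i \<bullet> Q (b j) = (if i = j then 1 else 0)"
    using exists_Q_orthonormal_family[OF assms, of "CARD('n)"] by blast
  obtain h :: "'n \<Rightarrow> nat" where h: "bij_betw h UNIV {..<CARD('n)}"
    by (metis bij_betw_iff_card card_lessThan finite finite_lessThan)
  have hb: "b (h i) \<bullet> Q (b (h j)) = (if i = j then 1 else 0)" for i j
  proof -
    have "h i < CARD('n)" "h j < CARD('n)" using bij_betw_apply[OF h] by auto
    moreover have "h i = h j \<longleftrightarrow> i = j" using bij_betw_imp_inj_on[OF h] by (simp add: inj_eq)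
    ultimately show ?thesis using b[of "h i" "h j"] by simp
  qed
  define A :: "real^'n^'n" where "A = (\<chi> i j. b (h j) $ i)"
  have A: "A *v x = (\<Sum>j\<in>UNIV. x $ j *\<^sub>R b (h j))" for x
    by (simp add: vec_eq_iff A_def matrix_vector_mult_def mult.commute)
  have "(A *v x) \<bullet> Q (A *v y) = x \<bullet> y" for x y
  proof -
    have "(A *v x) \<bullet> Q (A *v y) = (\<Sum>i\<in>UNIV. \<Sum>j\<in>UNIV. x $ i * (y $ j * (b (h i) \<bullet> Q (b (h j)))))"
      by (simp add: A linear_sum[OF lin] linear_scale[OF lin] inner_sum_left inner_sum_right sum_distrib_left)
        (subst sum.swap, simp add: mult.left_commute)
    also have "\<dots> = x \<bullet> y"
      unfolding hb by (simp add: inner_vec_def if_distrib cong: if_cong)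
    finally show ?thesis .
  qed
  then show ?thesis by blast
qed

locale gaussian_kernel =
  fixes Q :: "real^'n \<Rightarrow> real^'n" and K c :: real
  assumes linQ: "linear Q" and symQ: "\<And>x y. x \<bullet> Q y = y \<bullet> Q x"
    and c: "0 < c" and posQ: "\<And>x. c * (norm x)\<^sup>2 \<le> x \<bullet> Q x"
    and K: "0 < K" and total: "(\<integral>\<^sup>+x. ennreal (K * exp (- (x \<bullet> Q x) / 2)) \<partial>lborel) = 1"

text \<open>If the columns of \<open>A\<close> are orthonormal for the form of the inverse
  covariance, the substitution \<open>A *v x\<close> turns the integral into the standard Gaussian
  one and \<open>(det A)\<^sup>2 = det \<Sigma>\<close>, which confirms the normalising constant.
  \<open>c\<close> is the minimum of the form on the unit sphere.\<close>

lemma gaussian_density_kernel: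
  fixes \<Sigma> :: "real^'n^'n"
  assumes sym: "transpose \<Sigma> = \<Sigma>" and pd: "\<And>x. x \<noteq> 0 \<Longrightarrow> 0 < x \<bullet> (\<Sigma> *v x)"
  shows "\<exists>K c. gaussian_kernel ((*v) (matrix_inv \<Sigma>)) K c \<and>
    (\<forall>m x. gaussian_density m \<Sigma> x = K * exp (- ((x - m) \<bullet> (matrix_inv \<Sigma> *v (x - m))) / 2))"
proof -
  have "\<forall>x. \<Sigma> *v x = 0 \<longrightarrow> x = 0" using pd by (metis inner_zero_right less_irrefl)
  then have "invertible \<Sigma>" by (metis invertible_left_inverse matrix_left_invertible_ker)
  then have inv: "matrix_inv \<Sigma> ** \<Sigma> = mat 1" "\<Sigma> ** matrix_inv \<Sigma> = mat 1"
    using someI_ex[of "\<lambda>A'. \<Sigma> ** A' = mat 1 \<and> A' ** \<Sigma> = mat 1"] unfolding matrix_inv_def invertible_def by auto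
  define Q where "Q = (*v) (matrix_inv \<Sigma>)"
  have Q\<Sigma>: "Q (\<Sigma> *v x) = x" "\<Sigma> *v Q x = x" for x
    by (simp_all add: Q_def matrix_vector_mul_assoc inv)
  have lin: "linear Q" by (simp add: Q_def)
  have sym\<Sigma>: "(\<Sigma> *v a) \<bullet> b = a \<bullet> (\<Sigma> *v b)" for a b
    by (metis dot_lmul_matrix sym transpose_matrix_vector)
  have symQ: "x \<bullet> Q y = y \<bullet> Q x" for x y
    using sym\<Sigma>[of "Q x" "Q y"] by (simp add: Q\<Sigma> inner_commute)
  have pos: "0 < x \<bullet> Q x" if "x \<noteq> 0" for x
  proof -
    have "Q x \<noteq> 0" using that Q\<Sigma>(2)[of x] by auto
    from pd[OF this] show ?thesis by (simp add: Q\<Sigma> inner_commute)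
  qed
  obtain A :: "real^'n^'n" where A: "\<And>x y. (A *v x) \<bullet> Q (A *v y) = x \<bullet> y"
    using exists_Q_orthonormal_matrix[OF lin symQ pos] by blast
  have "transpose A ** (matrix_inv \<Sigma> ** A) = mat 1"
  proof (subst matrix_eq, intro allI)
    fix y
    have "x \<bullet> ((transpose A ** (matrix_inv \<Sigma> ** A)) *v y) = x \<bullet> (mat 1 *v y)" for x
    proof -
      have "x \<bullet> (transpose A *v u) = (A *v x) \<bullet> u" for u
        by (metis dot_lmul_matrix inner_commute transpose_matrix_vector)
      then show ?thesis using A[of x y]
        by (simp only: matrix_vector_mul_assoc[symmetric] Q_def matrix_vector_mul_lid)
    qed
    then show "(transpose A ** (matrix_inv \<Sigma> ** A)) *v y = mat 1 *v y"
      by (metis inner_commute vector_eq_rdot)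
  qed
  then have "det A * (det (matrix_inv \<Sigma>) * det A) = 1" by (metis det_I det_mul det_transpose)
  moreover have "det (matrix_inv \<Sigma>) * det \<Sigma> = 1" using inv(1) by (metis det_I det_mul)
  ultimately have detA: "(det A)\<^sup>2 = det \<Sigma>" "det A \<noteq> 0"
  proof -
    assume *: "det A * (det (matrix_inv \<Sigma>) * det A) = 1" "det (matrix_inv \<Sigma>) * det \<Sigma> = 1"
    then have "(det A)\<^sup>2 * det (matrix_inv \<Sigma>) = 1" by (simp add: power2_eq_square mult.commute mult.left_commute)
    with *(2) show "(det A)\<^sup>2 = det \<Sigma>" by (metis mult.assoc mult.commute mult_1)
    show "det A \<noteq> 0" using *(1) by auto
  qed
  have [measurable]: "Q \<in> borel_measurable borel" by (rule linear_measurable_borel[OF lin])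
  have "(\<integral>\<^sup>+x. ennreal (exp (- (x \<bullet> Q x) / 2)) \<partial>lborel)
      = (\<integral>\<^sup>+x. ennreal (exp (- ((A *v x) \<bullet> Q (A *v x)) / 2)) * ennreal \<bar>det A\<bar> \<partial>lborel)"
    using nn_integral_lborel_linear[of "(*v) A" "\<lambda>x. ennreal (exp (- (x \<bullet> Q x) / 2))"] detA by simp
  also have "\<dots> = (\<integral>\<^sup>+x. ennreal (exp (- (1 / 2) * (norm x)\<^sup>2)) \<partial>(lborel :: (real^'n) measure)) * ennreal \<bar>det A\<bar>"
    unfolding A by (subst nn_integral_multc) (simp_all add: power2_norm_eq_inner)
  also have "\<dots> = ennreal (sqrt (pi / (1 / 2)) ^ CARD('n) * \<bar>det A\<bar>)"
    by (subst nn_integral_exp_neg_norm_square) (simp_all add: ennreal_mult')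
  also have "sqrt (pi / (1 / 2)) ^ CARD('n) * \<bar>det A\<bar> = sqrt ((2 * pi) ^ CARD('n) * det \<Sigma>)"
  proof -
    have "pi / (1 / 2) = 2 * pi" "sqrt (det \<Sigma>) = \<bar>det A\<bar>" by (simp_all add: detA(1)[symmetric])
    then show ?thesis by (simp only: real_sqrt_mult[of "(2 * pi) ^ CARD('n)" "det \<Sigma>"] real_sqrt_power)
  qed
  finally have int: "(\<integral>\<^sup>+x. ennreal (exp (- (x \<bullet> Q x) / 2)) \<partial>lborel) = ennreal (sqrt ((2 * pi) ^ CARD('n) * det \<Sigma>))" .
  define K where "K = 1 / sqrt ((2 * pi) ^ CARD('n) * det \<Sigma>)"
  have d\<Sigma>: "det \<Sigma> > 0" using detA by (metis zero_less_power2)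
  have sq: "sqrt ((2 * pi) ^ CARD('n) * det \<Sigma>) > 0" using d\<Sigma> by simp
  have K: "K > 0" using sq by (simp add: K_def)
  have tot: "(\<integral>\<^sup>+x. ennreal (K * exp (- (x \<bullet> Q x) / 2)) \<partial>lborel) = 1"
  proof -
    have "(\<integral>\<^sup>+x. ennreal (K * exp (- (x \<bullet> Q x) / 2)) \<partial>lborel) = ennreal K * (\<integral>\<^sup>+x. ennreal (exp (- (x \<bullet> Q x) / 2)) \<partial>lborel)"
      using K by (subst nn_integral_cmult[symmetric]) (auto simp: ennreal_mult')
    also have "\<dots> = ennreal (K * sqrt ((2 * pi) ^ CARD('n) * det \<Sigma>))"
      unfolding int using K by (simp add: ennreal_mult')
    finally show ?thesis using sq d\<Sigma> by (simp add: K_def)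
  qed
  have "\<exists>c>0. \<forall>x. c * (norm x)\<^sup>2 \<le> x \<bullet> Q x"
  proof -
    have cont: "continuous_on (sphere 0 1) (\<lambda>x. x \<bullet> Q x)"
      using lin by (intro continuous_intros linear_continuous_on) (simp add: linear_conv_bounded_linear)
    have "sphere 0 1 \<noteq> ({} :: (real^'n) set)" by simp
    then obtain y where y: "y \<in> sphere 0 1" "\<And>x. x \<in> sphere 0 1 \<Longrightarrow> y \<bullet> Q y \<le> x \<bullet> Q x"
      using continuous_attains_inf[OF compact_sphere _ cont] by blast
    have "(y \<bullet> Q y) * (norm x)\<^sup>2 \<le> x \<bullet> Q x" for x
    proof (cases "x = 0")
      case False
      define u where "u = (1 / norm x) *\<^sub>R x"
      have u: "u \<in> sphere 0 1" "x = norm x *\<^sub>R u" using False by (simp_all add: u_def)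
      have "x \<bullet> Q x = (norm x *\<^sub>R u) \<bullet> Q (norm x *\<^sub>R u)" using u(2) by simp
      also have "\<dots> = (norm x)\<^sup>2 * (u \<bullet> Q u)" by (simp add: linear_scale[OF lin] power2_eq_square)
      finally show ?thesis using mult_right_mono[OF y(2)[OF u(1)], of "(norm x)\<^sup>2"] by (simp add: mult.commute)
    qed simp
    moreover have "y \<bullet> Q y > 0" using y(1) by (intro pos) auto
    ultimately show ?thesis by blast
  qed
  then obtain c where c: "c > 0" "\<And>x. c * (norm x)\<^sup>2 \<le> x \<bullet> Q x" by blast
  have "gaussian_kernel Q K c"
    by (rule gaussian_kernel.intro[OF lin symQ c K tot])
  moreover have "gaussian_density m \<Sigma> x = K * exp (- ((x - m) \<bullet> (matrix_inv \<Sigma> *v (x - m))) / 2)" for m x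
    by (simp add: gaussian_density_def K_def)
  ultimately show ?thesis unfolding Q_def by blast
qed

lemma AE_lborel_component_neq_0: "AE x in lborel. (x :: real^'n) $ k \<noteq> 0"
proof (rule AE_I')
  have "closed {x :: real^'n. x $ k = 0}" by (intro closed_Collect_eq continuous_intros)
  moreover have "negligible {x :: real^'n. x $ k = 0}" by (rule negligible_standard_hyperplane_cart)
  ultimately show "{x :: real^'n. x $ k = 0} \<in> null_sets lborel"
    by (simp add: negligible_iff_null_sets null_sets_completion_iff)
qed auto

text \<open>The two half spaces \<open>x $ k > 0\<close> and \<open>x $ k < 0\<close> are stretched separately, so the Jacobian is
  wrong on the null set \<open>x $ k = 0\<close>.\<close>

lemma pl_scale:
  fixes r :: real
  assumes r: "r > 0"
  shows "\<exists>J. pl (\<lambda>x::real^'n. r *\<^sub>R x) J \<and> (AE x in lborel. J x = r ^ CARD('n))"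
proof -
  have "\<exists>J. pl (\<lambda>x::real^'n. \<chi> k. if k \<in> S then r * x $ k else x $ k) J \<and>
      (\<forall>x. (\<forall>k\<in>S. x $ k \<noteq> 0) \<longrightarrow> J x = r ^ card S)" for S :: "'n set"
  proof (induction S rule: finite_induct[OF finite])
    case 1
    then show ?case using pl_id by (auto intro!: exI[of _ "\<lambda>_. 1"])
  next
    case (2 k S)
    then obtain J where J: "pl (\<lambda>x::real^'n. \<chi> k. if k \<in> S then r * x $ k else x $ k) J"
      "\<And>x. (\<forall>k\<in>S. x $ k \<noteq> 0) \<Longrightarrow> J x = r ^ card S" by blast
    \<comment> \<open>Strength \<open>r - 1\<close> turns the factor on one half space into
      \<open>r\<close>; reversing both \<open>a\<close> and \<open>w\<close> does the same on the
      opposite half space.\<close>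
    define w :: "real^'n" where "w = (r - 1) *\<^sub>R axis k 1"
    have aw: "1 + axis k 1 \<bullet> w > 0" "1 + (- axis k 1) \<bullet> (- w) > 0" using r by (simp_all add: w_def inner_axis_axis)
    define e1 where "e1 = el w (axis k 1) 0"
    define e2 where "e2 = el (- w) (- axis k 1) 0"
    have e1: "e1 x = (\<chi> i. if i = k then (if x $ k > 0 then r * x $ k else x $ k) else x $ i)" for x
      by (simp add: e1_def el_def w_def vec_eq_iff inner_axis') (auto simp: axis_def algebra_simps)
    have e2: "e2 x = (\<chi> i. if i = k then (if x $ k < 0 then r * x $ k else x $ k) else x $ i)" for x
      by (simp add: e2_def el_def w_def vec_eq_iff inner_axis') (auto simp: axis_def algebra_simps)
    have e21: "e2 (e1 x) = (\<chi> i. if i = k then r * x $ k else x $ i)" for x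
      using r by (auto simp: e1 e2 vec_eq_iff mult_less_0_iff)
    define j where "j x = el_jac (- w) (- axis k 1) 0 (e1 x) * el_jac w (axis k 1) 0 x" for x
    have pl12: "pl (\<lambda>x. e2 (e1 x)) j"
      using pl_comp[OF pl_el[OF aw(1), of 0] pl_el[OF aw(2), of 0]] by (simp add: e1_def e2_def j_def[abs_def])
    have j: "j x = r" if "x $ k \<noteq> 0" for x
      using that r by (auto simp: j_def el_jac_def inner_axis' e1 w_def mult_less_0_iff not_less)
    have "pl (\<lambda>x::real^'n. \<chi> i. if i \<in> S then r * (e2 (e1 x)) $ i else (e2 (e1 x)) $ i) (\<lambda>x. J (e2 (e1 x)) * j x)"
      by (rule pl_comp[OF pl12 J(1)])
    moreover have "(\<chi> i. if i \<in> S then r * (e2 (e1 x)) $ i else (e2 (e1 x)) $ i) = (\<chi> i. if i \<in> insert k S then r * x $ i else x $ i)" for x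
      using 2(2) by (auto simp: e21 vec_eq_iff)
    moreover have "J (e2 (e1 x)) * j x = r ^ card (insert k S)" if "\<forall>i\<in>insert k S. x $ i \<noteq> 0" for x
    proof -
      have "\<forall>i\<in>S. e2 (e1 x) $ i \<noteq> 0" using that 2(2) r by (auto simp: e21)
      with that J(2) j 2(1,2) show ?thesis by (simp add: mult.commute)
    qed
    ultimately show ?case by auto
  qed
  from this[of UNIV] obtain J where J: "pl (\<lambda>x::real^'n. \<chi> k. if k \<in> UNIV then r * x $ k else x $ k) J"
    "\<And>x. (\<forall>k\<in>UNIV. x $ k \<noteq> 0) \<Longrightarrow> J x = r ^ CARD('n)" by blast
  have "(\<lambda>x::real^'n. \<chi> k. if k \<in> UNIV then r * x $ k else x $ k) = (\<lambda>x. r *\<^sub>R x)"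
    by (simp add: fun_eq_iff vec_eq_iff)
  moreover have "AE x in lborel. \<forall>k\<in>UNIV. (x :: real^'n) $ k \<noteq> 0"
    by (rule AE_finite_allI) (auto intro: AE_lborel_component_neq_0)
  then have "AE x in lborel. J x = r ^ CARD('n)" by eventually_elim (rule J(2))
  ultimately show ?thesis using J(1) by auto
qed

section \<open>Approximation of the target by mixtures\<close>

lemma nn_integral_lborel_affine:
  fixes x :: "'a::euclidean_space"
  assumes r: "r \<noteq> 0" and [measurable]: "h \<in> borel_measurable borel"
  shows "(\<integral>\<^sup>+w. h (x + r *\<^sub>R w) * ennreal (\<bar>r\<bar> ^ DIM('a)) \<partial>lborel) = (\<integral>\<^sup>+y. h y \<partial>lborel)"
proof -
  have "(\<integral>\<^sup>+y. h y \<partial>lborel) = (\<integral>\<^sup>+y. h y \<partial>density (distr lborel borel (\<lambda>w. x + r *\<^sub>R w)) (\<lambda>_. ennreal (\<bar>r\<bar> ^ DIM('a))))"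
    using lborel_affine[OF r, of x] by simp
  also have "\<dots> = (\<integral>\<^sup>+w. ennreal (\<bar>r\<bar> ^ DIM('a)) * h (x + r *\<^sub>R w) \<partial>lborel)"
    by (subst nn_integral_density) (simp_all add: nn_integral_distr)
  finally show ?thesis by (simp add: mult.commute)
qed

text \<open>A form of the Vitali--Caratheodory theorem: \<open>f\<close> is the measure of the vertical slices of an
  open neighbourhood of the subgraph of \<open>\<nu>\<close>, hence lower semicontinuous.\<close>

lemma lower_semicontinuous_majorant:
  fixes \<nu> :: "'a::euclidean_space \<Rightarrow> real"
  assumes [measurable]: "\<nu> \<in> borel_measurable borel" and int: "(\<integral>\<^sup>+x. ennreal (\<nu> x) \<partial>lborel) = 1" and \<delta>: "0 < \<delta>"
  shows "\<exists>f :: 'a \<Rightarrow> ennreal. f \<in> borel_measurable borel \<and> (\<forall>x. ennreal (\<nu> x) \<le> f x) \<and>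
    (\<integral>\<^sup>+x. f x \<partial>lborel) \<le> ennreal (1 + \<delta>) \<and> (\<forall>x s. s \<longlonglongrightarrow> x \<longrightarrow> f x \<le> liminf (\<lambda>n. f (s n)))"
proof -
  define G where "G = {p :: 'a \<times> real. 0 < snd p \<and> snd p < \<nu> (fst p)}"
  have "G = {p \<in> space (borel \<Otimes>\<^sub>M borel). 0 < snd p \<and> snd p < \<nu> (fst p)}"
    by (simp add: G_def space_pair_measure)
  also have "\<dots> \<in> sets (borel \<Otimes>\<^sub>M borel)" by measurable
  finally have Gm: "G \<in> sets borel" unfolding borel_prod .
  have slice: "emeasure lborel (Pair x -` G) = ennreal (\<nu> x)" for x
  proof -
    have "Pair x -` G = {0<..<\<nu> x}" by (auto simp: G_def)
    then show ?thesis by (cases "0 \<le> \<nu> x") (auto simp: ennreal_neg)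
  qed
  have emG: "emeasure lborel G = 1"
  proof -
    have "emeasure lborel G = emeasure (lborel \<Otimes>\<^sub>M lborel) G" by (simp add: lborel_prod)
    also have "\<dots> = (\<integral>\<^sup>+x. emeasure lborel (Pair x -` G) \<partial>lborel)"
      by (rule lborel.emeasure_pair_measure_alt) (unfold lborel_prod, simp add: Gm)
    finally show ?thesis using int by (simp add: slice)
  qed
  obtain U where U: "open U" "G \<subseteq> U" "emeasure lborel (U - G) < ennreal \<delta>"
    using outer_regular_lborel[OF Gm \<delta>] by blast
  have Um [measurable]: "U \<in> sets borel" using U(1) by simp
  define f where "f x = (\<integral>\<^sup>+r. indicator U (x, r) \<partial>(lborel :: real measure))" for x
  have fm: "f \<in> borel_measurable borel"
  proof -
    have "(\<lambda>(x, r). indicator U (x, r) :: ennreal) \<in> borel_measurable (borel \<Otimes>\<^sub>M lborel)"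
      using Um by (simp add: borel_prod[symmetric] case_prod_unfold) measurable
    from lborel.borel_measurable_nn_integral_fst[OF this] show ?thesis by (simp add: f_def[abs_def])
  qed
  have fe: "f x = emeasure lborel (Pair x -` U)" for x
  proof -
    have "Pair x -` U \<in> sets borel" using U(1) by (intro borel_open open_vimage continuous_intros)
    moreover have "indicator U (x, r) = (indicator (Pair x -` U) r :: ennreal)" for r by (simp add: indicator_def)
    ultimately show ?thesis by (simp add: f_def)
  qed
  have ge: "ennreal (\<nu> x) \<le> f x" for x
    unfolding slice[symmetric] fe
    by (rule emeasure_mono) (use U in \<open>auto intro!: borel_open open_vimage continuous_intros\<close>)
  have "(\<integral>\<^sup>+x. f x \<partial>lborel) = emeasure (lborel \<Otimes>\<^sub>M lborel) U"
    unfolding fe by (rule lborel.emeasure_pair_measure_alt[symmetric]) (unfold lborel_prod, simp add: Um)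
  also have "\<dots> = emeasure lborel (G \<union> (U - G))" using U(2) by (simp add: lborel_prod Un_absorb1)
  also have "\<dots> \<le> emeasure lborel G + emeasure lborel (U - G)"
    by (rule emeasure_subadditive) (use Gm Um in auto)
  also have "\<dots> \<le> 1 + ennreal \<delta>" unfolding emG using U(3) by (intro add_left_mono less_imp_le)
  also have "\<dots> = ennreal (1 + \<delta>)" using \<delta> by (simp add: ennreal_plus)
  finally have le: "(\<integral>\<^sup>+x. f x \<partial>lborel) \<le> ennreal (1 + \<delta>)" .
  have lsc: "f x \<le> liminf (\<lambda>n. f (s n))" if s: "s \<longlonglongrightarrow> x" for x s
  proof -
    \<comment> \<open>A point \<open>(x, r)\<close> of the open set \<open>U\<close> has
      \<open>(s n, r)\<close> in \<open>U\<close> eventually, so indicators of slices satisfy the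
      inequality pointwise, and Fatou's lemma passes it on to their measures.\<close>
    have "f x \<le> (\<integral>\<^sup>+r. liminf (\<lambda>n. indicator U (s n, r)) \<partial>(lborel :: real measure))"
      unfolding f_def
    proof (rule nn_integral_mono)
      fix r :: real
      show "indicator U (x, r) \<le> liminf (\<lambda>n. indicator U (s n, r) :: ennreal)"
      proof (cases "(x, r) \<in> U")
        case True
        have "(\<lambda>n. (s n, r)) \<longlonglongrightarrow> (x, r)" by (intro tendsto_intros s)
        then have "eventually (\<lambda>n. (s n, r) \<in> U) sequentially" using U(1) True by (rule topological_tendstoD)
        then have "eventually (\<lambda>n. 1 \<le> (indicator U (s n, r) :: ennreal)) sequentially" by eventually_elim simp
        then have "1 \<le> liminf (\<lambda>n. indicator U (s n, r) :: ennreal)" by (rule Liminf_bounded)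
        then show ?thesis using True by simp
      qed simp
    qed
    also have "\<dots> \<le> liminf (\<lambda>n. \<integral>\<^sup>+r. indicator U (s n, r) \<partial>(lborel :: real measure))"
    proof (rule nn_integral_liminf)
      fix n
      have "Pair (s n) -` U \<in> sets borel" using U(1) by (intro borel_open open_vimage continuous_intros)
      moreover have "(\<lambda>r. indicator U (s n, r) :: ennreal) = indicator (Pair (s n) -` U)" by (simp add: indicator_def fun_eq_iff)
      ultimately show "(\<lambda>r. indicator U (s n, r) :: ennreal) \<in> borel_measurable lborel" by simp
    qed
    finally show ?thesis by (simp add: f_def)
  qed
  from fm ge le lsc show ?thesis by blast
qed

text \<open>\<open>KLnn \<nu> \<rho>\<close> and the integral of the nonnegative function \<open>\<nu> (A + B |x|\<^sup>2 + ln \<rho>)\<close> add up to a constant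
  independent of \<open>\<rho>\<close>, so Fatou's lemma for the latter bounds the former from above.\<close>

locale KL_target =
  fixes \<nu> :: "real^'n \<Rightarrow> real"
  assumes \<nu>m [measurable]: "\<nu> \<in> borel_measurable borel" and \<nu>0: "\<And>x. 0 \<le> \<nu> x"
    and \<nu>1: "(\<integral>\<^sup>+x. ennreal (\<nu> x) \<partial>lborel) = 1"
    and ent: "integrable lborel (\<lambda>x. \<nu> x * ln (\<nu> x))"
    and mom: "integrable lborel (\<lambda>x. \<nu> x * (norm x)\<^sup>2)"
begin

definition gain :: "real \<Rightarrow> real \<Rightarrow> (real^'n \<Rightarrow> real) \<Rightarrow> real^'n \<Rightarrow> real" where
  "gain A B \<rho> x = \<nu> x * (A + B * (norm x)\<^sup>2 + ln (\<rho> x))"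

definition total_gain :: "real \<Rightarrow> real \<Rightarrow> real" where
  "total_gain A B = (\<integral>x. gain A B \<nu> x \<partial>lborel)"

lemma integrable_\<nu>: "integrable lborel \<nu>" "(\<integral>x. \<nu> x \<partial>lborel) = 1"
proof -
  show i: "integrable lborel \<nu>"
    using \<nu>0 \<nu>1 by (intro integrableI_nonneg) auto
  have "ennreal (\<integral>x. \<nu> x \<partial>lborel) = 1"
    using nn_integral_eq_integral[OF i] \<nu>0 \<nu>1 by simp
  then show "(\<integral>x. \<nu> x \<partial>lborel) = 1"
    by (metis ennreal_eq_1 ennreal_1)
qed

lemma integrable_gain: "integrable lborel (gain A B \<nu>)"
proof -
  have "integrable lborel (\<lambda>x. A * \<nu> x + B * (\<nu> x * (norm x)\<^sup>2) + \<nu> x * ln (\<nu> x))"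
    using integrable_\<nu>(1) ent mom by simp
  then show ?thesis by (simp add: gain_def[abs_def] algebra_simps)
qed

lemma gain_measurable [measurable]: "\<rho> \<in> borel_measurable borel \<Longrightarrow> gain A B \<rho> \<in> borel_measurable borel"
  unfolding gain_def[abs_def] by measurable

lemma gain_nonneg:
  assumes "exp (- (A + B * (norm x)\<^sup>2)) \<le> \<rho> x" shows "0 \<le> gain A B \<rho> x"
proof -
  have "- (A + B * (norm x)\<^sup>2) \<le> ln (\<rho> x)"
    using assms by (metis exp_gt_zero ln_exp ln_le_cancel_iff order_less_le_trans)
  then show ?thesis using \<nu>0 by (simp add: gain_def)
qed

lemma KLnn_add_gain:
  assumes [measurable]: "\<rho> \<in> borel_measurable borel" and \<rho>1: "(\<integral>\<^sup>+x. ennreal (\<rho> x) \<partial>lborel) = 1"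
    and low: "\<And>x. exp (- (A + B * (norm x)\<^sup>2)) \<le> \<rho> x"
  shows "KLnn \<nu> \<rho> + (\<integral>\<^sup>+x. ennreal (gain A B \<rho> x) \<partial>lborel) = ennreal (total_gain A B)" "0 \<le> total_gain A B"
proof -
  have pos: "\<rho> x > 0" for x using low[of x] exp_gt_zero by (rule order_less_le_trans[rotated])
  have i\<rho>: "integrable lborel \<rho>" using \<rho>1 pos by (intro integrableI_nonneg) (auto simp: less_imp_le)
  have "ennreal (\<integral>x. \<rho> x \<partial>lborel) = 1"
    using nn_integral_eq_integral[OF i\<rho>] pos \<rho>1 by (simp add: less_imp_le)
  then have I1: "(\<integral>x. \<rho> x \<partial>lborel) = 1" by (metis ennreal_eq_1 ennreal_1)
  have eq: "rel_ent (\<nu> x) (\<rho> x) + gain A B \<rho> x = gain A B \<nu> x - \<nu> x + \<rho> x" for x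
    using \<nu>0[of x] pos[of x] by (cases "\<nu> x = 0") (auto simp: rel_ent_def gain_def ln_div algebra_simps)
  have nn: "0 \<le> rel_ent (\<nu> x) (\<rho> x)" "0 \<le> gain A B \<rho> x" for x
    by (auto intro: rel_ent_nonneg \<nu>0 pos gain_nonneg low)
  have i: "integrable lborel (\<lambda>x. gain A B \<nu> x - \<nu> x + \<rho> x)"
    using integrable_gain integrable_\<nu>(1) i\<rho> by simp
  have val: "(\<integral>x. gain A B \<nu> x - \<nu> x + \<rho> x \<partial>lborel) = total_gain A B"
    using integrable_gain integrable_\<nu> i\<rho> I1 by (simp add: total_gain_def)
  have "KLnn \<nu> \<rho> + (\<integral>\<^sup>+x. ennreal (gain A B \<rho> x) \<partial>lborel)
      = (\<integral>\<^sup>+x. ennreal (rel_ent (\<nu> x) (\<rho> x)) + ennreal (gain A B \<rho> x) \<partial>lborel)"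
    unfolding KLnn_def by (rule nn_integral_add[symmetric]) auto
  also have "\<dots> = (\<integral>\<^sup>+x. ennreal (gain A B \<nu> x - \<nu> x + \<rho> x) \<partial>lborel)"
    by (intro nn_integral_cong) (simp add: ennreal_plus[symmetric] nn eq del: ennreal_plus)
  also have "\<dots> = ennreal (total_gain A B)"
    using nn_integral_eq_integral[OF i] nn add_nonneg_nonneg by (simp add: val[symmetric] eq[symmetric])
  finally show "KLnn \<nu> \<rho> + (\<integral>\<^sup>+x. ennreal (gain A B \<rho> x) \<partial>lborel) = ennreal (total_gain A B)" .
  show "0 \<le> total_gain A B"
    unfolding val[symmetric] using nn by (intro integral_nonneg_AE AE_I2) (simp add: eq[symmetric])
qed

text \<open>Convergence is assumed from below only, towards a positive function \<open>g\<close>. As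
  \<open>ln\<close> is monotone, this bounds the gains from below in the limit, and a gain within
  \<open>\<epsilon>\<close> of the constant \<open>total_gain A B\<close> leaves less than
  \<open>\<epsilon>\<close> for the entropy.\<close>

lemma KLnn_Fatou:
  assumes \<rho>m: "\<And>n. \<rho> n \<in> borel_measurable borel" and \<rho>1: "\<And>n. (\<integral>\<^sup>+x. ennreal (\<rho> n x) \<partial>lborel) = 1"
    and low: "\<And>n x. exp (- (A + B * (norm x)\<^sup>2)) \<le> \<rho> n x"
    and gm: "g \<in> borel_measurable borel" and gpos: "\<And>x. 0 < g x"
    and lim: "\<And>x a. a < g x \<Longrightarrow> eventually (\<lambda>n. a < \<rho> n x) sequentially"
    and less: "ennreal (total_gain A B) < (\<integral>\<^sup>+x. ennreal (gain A B g x) \<partial>lborel) + ennreal \<epsilon>"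
  shows "\<exists>n. KLnn \<nu> (\<rho> n) < ennreal \<epsilon>"
proof -
  note [measurable] = \<rho>m gm
  have pos: "\<rho> n x > 0" for n x using low[of x n] exp_gt_zero by (rule order_less_le_trans[rotated])
  have "(\<integral>\<^sup>+x. ennreal (gain A B g x) \<partial>lborel) \<le> (\<integral>\<^sup>+x. liminf (\<lambda>n. ennreal (gain A B (\<rho> n) x)) \<partial>lborel)"
  proof (rule nn_integral_mono)
    fix x
    show "ennreal (gain A B g x) \<le> liminf (\<lambda>n. ennreal (gain A B (\<rho> n) x))"
    proof (cases "\<nu> x = 0")
      case True then show ?thesis by (simp add: gain_def)
    next
      case False
      then have n: "\<nu> x > 0" using \<nu>0[of x] by simp
      show ?thesis
      proof (rule le_Liminf_iff[THEN iffD2], intro allI impI)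
        fix y assume "y < ennreal (gain A B g x)"
        then obtain b where b: "y = ennreal b" "0 \<le> b" "b < gain A B g x"
          by (cases y) (auto simp: ennreal_less_iff top_unique)
        \<comment> \<open>The value of the density at \<open>x\<close> for which the gain equals
          \<open>b\<close>.\<close>
        define a where "a = exp (b / \<nu> x - A - B * (norm x)\<^sup>2)"
        have "b / \<nu> x < A + B * (norm x)\<^sup>2 + ln (g x)"
          using b(3) n by (simp add: gain_def pos_divide_less_eq mult.commute)
        then have "a < g x" unfolding a_def using gpos[of x]
          by (metis add.commute diff_less_eq exp_less_cancel_iff exp_ln diff_diff_add)
        from lim[OF this] show "eventually (\<lambda>n. y < ennreal (gain A B (\<rho> n) x)) sequentially"
        proof eventually_elim
          fix m assume "a < \<rho> m x"
          then have "b / \<nu> x - A - B * (norm x)\<^sup>2 < ln (\<rho> m x)"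
            using pos[of m x] unfolding a_def by (metis exp_gt_zero ln_exp ln_less_cancel_iff)
          then have "b / \<nu> x < A + B * (norm x)\<^sup>2 + ln (\<rho> m x)" by linarith
          then have "b < gain A B (\<rho> m) x"
            using n by (simp add: gain_def pos_divide_less_eq mult.commute)
          then show "y < ennreal (gain A B (\<rho> m) x)" using b by (simp add: ennreal_lessI)
        qed
      qed
    qed
  qed
  also have "\<dots> \<le> liminf (\<lambda>n. \<integral>\<^sup>+x. ennreal (gain A B (\<rho> n) x) \<partial>lborel)"
    by (rule nn_integral_liminf) measurable
  finally have "ennreal (total_gain A B) < liminf (\<lambda>n. \<integral>\<^sup>+x. ennreal (gain A B (\<rho> n) x) \<partial>lborel) + ennreal \<epsilon>"
    using less by (meson add_right_mono order_less_le_trans)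
  moreover have "\<exists>n. ennreal (total_gain A B) < (\<integral>\<^sup>+x. ennreal (gain A B (\<rho> n) x) \<partial>lborel) + ennreal \<epsilon>"
  proof (rule ccontr)
    assume "\<not> ?thesis"
    then have le: "(\<integral>\<^sup>+x. ennreal (gain A B (\<rho> n) x) \<partial>lborel) + ennreal \<epsilon> \<le> ennreal (total_gain A B)" for n
      by (simp add: not_less)
    have "(\<integral>\<^sup>+x. ennreal (gain A B (\<rho> n) x) \<partial>lborel) \<le> ennreal (total_gain A B) - ennreal \<epsilon>" for n
      using ennreal_minus_mono[OF le[of n] order_refl[of "ennreal \<epsilon>"]] by (simp add: ennreal_add_diff_cancel_right)
    then have "liminf (\<lambda>n. \<integral>\<^sup>+x. ennreal (gain A B (\<rho> n) x) \<partial>lborel) \<le> liminf (\<lambda>n::nat. ennreal (total_gain A B) - ennreal \<epsilon>)"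
      by (intro Liminf_mono always_eventually allI)
    then have "liminf (\<lambda>n. \<integral>\<^sup>+x. ennreal (gain A B (\<rho> n) x) \<partial>lborel) \<le> ennreal (total_gain A B) - ennreal \<epsilon>"
      by (simp add: Liminf_const)
    then have "liminf (\<lambda>n. \<integral>\<^sup>+x. ennreal (gain A B (\<rho> n) x) \<partial>lborel) + ennreal \<epsilon> \<le> (ennreal (total_gain A B) - ennreal \<epsilon>) + ennreal \<epsilon>"
      by (rule add_right_mono)
    also have "\<dots> = ennreal (total_gain A B)"
      by (intro diff_add_cancel_ennreal order_trans[OF _ le[of 0]]) simp
    finally show False using \<open>ennreal (total_gain A B) < liminf _ + _\<close> by simp
  qed
  then obtain n where n: "ennreal (total_gain A B) < (\<integral>\<^sup>+x. ennreal (gain A B (\<rho> n) x) \<partial>lborel) + ennreal \<epsilon>" by blast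
  have "KLnn \<nu> (\<rho> n) + (\<integral>\<^sup>+x. ennreal (gain A B (\<rho> n) x) \<partial>lborel) = ennreal (total_gain A B)"
    by (rule KLnn_add_gain[OF \<rho>m \<rho>1 low])
  with n have "(\<integral>\<^sup>+x. ennreal (gain A B (\<rho> n) x) \<partial>lborel) + KLnn \<nu> (\<rho> n) < (\<integral>\<^sup>+x. ennreal (gain A B (\<rho> n) x) \<partial>lborel) + ennreal \<epsilon>"
    by (simp add: add.commute)
  then show ?thesis by (metis add_left_mono not_le)
qed

end

section \<open>Gaussian kernels and smoothing of measures\<close>

context gaussian_kernel
begin

lemma Q_simps: "Q (x + y) = Q x + Q y" "Q (x - y) = Q x - Q y" "Q (r *\<^sub>R x) = r *\<^sub>R Q x" "Q 0 = 0"
  using linQ by (simp_all add: linear_add linear_diff linear_scale linear_0)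

lemma Q_measurable [measurable]: "Q \<in> borel_measurable borel"
  by (rule linear_measurable_borel[OF linQ])

lemma Q_nonneg: "0 \<le> x \<bullet> Q x"
  using posQ[of x] c by (meson mult_nonneg_nonneg less_imp_le order_trans zero_le_power2)

lemma Q_upper: "\<exists>C>0. \<forall>x. x \<bullet> Q x \<le> C * (norm x)\<^sup>2"
proof -
  obtain L where L: "L > 0" "\<forall>x. norm (Q x) \<le> norm x * L" using linear_bounded_pos[OF linQ] by (auto simp: mult.commute)
  have "x \<bullet> Q x \<le> L * (norm x)\<^sup>2" for x
  proof -
    have "x \<bullet> Q x \<le> norm x * norm (Q x)" by (rule norm_cauchy_schwarz)
    also have "\<dots> \<le> norm x * (norm x * L)" using L(2) by (intro mult_left_mono) auto
    finally show ?thesis by (simp add: power2_eq_square mult.commute mult.left_commute)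
  qed
  with L(1) show ?thesis by blast
qed

lemma Q_parallelogram: "(x - y) \<bullet> Q (x - y) \<le> 2 * (x \<bullet> Q x) + 2 * (y \<bullet> Q y)"
  using Q_nonneg[of "x + y"] by (simp add: Q_simps inner_add_left inner_add_right inner_diff_left inner_diff_right)

text \<open>The density of the centred Gaussian whose covariance is \<open>s\<^sup>2\<close> times
  the inverse of \<open>Q\<close>.\<close>

definition N :: "real \<Rightarrow> real^'n \<Rightarrow> real" where
  "N s x = K * (1 / s) ^ CARD('n) * exp (- (((1 / s) *\<^sub>R x) \<bullet> Q ((1 / s) *\<^sub>R x)) / 2)"

lemma N_measurable [measurable]: "N s \<in> borel_measurable borel"
  unfolding N_def[abs_def] by measurable

lemma N_pos: "0 < s \<Longrightarrow> 0 < N s x"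
  using K by (simp add: N_def)

lemma N_le: "0 < s \<Longrightarrow> N s x \<le> K * (1 / s) ^ CARD('n)"
  unfolding N_def using K Q_nonneg[of "(1 / s) *\<^sub>R x"] by (intro mult_left_le) auto

lemma N_scale: "0 < s \<Longrightarrow> N s (s *\<^sub>R w) * s ^ CARD('n) = N 1 w"
  by (simp add: N_def power_one_over)

lemma nn_integral_N: assumes s: "0 < s" shows "(\<integral>\<^sup>+x. ennreal (N s (x - y)) \<partial>lborel) = 1"
proof -
  have "(\<integral>\<^sup>+x. ennreal (N s (x - y)) \<partial>lborel) = (\<integral>\<^sup>+x. ennreal (N s x) \<partial>lborel)"
    using nn_integral_lborel_shift[of "\<lambda>x. ennreal (N s x)" "- y"] by simp
  also have "\<dots> = (\<integral>\<^sup>+w. ennreal (N s (s *\<^sub>R w)) * ennreal (s ^ CARD('n)) \<partial>lborel)"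
    using nn_integral_lborel_affine[of s "\<lambda>x. ennreal (N s x)" 0] s by simp
  also have "\<dots> = (\<integral>\<^sup>+w. ennreal (N 1 w) \<partial>lborel)"
    using s by (intro nn_integral_cong) (simp add: ennreal_mult'[symmetric] N_scale less_imp_le[OF N_pos] flip: ennreal_mult'')
  also have "\<dots> = 1" using total by (simp add: N_def)
  finally show ?thesis .
qed

lemma N_lower:
  assumes s: "0 < s"
  shows "\<exists>B. \<forall>x y. norm y \<le> R \<longrightarrow> K * (1 / s) ^ CARD('n) * exp (- (B * R\<^sup>2 + B * (norm x)\<^sup>2)) \<le> N s (x - y)"
proof -
  obtain C where C: "C > 0" "\<And>x. x \<bullet> Q x \<le> C * (norm x)\<^sup>2" using Q_upper by blast
  have "K * (1 / s) ^ CARD('n) * exp (- ((C / s\<^sup>2) * R\<^sup>2 + (C / s\<^sup>2) * (norm x)\<^sup>2)) \<le> N s (x - y)" if y: "norm y \<le> R" for x y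
  proof -
    have "((1 / s) *\<^sub>R (x - y)) \<bullet> Q ((1 / s) *\<^sub>R (x - y)) = ((x - y) \<bullet> Q (x - y)) / s\<^sup>2"
      unfolding Q_simps(3) by (simp add: power2_eq_square)
    also have "\<dots> \<le> (2 * (C * (norm x)\<^sup>2) + 2 * (C * R\<^sup>2)) / s\<^sup>2"
    proof (rule divide_right_mono)
      have "(norm y)\<^sup>2 \<le> R\<^sup>2" using y by (intro power_mono) auto
      then have "C * (norm y)\<^sup>2 \<le> C * R\<^sup>2" using C(1) by simp
      then show "(x - y) \<bullet> Q (x - y) \<le> 2 * (C * (norm x)\<^sup>2) + 2 * (C * R\<^sup>2)"
        using Q_parallelogram[of x y] C(2)[of x] C(2)[of y] by linarith
    qed simp
    finally have "- ((C / s\<^sup>2) * R\<^sup>2 + (C / s\<^sup>2) * (norm x)\<^sup>2) \<le> - (((1 / s) *\<^sub>R (x - y)) \<bullet> Q ((1 / s) *\<^sub>R (x - y))) / 2"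
      by (simp add: add_divide_distrib)
    then show ?thesis unfolding N_def using K s by (intro mult_left_mono) auto
  qed
  then show ?thesis by blast
qed

lemma continuous_N: "continuous_on UNIV (N s)"
  unfolding N_def by (intro continuous_intros linear_continuous_on_compose[OF _ linQ]) simp_all

end

locale gaussian_smoothing = gaussian_kernel Q K c + prob_space M
  for Q :: "real^'n \<Rightarrow> real^'n" and K c and M :: "(real^'n) measure" +
  assumes sets_M [measurable_cong]: "sets M = sets borel"
begin

text \<open>For the identity \<open>S\<close> this is the convolution of \<open>M\<close> with the
  kernel; for a simple function \<open>S\<close> it is a finite mixture. Both are thus covered by
  the same estimates.\<close>

definition smooth :: "real \<Rightarrow> (real^'n \<Rightarrow> real^'n) \<Rightarrow> real^'n \<Rightarrow> real" where
  "smooth s S x = (\<integral>y. N s (x - S y) \<partial>M)"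

lemma integrable_N:
  assumes s: "0 < s" and [measurable]: "S \<in> borel_measurable borel" shows "integrable M (\<lambda>y. N s (x - S y))"
  by (rule integrable_const_bound[of _ "K * (1 / s) ^ CARD('n)"])
    (use N_le[OF s] N_pos[OF s] in \<open>auto simp: less_imp_le\<close>)

lemma ennreal_smooth:
  assumes s: "0 < s" and [measurable]: "S \<in> borel_measurable borel"
  shows "ennreal (smooth s S x) = (\<integral>\<^sup>+y. ennreal (N s (x - S y)) \<partial>M)"
  unfolding smooth_def using N_pos[OF s]
  by (intro nn_integral_eq_integral[symmetric] integrable_N assms) (auto simp: less_imp_le)

lemma smooth_measurable:
  assumes [measurable]: "S \<in> borel_measurable borel" shows "smooth s S \<in> borel_measurable borel"
  unfolding smooth_def[abs_def] by measurable

lemma nn_integral_smooth: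
  assumes s: "0 < s" and [measurable]: "S \<in> borel_measurable borel"
  shows "(\<integral>\<^sup>+x. ennreal (smooth s S x) \<partial>lborel) = 1"
proof -
  interpret pair_sigma_finite M lborel ..
  have "(\<integral>\<^sup>+x. ennreal (smooth s S x) \<partial>lborel) = (\<integral>\<^sup>+x. \<integral>\<^sup>+y. ennreal (N s (x - S y)) \<partial>M \<partial>lborel)"
    by (simp add: ennreal_smooth[OF assms])
  also have "\<dots> = (\<integral>\<^sup>+y. \<integral>\<^sup>+x. ennreal (N s (x - S y)) \<partial>lborel \<partial>M)"
    by (rule Fubini') measurable
  also have "\<dots> = 1" by (simp add: nn_integral_N[OF s] emeasure_space_1)
  finally show ?thesis .
qed

text \<open>Some ball carries more than half of the mass of \<open>M\<close>, and the growth bound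
  on \<open>S n\<close> keeps its image in the ball of twice the radius; kernels centred there share
  a Gaussian lower bound.\<close>

lemma smooth_lower:
  assumes s: "0 < s" and Sm: "\<And>n. S n \<in> borel_measurable borel" and S2: "\<And>n y. norm (S n y) \<le> 2 * norm y"
  shows "\<exists>A B. \<forall>n x. exp (- (A + B * (norm x)\<^sup>2)) \<le> smooth s (S n) x"
proof -
  have "(\<lambda>k. measure M (cball 0 (real k))) \<longlonglongrightarrow> measure M (\<Union>k. cball 0 (real k))"
    by (rule finite_Lim_measure_incseq) (auto simp: incseq_def sets_M)
  moreover have "(\<Union>k. cball 0 (real k)) = space M"
    using sets_eq_imp_space_eq[OF sets_M] real_arch_simple by fastforce
  ultimately have "(\<lambda>k. measure M (cball 0 (real k))) \<longlonglongrightarrow> 1" by (simp add: prob_space)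
  then have "eventually (\<lambda>k. 1 / 2 < measure M (cball 0 (real k))) sequentially"
    by (rule order_tendstoD) simp
  then obtain k where k: "1 / 2 < measure M (cball 0 (real k))" by (auto simp: eventually_sequentially)
  obtain B where B: "\<And>x y. norm y \<le> 2 * real k \<Longrightarrow> K * (1 / s) ^ CARD('n) * exp (- (B * (2 * real k)\<^sup>2 + B * (norm x)\<^sup>2)) \<le> N s (x - y)"
    using N_lower[OF s, of "2 * real k"] by blast
  define C where "C = K * (1 / s) ^ CARD('n) * exp (- (B * (2 * real k)\<^sup>2)) / 2"
  have C: "C > 0" using K s by (simp add: C_def)
  have "C * exp (- B * (norm x)\<^sup>2) \<le> smooth s (S n) x" for n x
  proof -
    define a where "a = 2 * C * exp (- B * (norm x)\<^sup>2)"
    have a: "a > 0" using C by (simp add: a_def)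
    have am: "cball 0 (real k) \<in> sets M" by (simp add: sets_M)
    have "a * (1 / 2) \<le> a * measure M (cball 0 (real k))" using k a by simp
    also have "\<dots> = (\<integral>y. a * indicator (cball 0 (real k)) y \<partial>M)" using am by simp
    also have "\<dots> \<le> smooth s (S n) x"
      unfolding smooth_def
    proof (rule integral_mono)
      show "integrable M (\<lambda>y. a * indicator (cball 0 (real k)) y)"
        using am by (intro integrable_mult_right integrable_real_indicator) (simp_all add: emeasure_eq_measure)
      show "integrable M (\<lambda>y. N s (x - S n y))" by (rule integrable_N[OF s Sm])
      fix y
      show "a * indicator (cball 0 (real k)) y \<le> N s (x - S n y)"
      proof (cases "y \<in> cball 0 (real k)")
        case True
        then have "norm (S n y) \<le> 2 * real k" using S2[of n y] by simp
        from B[OF this, of x] True show ?thesis by (simp add: a_def C_def exp_add[symmetric] mult.assoc)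
      qed (use N_pos[OF s] in \<open>simp add: less_imp_le\<close>)
    qed
    finally show ?thesis by (simp add: a_def)
  qed
  then have "exp (- (- ln C + B * (norm x)\<^sup>2)) \<le> smooth s (S n) x" for n x
    using C by (simp add: exp_diff exp_minus divide_inverse)
  then show ?thesis by blast
qed

lemma smooth_tendsto:
  assumes s: "0 < s" and [measurable]: "\<And>n. S n \<in> borel_measurable borel" and lim: "\<And>y. (\<lambda>n. S n y) \<longlonglongrightarrow> y"
  shows "(\<lambda>n. smooth s (S n) x) \<longlonglongrightarrow> smooth s (\<lambda>y. y) x"
  unfolding smooth_def
proof (rule integral_dominated_convergence[where w = "\<lambda>_. K * (1 / s) ^ CARD('n)"])
  have "(\<lambda>n. N s (x - S n y)) \<longlonglongrightarrow> N s (x - y)" for y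
    by (rule continuous_on_tendsto_compose[OF continuous_N]) (auto intro!: tendsto_intros lim)
  then show "AE y in M. (\<lambda>n. N s (x - S n y)) \<longlonglongrightarrow> N s (x - y)" by simp
  show "AE y in M. norm (N s (x - S n y)) \<le> K * (1 / s) ^ CARD('n)" for n
    using N_le[OF s] N_pos[OF s] by (simp add: less_imp_le)
qed auto

lemma smooth_simple:
  assumes s: "0 < s" and S: "simple_function M S"
  shows "smooth s S x = (\<Sum>u\<in>S ` space M. measure M (S -` {u} \<inter> space M) * N s (x - u))"
    "(\<Sum>u\<in>S ` space M. measure M (S -` {u} \<inter> space M)) = 1"
proof -
  have fin: "finite (S ` space M)" and meas: "\<And>u. u \<in> S ` space M \<Longrightarrow> S -` {u} \<inter> space M \<in> sets M"
    using S by (auto simp: simple_function_def)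
  have "smooth s S x = (\<integral>y. (\<Sum>u\<in>S ` space M. indicator (S -` {u} \<inter> space M) y * N s (x - u)) \<partial>M)"
    unfolding smooth_def
  proof (rule Bochner_Integration.integral_cong[OF refl])
    fix y assume y: "y \<in> space M"
    have "(\<Sum>u\<in>S ` space M. indicator (S -` {u} \<inter> space M) y * N s (x - u)) = (\<Sum>u\<in>S ` space M. if u = S y then N s (x - u) else 0)"
      using y by (intro sum.cong) (auto simp: indicator_def)
    then show "N s (x - S y) = (\<Sum>u\<in>S ` space M. indicator (S -` {u} \<inter> space M) y * N s (x - u))"
      using fin y by simp
  qed
  also have "\<dots> = (\<Sum>u\<in>S ` space M. measure M (S -` {u} \<inter> space M) * N s (x - u))"
    using meas by (subst Bochner_Integration.integral_sum)
      (auto intro!: integrable_mult_left integrable_real_indicator simp: emeasure_eq_measure)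
  finally show "smooth s S x = (\<Sum>u\<in>S ` space M. measure M (S -` {u} \<inter> space M) * N s (x - u))" .
  have "(\<Sum>u\<in>S ` space M. measure M (S -` {u} \<inter> space M)) = measure M (\<Union>u\<in>S ` space M. S -` {u} \<inter> space M)"
    by (rule finite_measure_finite_Union[symmetric]) (use fin meas in \<open>auto simp: disjoint_family_on_def\<close>)
  also have "(\<Union>u\<in>S ` space M. S -` {u} \<inter> space M) = space M" by auto
  finally show "(\<Sum>u\<in>S ` space M. measure M (S -` {u} \<inter> space M)) = 1" by (simp add: prob_space)
qed

end

lemma KLnn_cong_AE:
  "(AE x in lborel. \<rho> x = \<rho>' x) \<Longrightarrow> KLnn \<nu> \<rho> = KLnn \<nu> \<rho>'"
  unfolding KLnn_def by (rule nn_integral_cong_AE) auto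

text \<open>Adding \<open>\<nu> x - \<rho> x\<close>, which has integral 0, leads back from
  \<open>rel_ent\<close> to the signed entropy integrand.\<close>

lemma integrable_KL_of_KLnn:
  assumes [measurable]: "\<nu> \<in> borel_measurable borel" "\<rho> \<in> borel_measurable borel"
    and \<nu>: "\<And>x. 0 \<le> \<nu> x" "(\<integral>\<^sup>+x. ennreal (\<nu> x) \<partial>lborel) = 1"
    and \<rho>: "\<And>x. 0 < \<rho> x" "(\<integral>\<^sup>+x. ennreal (\<rho> x) \<partial>lborel) = 1"
    and le: "KLnn \<nu> \<rho> \<le> ennreal \<epsilon>" and \<epsilon>: "0 \<le> \<epsilon>"
  shows "integrable lborel (\<lambda>x. \<nu> x * ln (\<nu> x / \<rho> x))" "(\<integral>x. \<nu> x * ln (\<nu> x / \<rho> x) \<partial>lborel) \<le> \<epsilon>"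
proof -
  have density: "integrable lborel f \<and> (\<integral>x. f x \<partial>lborel) = 1"
    if [measurable]: "f \<in> borel_measurable borel" and f: "\<And>x. 0 \<le> f x" "(\<integral>\<^sup>+x. ennreal (f x) \<partial>lborel) = 1"
    for f :: "real^'a \<Rightarrow> real"
  proof -
    have i: "integrable lborel f" using f by (intro integrableI_nonneg) auto
    have "ennreal (\<integral>x. f x \<partial>lborel) = 1" using nn_integral_eq_integral[OF i] f by simp
    with i show ?thesis by (metis ennreal_eq_1 ennreal_1)
  qed
  note i\<nu> = density[OF assms(1) \<nu>]
  have i\<rho>: "integrable lborel \<rho> \<and> (\<integral>x. \<rho> x \<partial>lborel) = 1" by (rule density) (use \<rho> in \<open>auto simp: less_imp_le\<close>)
  have nn: "0 \<le> rel_ent (\<nu> x) (\<rho> x)" for x by (rule rel_ent_nonneg) (rule \<nu> \<rho>)+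
  have ir: "integrable lborel (\<lambda>x. rel_ent (\<nu> x) (\<rho> x))"
    using le nn by (intro integrableI_nonneg) (auto simp: KLnn_def intro: order_le_less_trans)
  have "ennreal (\<integral>x. rel_ent (\<nu> x) (\<rho> x) \<partial>lborel) \<le> ennreal \<epsilon>"
    using le nn_integral_eq_integral[OF ir] nn by (simp add: KLnn_def)
  then have r: "(\<integral>x. rel_ent (\<nu> x) (\<rho> x) \<partial>lborel) \<le> \<epsilon>" using \<epsilon> by simp
  have eq: "\<nu> x * ln (\<nu> x / \<rho> x) = rel_ent (\<nu> x) (\<rho> x) + \<nu> x - \<rho> x" for x by (simp add: rel_ent_def)
  show "integrable lborel (\<lambda>x. \<nu> x * ln (\<nu> x / \<rho> x))" unfolding eq using ir i\<nu> i\<rho> by simp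
  show "(\<integral>x. \<nu> x * ln (\<nu> x / \<rho> x) \<partial>lborel) \<le> \<epsilon>" unfolding eq using ir i\<nu> i\<rho> r by simp
qed

lemma ennreal_integral_le_nn_integral:
  assumes "integrable M h" shows "ennreal (\<integral>x. h x \<partial>M) \<le> (\<integral>\<^sup>+x. ennreal (h x) \<partial>M)"
proof -
  have "(\<integral>x. h x \<partial>M) \<le> (\<integral>x. max 0 (h x) \<partial>M)" using assms by (intro integral_mono) auto
  then have "ennreal (\<integral>x. h x \<partial>M) \<le> ennreal (\<integral>x. max 0 (h x) \<partial>M)" by (rule ennreal_leI)
  also have "\<dots> = (\<integral>\<^sup>+x. ennreal (max 0 (h x)) \<partial>M)" using assms by (subst nn_integral_eq_integral) auto
  also have "\<dots> = (\<integral>\<^sup>+x. ennreal (h x) \<partial>M)" by (intro nn_integral_cong) (simp add: max_def ennreal_neg)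
  finally show ?thesis .
qed

text \<open>Integrated over \<open>w\<close>, this bounds the smoothing of \<open>N 1\<close> below
  by a Gaussian in \<open>x\<close>, uniformly in \<open>s \<le> 1\<close>. The parallelogram bound
  leaves \<open>3 / 2\<close> times \<open>w \<bullet> Q w\<close> in the exponent, which is the
  kernel of scale \<open>1 / sqrt 3\<close>.\<close>

lemma (in gaussian_kernel) N_one_lower:
  assumes s: "0 < s" "s \<le> 1"
  shows "(K * (1 / sqrt 3) ^ CARD('n) * exp (- (x \<bullet> Q x))) * N (1 / sqrt 3) w \<le> N 1 (x - s *\<^sub>R w) * N 1 w"
proof -
  have "(s *\<^sub>R w) \<bullet> Q (s *\<^sub>R w) = s\<^sup>2 * (w \<bullet> Q w)" by (simp add: Q_simps power2_eq_square)
  also have "\<dots> \<le> 1 * (w \<bullet> Q w)" using s Q_nonneg[of w] by (intro mult_right_mono) (auto simp: power_le_one)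
  finally have "(x - s *\<^sub>R w) \<bullet> Q (x - s *\<^sub>R w) \<le> 2 * (x \<bullet> Q x) + 2 * (w \<bullet> Q w)"
    using Q_parallelogram[of x "s *\<^sub>R w"] by linarith
  then have le: "exp (- (x \<bullet> Q x)) * exp (- (3 * (w \<bullet> Q w)) / 2) \<le> exp (- ((x - s *\<^sub>R w) \<bullet> Q (x - s *\<^sub>R w)) / 2) * exp (- (w \<bullet> Q w) / 2)"
    unfolding exp_add[symmetric] by simp
  have "(sqrt 3 *\<^sub>R w) \<bullet> Q (sqrt 3 *\<^sub>R w) = 3 * (w \<bullet> Q w)" by (simp add: Q_simps)
  then have Neq: "N (1 / sqrt 3) w * (1 / sqrt 3) ^ CARD('n) = K * exp (- (3 * (w \<bullet> Q w)) / 2)"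
    by (simp add: N_def power_one_over)
  have "(K * (1 / sqrt 3) ^ CARD('n) * exp (- (x \<bullet> Q x))) * N (1 / sqrt 3) w
      = K * exp (- (x \<bullet> Q x)) * (N (1 / sqrt 3) w * (1 / sqrt 3) ^ CARD('n))"
    by (simp only: mult_ac)
  also have "\<dots> = K * K * (exp (- (x \<bullet> Q x)) * exp (- (3 * (w \<bullet> Q w)) / 2))"
    unfolding Neq by (simp only: mult_ac)
  also have "\<dots> \<le> K * K * (exp (- ((x - s *\<^sub>R w) \<bullet> Q (x - s *\<^sub>R w)) / 2) * exp (- (w \<bullet> Q w) / 2))"
    using le K by (intro mult_left_mono) auto
  also have "\<dots> = N 1 (x - s *\<^sub>R w) * N 1 w" by (simp add: N_def)
  finally show ?thesis .
qed

text \<open>Fatou's lemma is applied twice: as the smoothing scale tends to 0, where semicontinuity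
  gives lower bounds only, and at a fixed scale as the mixing measure is discretised, where the
  densities converge.\<close>

lemma mixture_KLnn:
  fixes \<nu> :: "real^'n \<Rightarrow> real"
  assumes kernel: "gaussian_kernel Q K c" and target: "KL_target \<nu>" and \<epsilon>: "0 < \<epsilon>"
  shows "\<exists>s>0. \<exists>I wt. finite I \<and> (\<forall>u\<in>I. 0 \<le> wt u) \<and> sum wt I = 1 \<and>
    KLnn \<nu> (\<lambda>x. \<Sum>u\<in>I. wt u * gaussian_kernel.N Q K s (x - u)) < ennreal \<epsilon>"
proof -
  interpret gaussian_kernel Q K c by (rule kernel)
  interpret KL_target \<nu> by (rule target)
  \<comment> \<open>Normalising a mass \<open>Z \<le> 1 + 2 * \<delta>\<close> costs entropy
    \<open>ln Z \<le> \<epsilon> / 2\<close>.\<close>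
  define \<delta> where "\<delta> = \<epsilon> / 4"
  have \<delta>: "\<delta> > 0" using \<epsilon> by (simp add: \<delta>_def)
  obtain f where fm [measurable]: "f \<in> borel_measurable borel" and f\<nu>: "\<And>x. ennreal (\<nu> x) \<le> f x"
    and fint: "(\<integral>\<^sup>+x. f x \<partial>lborel) \<le> ennreal (1 + \<delta>)" and lsc: "\<And>x s. s \<longlonglongrightarrow> x \<Longrightarrow> f x \<le> liminf (\<lambda>n. f (s n))"
    using lower_semicontinuous_majorant[OF \<nu>m \<nu>1 \<delta>] by blast
  \<comment> \<open>The majorant may vanish on large sets; the added Gaussian gives all smoothings
    the common lower bound that \<open>KLnn_Fatou\<close> asks for.\<close>
  define F where "F y = f y + ennreal (\<delta> * N 1 y)" for y
  have Fm [measurable]: "F \<in> borel_measurable borel" unfolding F_def[abs_def] by measurable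
  have N1: "(\<integral>\<^sup>+y. ennreal (N 1 y) \<partial>lborel) = 1" using nn_integral_N[of 1 0] by simp
  have "(\<integral>\<^sup>+y. F y \<partial>lborel) = (\<integral>\<^sup>+y. f y \<partial>lborel) + ennreal \<delta>"
    using \<delta> N1 by (simp add: F_def nn_integral_add ennreal_mult' nn_integral_cmult)
  moreover have "\<dots> \<le> ennreal (1 + \<delta>) + ennreal \<delta>" using fint by (rule add_right_mono)
  moreover have "\<dots> = ennreal (1 + 2 * \<delta>)" using \<delta> by (simp add: ennreal_plus[symmetric] del: ennreal_plus)
  moreover have "1 \<le> (\<integral>\<^sup>+y. f y \<partial>lborel)" unfolding \<nu>1[symmetric] by (intro nn_integral_mono f\<nu>)
  ultimately have Fint: "(\<integral>\<^sup>+y. F y \<partial>lborel) \<le> ennreal (1 + 2 * \<delta>)" "1 \<le> (\<integral>\<^sup>+y. F y \<partial>lborel)"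
    by (auto intro: add_increasing2)
  define Z where "Z = enn2real (\<integral>\<^sup>+y. F y \<partial>lborel)"
  have "(\<integral>\<^sup>+y. F y \<partial>lborel) < \<top>" using Fint(1) by (rule order_le_less_trans) simp
  then have Zeq: "(\<integral>\<^sup>+y. F y \<partial>lborel) = ennreal Z" by (simp add: Z_def)
  have Z: "1 \<le> Z" "Z \<le> 1 + 2 * \<delta>"
  proof -
    have "ennreal 1 \<le> ennreal Z" using Fint(2) unfolding Zeq by simp
    moreover have "0 \<le> Z" by (simp add: Z_def)
    ultimately show "1 \<le> Z" by (simp only: ennreal_le_iff)
    show "Z \<le> 1 + 2 * \<delta>"
      using Fint(1) \<delta> unfolding Zeq by (subst (asm) ennreal_le_iff) auto
  qed
  define M where "M = density lborel (\<lambda>y. F y * ennreal (1 / Z))"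
  have sM: "sets M = sets borel" by (simp add: M_def)
  have "prob_space M"
  proof
    have "emeasure M (space M) = (\<integral>\<^sup>+y. F y * ennreal (1 / Z) \<partial>lborel)"
      unfolding M_def by (subst emeasure_density) auto
    also have "\<dots> = ennreal Z * ennreal (1 / Z)" by (simp add: nn_integral_multc Zeq)
    also have "\<dots> = 1" using Z by (simp add: ennreal_mult'[symmetric])
    finally show "emeasure M (space M) = 1" .
  qed
  then interpret M: gaussian_smoothing Q K c M
    by (intro gaussian_smoothing.intro kernel gaussian_smoothing_axioms.intro sM)
  have smooth_eq: "ennreal (M.smooth s (\<lambda>y. y) x) = (\<integral>\<^sup>+w. F (x - s *\<^sub>R w) * ennreal (1 / Z * N 1 w) \<partial>lborel)"
    if s: "0 < s" for s x
  proof -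
    have "ennreal (M.smooth s (\<lambda>y. y) x) = (\<integral>\<^sup>+y. ennreal (N s (x - y)) \<partial>M)"
      by (rule M.ennreal_smooth[OF s]) simp
    also have "\<dots> = (\<integral>\<^sup>+y. F y * ennreal (1 / Z) * ennreal (N s (x - y)) \<partial>lborel)"
      unfolding M_def by (rule nn_integral_density) measurable
    also have "\<dots> = (\<integral>\<^sup>+w. F (x + (- s) *\<^sub>R w) * ennreal (1 / Z) * ennreal (N s (x - (x + (- s) *\<^sub>R w))) * ennreal (\<bar>- s\<bar> ^ DIM(real^'n)) \<partial>lborel)"
      using s by (intro nn_integral_lborel_affine[symmetric]) auto
    also have "\<dots> = (\<integral>\<^sup>+w. F (x - s *\<^sub>R w) * ennreal (1 / Z * N 1 w) \<partial>lborel)"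
    proof (intro nn_integral_cong)
      fix w
      have "ennreal (1 / Z) * (ennreal (N s (s *\<^sub>R w)) * ennreal (s ^ CARD('n))) = ennreal (1 / Z * N 1 w)"
        using s Z N_pos[OF s] by (subst N_scale[OF s, symmetric]) (simp add: ennreal_mult'[symmetric] less_imp_le mult.commute)
      then show "F (x + (- s) *\<^sub>R w) * ennreal (1 / Z) * ennreal (N s (x - (x + (- s) *\<^sub>R w))) * ennreal (\<bar>- s\<bar> ^ DIM(real^'n))
         = F (x - s *\<^sub>R w) * ennreal (1 / Z * N 1 w)"
        using s by (simp add: mult.assoc)
    qed
    finally show ?thesis .
  qed
  define C where "C = \<delta> / Z * (K * (1 / sqrt 3) ^ CARD('n))"
  have C: "C > 0" using \<delta> Z K by (simp add: C_def)
  obtain B where B: "B > 0" "\<And>x. x \<bullet> Q x \<le> B * (norm x)\<^sup>2" using Q_upper by blast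
  define A where "A = - ln C"
  have low1: "exp (- (A + B * (norm x)\<^sup>2)) \<le> M.smooth s (\<lambda>y. y) x" if s: "0 < s" "s \<le> 1" for s x
  proof -
    have "exp (- (A + B * (norm x)\<^sup>2)) = C * exp (- (B * (norm x)\<^sup>2))"
      using C by (simp add: A_def exp_diff exp_minus divide_inverse)
    also have "\<dots> \<le> C * exp (- (x \<bullet> Q x))" using C B(2)[of x] by simp
    finally have 1: "exp (- (A + B * (norm x)\<^sup>2)) \<le> C * exp (- (x \<bullet> Q x))" .
    have "ennreal (C * exp (- (x \<bullet> Q x))) = ennreal (C * exp (- (x \<bullet> Q x))) * (\<integral>\<^sup>+w. ennreal (N (1 / sqrt 3) w) \<partial>lborel)"
      using nn_integral_N[of "1 / sqrt 3" 0] by simp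
    also have "\<dots> = (\<integral>\<^sup>+w. ennreal (C * exp (- (x \<bullet> Q x)) * N (1 / sqrt 3) w) \<partial>lborel)"
      using C by (subst nn_integral_cmult[symmetric]) (auto simp: ennreal_mult')
    also have "\<dots> \<le> (\<integral>\<^sup>+w. F (x - s *\<^sub>R w) * ennreal (1 / Z * N 1 w) \<partial>lborel)"
    proof (intro nn_integral_mono)
      fix w
      have "C * exp (- (x \<bullet> Q x)) * N (1 / sqrt 3) w = \<delta> / Z * ((K * (1 / sqrt 3) ^ CARD('n) * exp (- (x \<bullet> Q x))) * N (1 / sqrt 3) w)"
        by (simp add: C_def)
      also have "\<dots> \<le> \<delta> / Z * (N 1 (x - s *\<^sub>R w) * N 1 w)"
        using N_one_lower[OF s] \<delta> Z by (intro mult_left_mono) auto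
      also have "\<dots> = (\<delta> * N 1 (x - s *\<^sub>R w)) * (1 / Z * N 1 w)" by simp
      finally have "ennreal (C * exp (- (x \<bullet> Q x)) * N (1 / sqrt 3) w) \<le> ennreal (\<delta> * N 1 (x - s *\<^sub>R w)) * ennreal (1 / Z * N 1 w)"
        using \<delta> N_pos[of 1] by (simp add: ennreal_mult'[symmetric] less_imp_le ennreal_leI)
      also have "\<dots> \<le> F (x - s *\<^sub>R w) * ennreal (1 / Z * N 1 w)"
        unfolding F_def by (intro mult_right_mono) auto
      finally show "ennreal (C * exp (- (x \<bullet> Q x)) * N (1 / sqrt 3) w) \<le> F (x - s *\<^sub>R w) * ennreal (1 / Z * N 1 w)" .
    qed
    also have "\<dots> = ennreal (M.smooth s (\<lambda>y. y) x)" by (rule smooth_eq[OF s(1), symmetric])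
    finally have "ennreal (C * exp (- (x \<bullet> Q x))) \<le> ennreal (M.smooth s (\<lambda>y. y) x)" .
    moreover have "0 \<le> M.smooth s (\<lambda>y. y) x"
      unfolding M.smooth_def using N_pos[OF s(1)] by (intro integral_nonneg_AE) (simp add: less_imp_le)
    ultimately have "C * exp (- (x \<bullet> Q x)) \<le> M.smooth s (\<lambda>y. y) x" by (simp only: ennreal_le_iff)
    with 1 show ?thesis by (rule order_trans)
  qed
  define r where "r m = inverse (real (Suc m))" for m
  have r: "0 < r m" "r m \<le> 1" for m by (auto simp: r_def inverse_le_1_iff)
  define R where "R m = M.smooth (r m) (\<lambda>y. y)" for m
  have Rm: "R m \<in> borel_measurable borel" for m unfolding R_def by (rule M.smooth_measurable) simp
  have R1: "(\<integral>\<^sup>+x. ennreal (R m x) \<partial>lborel) = 1" for m unfolding R_def by (rule M.nn_integral_smooth[OF r(1)]) simp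
  have Rlow: "exp (- (A + B * (norm x)\<^sup>2)) \<le> R m x" for m x unfolding R_def by (rule low1[OF r])
  \<comment> \<open>A lower bound for the limit of the smoothings: \<open>\<nu> x / Z\<close> by
    semicontinuity, and the common Gaussian bound, which keeps it positive where
    \<open>\<nu>\<close> vanishes.\<close>
  define g where "g x = max (\<nu> x / Z) (exp (- (A + B * (norm x)\<^sup>2)))" for x
  have gm: "g \<in> borel_measurable borel" unfolding g_def[abs_def] by measurable
  have gpos: "0 < g x" for x by (simp add: g_def less_max_iff_disj)
  have lim: "eventually (\<lambda>m. a < R m x) sequentially" if a: "a < g x" for x a
  proof (cases "a < exp (- (A + B * (norm x)\<^sup>2))")
    case True
    then show ?thesis by (intro always_eventually allI) (rule order_less_le_trans[OF _ Rlow])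
  next
    case False
    then have a': "a < \<nu> x / Z" using a by (auto simp: g_def less_max_iff_disj)
    have a0: "0 \<le> a" using False exp_gt_zero[of "- (A + B * (norm x)\<^sup>2)"] by linarith
    \<comment> \<open>The smoothing at \<open>x\<close> is the integral of
      \<open>F (x - r m *\<^sub>R w)\<close> over \<open>w\<close> under \<open>P\<close>, whose
      mass is \<open>1 / Z\<close>. Semicontinuity of \<open>f\<close> and Fatou's lemma give at
      least \<open>\<nu> x / Z\<close> in the limit.\<close>
    define P where "P = density lborel (\<lambda>w. ennreal (1 / Z * N 1 w))"
    have P1: "emeasure P (space P) = ennreal (1 / Z)"
    proof -
      have "emeasure P (space P) = (\<integral>\<^sup>+w. ennreal (1 / Z) * ennreal (N 1 w) \<partial>lborel)"
        unfolding P_def using Z by (subst emeasure_density) (simp_all add: ennreal_mult'[symmetric])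
      then show ?thesis by (simp add: nn_integral_cmult N1)
    qed
    have [measurable_cong]: "sets P = sets borel" by (simp add: P_def)
    have "(\<lambda>m. x - r m *\<^sub>R w) \<longlonglongrightarrow> x - 0 *\<^sub>R w" for w
      unfolding r_def by (intro tendsto_intros LIMSEQ_inverse_real_of_nat)
    then have fl: "f x \<le> liminf (\<lambda>m. f (x - r m *\<^sub>R w))" for w by (intro lsc) simp
    have "ennreal (\<nu> x / Z) = ennreal (\<nu> x) * ennreal (1 / Z)" using \<nu>0 by (simp add: ennreal_mult'[symmetric])
    also have "\<dots> \<le> f x * emeasure P (space P)" unfolding P1 by (intro mult_right_mono f\<nu>) simp
    also have "\<dots> = (\<integral>\<^sup>+w. f x \<partial>P)" by simp
    also have "\<dots> \<le> (\<integral>\<^sup>+w. liminf (\<lambda>m. f (x - r m *\<^sub>R w)) \<partial>P)" by (intro nn_integral_mono fl)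
    also have "\<dots> \<le> liminf (\<lambda>m. \<integral>\<^sup>+w. f (x - r m *\<^sub>R w) \<partial>P)" by (rule nn_integral_liminf) measurable
    also have "\<dots> \<le> liminf (\<lambda>m. ennreal (R m x))"
    proof (intro Liminf_mono always_eventually allI)
      fix m
      have "(\<integral>\<^sup>+w. f (x - r m *\<^sub>R w) \<partial>P) = (\<integral>\<^sup>+w. ennreal (1 / Z * N 1 w) * f (x - r m *\<^sub>R w) \<partial>lborel)"
        unfolding P_def by (rule nn_integral_density) measurable
      also have "\<dots> \<le> (\<integral>\<^sup>+w. F (x - r m *\<^sub>R w) * ennreal (1 / Z * N 1 w) \<partial>lborel)"
        unfolding F_def by (intro nn_integral_mono) (subst mult.commute, intro mult_right_mono, auto)
      finally show "(\<integral>\<^sup>+w. f (x - r m *\<^sub>R w) \<partial>P) \<le> ennreal (R m x)"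
        unfolding R_def smooth_eq[OF r(1)] .
    qed
    finally have "ennreal a < liminf (\<lambda>m. ennreal (R m x))"
      using a' a0 by (intro order_less_le_trans[OF ennreal_lessI]) auto
    from less_LiminfD[OF this] show ?thesis
      by eventually_elim (use a0 in \<open>simp add: ennreal_less_iff\<close>)
  qed
  have T0: "0 \<le> total_gain A B"
    by (rule KLnn_add_gain(2)[where \<rho> = "R 0", OF Rm R1 Rlow])
  have less: "ennreal (total_gain A B) < (\<integral>\<^sup>+x. ennreal (gain A B g x) \<partial>lborel) + ennreal \<epsilon>"
  proof -
    have ge: "gain A B \<nu> x - ln Z * \<nu> x \<le> gain A B g x" for x
    proof (cases "\<nu> x = 0")
      case False
      then have n: "\<nu> x > 0" using \<nu>0[of x] by simp
      have "ln (\<nu> x) - ln Z = ln (\<nu> x / Z)" using n Z by (simp add: ln_div)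
      also have "\<dots> \<le> ln (g x)" using n Z gpos[of x] by (subst ln_le_cancel_iff) (auto simp: g_def)
      finally have "\<nu> x * (A + B * (norm x)\<^sup>2 + (ln (\<nu> x) - ln Z)) \<le> \<nu> x * (A + B * (norm x)\<^sup>2 + ln (g x))"
        using n by (intro mult_left_mono) auto
      then show ?thesis by (simp add: gain_def algebra_simps)
    qed (simp add: gain_def)
    have i: "integrable lborel (\<lambda>x. gain A B \<nu> x - ln Z * \<nu> x)" using integrable_gain integrable_\<nu> by simp
    have "ennreal (total_gain A B - ln Z) = ennreal (\<integral>x. gain A B \<nu> x - ln Z * \<nu> x \<partial>lborel)"
      using integrable_gain integrable_\<nu> by (simp add: total_gain_def)
    also have "\<dots> \<le> (\<integral>\<^sup>+x. ennreal (gain A B \<nu> x - ln Z * \<nu> x) \<partial>lborel)" by (rule ennreal_integral_le_nn_integral[OF i])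
    also have "\<dots> \<le> (\<integral>\<^sup>+x. ennreal (gain A B g x) \<partial>lborel)" by (intro nn_integral_mono ennreal_leI ge)
    finally have 1: "ennreal (total_gain A B - ln Z) + ennreal \<epsilon> \<le> (\<integral>\<^sup>+x. ennreal (gain A B g x) \<partial>lborel) + ennreal \<epsilon>"
      by (rule add_right_mono)
    have "ln Z \<le> Z - 1" using Z by (intro ln_le_minus_one) simp
    then have lnZ: "ln Z < \<epsilon>" using Z \<epsilon> by (simp add: \<delta>_def)
    \<comment> \<open>If the difference is negative, \<open>ennreal\<close> truncates it to 0, but
      then \<open>total_gain A B < ln Z < \<epsilon>\<close>.\<close>
    have "ennreal (total_gain A B) < ennreal (total_gain A B - ln Z) + ennreal \<epsilon>"
    proof (cases "total_gain A B - ln Z \<ge> 0")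
      case True
      then have "ennreal (total_gain A B - ln Z) + ennreal \<epsilon> = ennreal (total_gain A B - ln Z + \<epsilon>)"
        using \<epsilon> by (simp only: ennreal_plus less_imp_le)
      then show ?thesis using lnZ T0 by (simp only:) (rule ennreal_lessI, auto)
    next
      case False
      then show ?thesis using lnZ \<epsilon> T0 by (simp add: ennreal_neg ennreal_lessI)
    qed
    then show ?thesis using 1 by (rule order_less_le_trans)
  qed
  have "\<exists>m. KLnn \<nu> (R m) < ennreal \<epsilon>"
    by (rule KLnn_Fatou[where \<rho> = R and A = A and B = B and g = g, OF Rm R1 Rlow gm gpos lim less])
  then obtain m where m: "KLnn \<nu> (R m) < ennreal \<epsilon>" ..
  define s where "s = r m"
  have s: "0 < s" using r by (simp add: s_def)
  define \<rho> where "\<rho> = M.smooth s (\<lambda>y. y)"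
  have \<rho>m: "\<rho> \<in> borel_measurable borel" unfolding \<rho>_def by (rule M.smooth_measurable) simp
  have \<rho>1: "(\<integral>\<^sup>+x. ennreal (\<rho> x) \<partial>lborel) = 1" unfolding \<rho>_def by (rule M.nn_integral_smooth[OF s]) simp
  have m': "KLnn \<nu> \<rho> < ennreal \<epsilon>" using m unfolding \<rho>_def s_def R_def .
  \<comment> \<open>Simple functions converging to the identity and at most doubling the norm, as
    \<open>smooth_lower\<close> requires; the masses of their level sets become the weights of the
    mixture.\<close>
  have "(\<lambda>y. y) \<in> borel_measurable M" using sM by (simp add: measurable_ident_sets)
  from borel_measurable_implies_sequence_metric[OF this, of 0]
  obtain S where S': "\<forall>i. simple_function M (S i)" "\<forall>y\<in>space M. (\<lambda>i. S i y) \<longlonglongrightarrow> y"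
      "\<forall>i. \<forall>y\<in>space M. dist (S i y) 0 \<le> 2 * dist y 0" by (elim exE conjE)
  have spM: "space M = UNIV" by (simp add: M_def)
  have S: "simple_function M (S i)" "(\<lambda>i. S i y) \<longlonglongrightarrow> y" "dist (S i y) 0 \<le> 2 * dist y 0" for i y
    using S' unfolding spM by simp_all
  have Sm: "S i \<in> borel_measurable borel" for i
    using borel_measurable_simple_function[OF S(1)[of i]] measurable_cong_sets[OF sM refl, of borel] by simp
  have S2: "norm (S i y) \<le> 2 * norm y" for i y using S(3)[of i y] by simp
  define W where "W n = M.smooth s (S n)" for n
  have Wm: "W n \<in> borel_measurable borel" for n unfolding W_def by (rule M.smooth_measurable[OF Sm])
  have W1: "(\<integral>\<^sup>+x. ennreal (W n x) \<partial>lborel) = 1" for n unfolding W_def by (rule M.nn_integral_smooth[OF s Sm])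
  from M.smooth_lower[where S = S, OF s Sm S2]
  obtain A' B' where "\<forall>n x. exp (- (A' + B' * (norm x)\<^sup>2)) \<le> M.smooth s (S n) x" by (elim exE)
  then have low2: "exp (- (A' + B' * (norm x)\<^sup>2)) \<le> W n x" for n x by (simp add: W_def)
  have tends: "(\<lambda>n. W n x) \<longlonglongrightarrow> \<rho> x" for x
    unfolding \<rho>_def W_def by (rule M.smooth_tendsto[where S = S, OF s Sm S(2)])
  have low3: "exp (- (A' + B' * (norm x)\<^sup>2)) \<le> \<rho> x" for x
    by (rule LIMSEQ_le_const[OF tends]) (use low2 in auto)
  have \<rho>pos: "0 < \<rho> x" for x using low3[of x] exp_gt_zero by (rule order_less_le_trans[rotated])
  have sumg: "KLnn \<nu> \<rho> + (\<integral>\<^sup>+x. ennreal (gain A' B' \<rho> x) \<partial>lborel) = ennreal (total_gain A' B')"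
    by (rule KLnn_add_gain(1)[OF \<rho>m \<rho>1 low3])
  have limW: "eventually (\<lambda>n. a < W n x) sequentially" if "a < \<rho> x" for x a
    by (rule order_tendstoD(1)[OF tends that])
  have less': "ennreal (total_gain A' B') < (\<integral>\<^sup>+x. ennreal (gain A' B' \<rho> x) \<partial>lborel) + ennreal \<epsilon>"
  proof -
    have "(\<integral>\<^sup>+x. ennreal (gain A' B' \<rho> x) \<partial>lborel) \<noteq> \<top>"
    proof
      assume "(\<integral>\<^sup>+x. ennreal (gain A' B' \<rho> x) \<partial>lborel) = \<top>"
      with sumg show False by simp
    qed
    then show ?thesis unfolding sumg[symmetric] using m' by (simp add: add.commute ennreal_add_left_cancel_less)
  qed
  have "\<exists>n. KLnn \<nu> (W n) < ennreal \<epsilon>"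
    by (rule KLnn_Fatou[where \<rho> = W and A = A' and B = B' and g = \<rho>, OF Wm W1 low2 \<rho>m \<rho>pos limW less'])
  then obtain n where n: "KLnn \<nu> (W n) < ennreal \<epsilon>" ..
  define I where "I = S n ` space M"
  define wt where "wt u = measure M (S n -` {u} \<inter> space M)" for u
  have "finite I" using S(1)[of n] by (simp add: simple_function_def I_def)
  moreover have "\<forall>u\<in>I. 0 \<le> wt u" by (simp add: wt_def)
  moreover have "sum wt I = 1" unfolding wt_def I_def by (rule M.smooth_simple(2)[OF s S(1)])
  moreover have W: "W n = (\<lambda>x. \<Sum>u\<in>I. wt u * N s (x - u))"
    unfolding W_def wt_def I_def by (rule ext) (rule M.smooth_simple(1)[OF s S(1)])
  ultimately have "finite I \<and> (\<forall>u\<in>I. 0 \<le> wt u) \<and> sum wt I = 1 \<and>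
      KLnn \<nu> (\<lambda>x. \<Sum>u\<in>I. wt u * N s (x - u)) < ennreal \<epsilon>"
    using n unfolding W by (intro conjI)
  then have "\<exists>I wt. finite I \<and> (\<forall>u\<in>I. 0 \<le> wt u) \<and> sum wt I = 1 \<and>
      KLnn \<nu> (\<lambda>x. \<Sum>u\<in>I. wt u * N s (x - u)) < ennreal \<epsilon>"
    by (intro exI)
  with s have "0 < s \<and> (\<exists>I wt. finite I \<and> (\<forall>u\<in>I. 0 \<le> wt u) \<and> sum wt I = 1 \<and>
      KLnn \<nu> (\<lambda>x. \<Sum>u\<in>I. wt u * N s (x - u)) < ennreal \<epsilon>)"
    by (rule conjI)
  then show ?thesis by (rule exI)
qed

text \<open>Half of the Gaussian exponent absorbs the factor \<open>(norm x)\<^sup>2\<close>, by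
  \<open>k * q \<le> exp (k * q)\<close>; inside the ball of radius \<open>M\<close> this factor is
  at most \<open>M\<^sup>2\<close>.\<close>

lemma integrable_norm_square_gaussian_tail:
  fixes \<rho> :: "real^'n \<Rightarrow> real"
  assumes [measurable]: "\<rho> \<in> borel_measurable borel" and \<rho>0: "\<And>x. 0 \<le> \<rho> x"
    and \<rho>1: "(\<integral>\<^sup>+x. ennreal (\<rho> x) \<partial>lborel) = 1" and \<sigma>: "0 < \<sigma>" and D: "0 \<le> D"
    and tail: "\<And>x. M \<le> norm x \<Longrightarrow> \<rho> x \<le> D * exp (- (norm x)\<^sup>2 / (2 * \<sigma>\<^sup>2))"
  shows "integrable lborel (\<lambda>x. \<rho> x * (norm x)\<^sup>2)"
proof (rule integrableI_nonneg)
  define k where "k = 1 / (4 * \<sigma>\<^sup>2)"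
  have k: "k > 0" using \<sigma> by (simp add: k_def)
  have bound: "\<rho> x * (norm x)\<^sup>2 \<le> M\<^sup>2 * \<rho> x + D / k * exp (- k * (norm x)\<^sup>2)" for x
  proof (cases "M \<le> norm x")
    case True
    define q where "q = (norm x)\<^sup>2"
    have q: "- q / (2 * \<sigma>\<^sup>2) = - k * q + - k * q" using \<sigma> by (simp add: k_def field_simps)
    have "k * q \<le> exp (k * q)" using exp_ge_add_one_self[of "k * q"] by linarith
    then have "k * q * exp (- k * q) \<le> exp (k * q) * exp (- k * q)" by (rule mult_right_mono) simp
    also have "\<dots> = 1" by (simp add: exp_add[symmetric])
    finally have kq: "q * exp (- k * q) \<le> 1 / k" using k by (simp add: field_simps)
    have "\<rho> x * q \<le> D * exp (- q / (2 * \<sigma>\<^sup>2)) * q"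
      using tail[OF True] unfolding q_def by (rule mult_right_mono) simp
    also have "\<dots> = D * exp (- k * q) * (q * exp (- k * q))" unfolding q exp_add by (simp only: mult_ac)
    also have "\<dots> \<le> D * exp (- k * q) * (1 / k)" using kq D by (intro mult_left_mono) auto
    finally have "\<rho> x * q \<le> D / k * exp (- k * q)" by simp
    moreover have "0 \<le> M\<^sup>2 * \<rho> x" using \<rho>0 by simp
    ultimately show ?thesis unfolding q_def by linarith
  next
    case False
    then have "(norm x)\<^sup>2 \<le> M\<^sup>2" by (intro power_mono) auto
    from mult_right_mono[OF this \<rho>0[of x]] have "\<rho> x * (norm x)\<^sup>2 \<le> M\<^sup>2 * \<rho> x"
      by (simp only: mult.commute)
    moreover have "0 \<le> D / k * exp (- k * (norm x)\<^sup>2)" using D k by simp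
    ultimately show ?thesis by linarith
  qed
  have "(\<integral>\<^sup>+x. ennreal (\<rho> x * (norm x)\<^sup>2) \<partial>lborel)
      \<le> (\<integral>\<^sup>+x. ennreal (M\<^sup>2) * ennreal (\<rho> x) + ennreal (D / k) * ennreal (exp (- k * (norm x)\<^sup>2)) \<partial>lborel)"
  proof (rule nn_integral_mono)
    fix x
    have "ennreal (\<rho> x * (norm x)\<^sup>2) \<le> ennreal (M\<^sup>2 * \<rho> x + D / k * exp (- k * (norm x)\<^sup>2))"
      by (rule ennreal_leI[OF bound])
    also have "\<dots> = ennreal (M\<^sup>2) * ennreal (\<rho> x) + ennreal (D / k) * ennreal (exp (- k * (norm x)\<^sup>2))"
    proof -
      have d: "0 \<le> D / k" using D k by simp
      then have "ennreal (M\<^sup>2 * \<rho> x + D / k * exp (- k * (norm x)\<^sup>2))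
          = ennreal (M\<^sup>2 * \<rho> x) + ennreal (D / k * exp (- k * (norm x)\<^sup>2))"
        using \<rho>0[of x] by (intro ennreal_plus mult_nonneg_nonneg) simp_all
      then show ?thesis by (simp only: ennreal_mult'[OF d] ennreal_mult'[OF zero_le_power2])
    qed
    finally show "ennreal (\<rho> x * (norm x)\<^sup>2)
      \<le> ennreal (M\<^sup>2) * ennreal (\<rho> x) + ennreal (D / k) * ennreal (exp (- k * (norm x)\<^sup>2))" .
  qed
  also have "\<dots> = ennreal (M\<^sup>2) + ennreal (D / k) * (\<integral>\<^sup>+x. ennreal (exp (- k * (norm x)\<^sup>2)) \<partial>(lborel :: (real^'n) measure))"
    by (simp add: nn_integral_add nn_integral_cmult \<rho>1)
  also have "\<dots> < \<infinity>" unfolding nn_integral_exp_neg_norm_square[OF k] by (simp add: ennreal_mult_less_top)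
  finally show "(\<integral>\<^sup>+x. ennreal (\<rho> x * (norm x)\<^sup>2) \<partial>lborel) < \<infinity>" .
qed (use \<rho>0 in auto)

section \<open>Densities along the flow and the final estimate\<close>

text \<open>Substituting \<open>\<Psi>\<close> for the variable in the integral over the preimage
  under \<open>X\<close> produces the density directly, since \<open>X\<close> and
  \<open>\<Psi>\<close> are inverse to each other.\<close>

lemma distr_density_pl:
  assumes pl: "pl \<Psi> J" and inv: "\<And>x. \<Psi> (X x) = x" "\<And>x. X (\<Psi> x) = x"
    and [measurable]: "\<rho> \<in> borel_measurable borel" and \<rho>0: "\<And>x. 0 \<le> \<rho> x"
  shows "distr (density lborel \<rho>) lborel X = density lborel (push \<Psi> J \<rho>)"
proof -
  obtain \<Phi> where \<Phi>: "\<Phi> \<in> borel_measurable borel" "\<And>x. \<Phi> (\<Psi> x) = x" "\<And>x. \<Psi> (\<Phi> x) = x"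
    by (rule pl_inverse[OF pl]) (rule that)
  have "X = \<Phi>" by (rule ext) (metis \<Phi>(2) inv(1))
  with \<Phi>(1) have Xm [measurable]: "X \<in> borel_measurable borel" by simp
  note [measurable] = pl_measurable[OF pl] push_measurable[OF pl assms(4)]
  show ?thesis
  proof (rule measure_eqI)
    show "sets (distr (density lborel \<rho>) lborel X) = sets (density lborel (push \<Psi> J \<rho>))" by simp
    fix A assume "A \<in> sets (distr (density lborel \<rho>) lborel X)"
    then have A [measurable]: "A \<in> sets borel" by simp
    have XA: "X -` A \<in> sets borel" using measurable_sets[OF Xm A] by simp
    have "emeasure (distr (density lborel \<rho>) lborel X) A = emeasure (density lborel \<rho>) (X -` A)"
      by (subst emeasure_distr) simp_all
    also have "\<dots> = (\<integral>\<^sup>+x. ennreal (\<rho> x) * indicator (X -` A) x \<partial>lborel)"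
      using XA by (subst emeasure_density) auto
    also have "\<dots> = (\<integral>\<^sup>+x. (\<lambda>y. ennreal (\<rho> y) * indicator A (X y)) x \<partial>lborel)"
      by (intro nn_integral_cong) (simp add: indicator_def)
    also have "\<dots> = (\<integral>\<^sup>+x. (\<lambda>y. ennreal (\<rho> y) * indicator A (X y)) (\<Psi> x) * ennreal (J x) \<partial>lborel)"
      by (rule nn_integral_pl[OF pl, symmetric]) measurable
    also have "\<dots> = (\<integral>\<^sup>+x. ennreal (push \<Psi> J \<rho> x) * indicator A x \<partial>lborel)"
      by (intro nn_integral_cong)
        (simp add: inv(2) push_def ennreal_mult \<rho>0 less_imp_le[OF pl_pos[OF pl]] mult_ac)
    also have "\<dots> = emeasure (density lborel (push \<Psi> J \<rho>)) A" by (subst emeasure_density) auto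
    finally show "emeasure (distr (density lborel \<rho>) lborel X) A = emeasure (density lborel (push \<Psi> J \<rho>)) A" .
  qed
qed

lemma probability_density_push:
  assumes "pl \<Psi> J" "probability_density \<rho>" shows "probability_density (push \<Psi> J \<rho>)"
  using assms push_measurable[OF assms(1), of \<rho>] nn_integral_push[OF assms(1), of \<rho>]
  by (auto simp: probability_density_def push_def less_imp_le[OF pl_pos[OF assms(1)]])

text \<open>Transported densities are fixed only up to null sets, so representatives are chosen time
  by time; the predicate \<open>R\<close> prescribes \<open>\<rho>0\<close> at time 0 and
  \<open>push \<Psi> J \<rho>0\<close> at time \<open>T\<close>.\<close>

lemma pl_characteristics_solution:
  fixes \<Psi> :: "real^'n \<Rightarrow> real^'n"
  assumes pl: "pl \<Psi> J" and T: "0 < T" and \<rho>0: "probability_density \<rho>0"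
  shows "\<exists>w a b \<rho>. piecewise_constant_finite_switches T (\<lambda>t. (w t, a t, b t)) \<and>
    characteristics_solution T w a b \<rho>0 \<rho> \<and> \<rho> T = push \<Psi> J \<rho>0"
proof -
  from pl_realizable[OF pl T] obtain w a b X where
    real: "realizes T w a b X" and \<Psi>: "\<forall>x. \<Psi> (X T x) = x \<and> X T (\<Psi> x) = x"
    by (elim exE conjE)
  have fin: "finite ((\<lambda>s. (w s, a s, b s)) ` {0..T})" and sw: "finite (switches T (\<lambda>s. (w s, a s, b s)))"
    and X: "\<And>x. X 0 x = x" "\<And>x. almost_solves T w a b (\<lambda>t. X t x)"
    and pls: "\<forall>t\<in>{0..T}. \<exists>\<Psi> J. pl \<Psi> J \<and> (\<forall>x. \<Psi> (X t x) = x \<and> X t (\<Psi> x) = x)"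
    using real unfolding realizes_def by simp_all
  have flow: "flow_map T w a b t = X t" if "t \<in> {0..T}" for t
    by (rule ext) (rule flow_map_eq[OF T fin sw X(2) X(1) that])
  have \<rho>0m: "\<rho>0 \<in> borel_measurable borel" "\<And>x. 0 \<le> \<rho>0 x" using \<rho>0 by (auto simp: probability_density_def)
  define R where "R t r \<longleftrightarrow> probability_density r \<and> distr (density lborel \<rho>0) lborel (X t) = density lborel r \<and>
    (t = 0 \<longrightarrow> r = \<rho>0) \<and> (t = T \<longrightarrow> r = push \<Psi> J \<rho>0)" for t r
  have R: "R t (push \<Psi>' J' \<rho>0)"
    if "pl \<Psi>' J'" "\<forall>x. \<Psi>' (X t x) = x \<and> X t (\<Psi>' x) = x" "t = 0 \<Longrightarrow> push \<Psi>' J' \<rho>0 = \<rho>0"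
      "t = T \<Longrightarrow> push \<Psi>' J' \<rho>0 = push \<Psi> J \<rho>0" for t \<Psi>' J'
  proof -
    have "distr (density lborel \<rho>0) lborel (X t) = density lborel (push \<Psi>' J' \<rho>0)"
      using that(2) by (intro distr_density_pl[OF that(1) _ _ \<rho>0m]) simp_all
    then show ?thesis unfolding R_def using probability_density_push[OF that(1) \<rho>0] that(3,4) by simp
  qed
  have "\<forall>t\<in>{0..T}. \<exists>r. R t r"
  proof
    fix t assume t: "t \<in> {0..T}"
    show "\<exists>r. R t r"
    proof (cases "t = 0 \<or> t = T")
      case True
      then show ?thesis
      proof
        assume "t = 0"
        then have "R t (push (\<lambda>x. x) (\<lambda>_. 1) \<rho>0)"
          using T X(1) by (intro R[OF pl_id]) (simp_all add: push_def[abs_def])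
        then show ?thesis by (intro exI)
      next
        assume "t = T"
        then have "R t (push \<Psi> J \<rho>0)" using T \<Psi> by (intro R[OF pl]) simp_all
        then show ?thesis by (intro exI)
      qed
    next
      case False
      from pls t obtain \<Psi>' J' where "pl \<Psi>' J'" "\<forall>x. \<Psi>' (X t x) = x \<and> X t (\<Psi>' x) = x" by meson
      then have "R t (push \<Psi>' J' \<rho>0)" using False by (intro R) simp_all
      then show ?thesis by (intro exI)
    qed
  qed
  then obtain \<rho> where \<rho>: "\<forall>t\<in>{0..T}. R t (\<rho> t)" using bchoice by meson
  have "characteristics_solution T w a b \<rho>0 \<rho>"
    unfolding characteristics_solution_def
  proof (intro conjI ballI)
    show "\<rho> 0 = \<rho>0" using \<rho>[rule_format, of 0] T by (simp add: R_def)
    fix t assume t: "t \<in> {0..T}"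
    show "probability_density (\<rho> t)" using \<rho> t by (simp add: R_def)
    show "distr (density lborel \<rho>0) lborel (flow_map T w a b t) = density lborel (\<rho> t)"
      unfolding flow[OF t] using \<rho> t by (simp add: R_def)
  qed
  moreover have "\<rho> T = push \<Psi> J \<rho>0" using \<rho>[rule_format, of T] T by (simp add: R_def)
  ultimately have "piecewise_constant_finite_switches T (\<lambda>t. (w t, a t, b t)) \<and>
      characteristics_solution T w a b \<rho>0 \<rho> \<and> \<rho> T = push \<Psi> J \<rho>0"
    using piecewise_constant_if_finite_range[OF fin sw] by simp
  then show ?thesis by (intro exI)
qed

text \<open>The base Gaussian is first dilated by \<open>s\<close> and then carried along the path
  to the mixture. In terms of inverse maps, \<open>\<Psi>\<close> for the path is applied first and
  the contraction by \<open>1 / s\<close> after it.\<close>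

lemma gaussian_transport_KLnn:
  fixes \<nu> :: "real^'n \<Rightarrow> real"
  assumes kernel: "gaussian_kernel Q K c" and target: "KL_target \<nu>" and \<epsilon>: "0 < \<epsilon>"
  shows "\<exists>\<Psi> J. pl \<Psi> J \<and> KLnn \<nu> (push \<Psi> J (\<lambda>x. K * exp (- ((x - m) \<bullet> Q (x - m)) / 2))) \<le> ennreal \<epsilon>"
proof -
  interpret gaussian_kernel Q K c by (rule kernel)
  interpret KL_target \<nu> by (rule target)
  define \<gamma> where "\<gamma> x = K * exp (- ((x - m) \<bullet> Q (x - m)) / 2)" for x
  have \<gamma>m [measurable]: "\<gamma> \<in> borel_measurable borel" unfolding \<gamma>_def[abs_def] by measurable
  \<comment> \<open>The factor \<open>exp 1\<close> of the transport acts on the entropy relative to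
    the mixture and on the error, each at most \<open>\<eta>\<close>.\<close>
  define \<eta> where "\<eta> = \<epsilon> / (2 * exp 1)"
  have \<eta>: "\<eta> > 0" using \<epsilon> by (simp add: \<eta>_def)
  from mixture_KLnn[OF kernel target \<eta>] obtain s I wt where s: "0 < s" and I: "finite I"
    and wt: "\<forall>u\<in>I. 0 \<le> wt u" "sum wt I = 1" and mix: "KLnn \<nu> (\<lambda>x. \<Sum>u\<in>I. wt u * N s (x - u)) < ennreal \<eta>"
    by (elim exE conjE)
  \<comment> \<open>Dilation by \<open>s\<close> moves the mean \<open>m\<close> to
    \<open>z\<close>. Directions are measured from \<open>z\<close>, so that at time 1 the centres
    are the points of \<open>I\<close>.\<close>
  define z where "z = s *\<^sub>R m"
  define I' where "I' = (\<lambda>u. u - z) ` I"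
  define wt' where "wt' u = wt (u + z)" for u
  define Q' where "Q' x = (1 / s\<^sup>2) *\<^sub>R Q x" for x
  define K' where "K' = K * (1 / s) ^ CARD('n)"
  have N_eq: "N s x = K' * exp (- (x \<bullet> Q' x) / 2)" for x
    by (simp add: N_def K'_def Q'_def Q_simps power2_eq_square)
  have sum': "(\<Sum>u\<in>I'. wt' u * h u) = (\<Sum>u\<in>I. wt u * h (u - z))" for h
    unfolding I'_def wt'_def by (subst sum.reindex) (auto simp: inj_on_def)
  have sum1: "sum wt' I' = 1" using sum'[of "\<lambda>_. 1"] wt(2) by simp
  interpret path: gaussian_path Q' K' "c / s\<^sup>2" z I' wt'
  proof (rule gaussian_path.intro)
    show "linear Q'" unfolding Q'_def using linear_compose_scale_right[OF linQ] by simp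
    show "x \<bullet> Q' y = y \<bullet> Q' x" for x y unfolding Q'_def using symQ[of x y] by simp
    show "0 < c / s\<^sup>2" using c s by simp
    show "c / s\<^sup>2 * (norm x)\<^sup>2 \<le> x \<bullet> Q' x" for x
      using divide_right_mono[OF posQ[of x], of "s\<^sup>2"] by (simp add: Q'_def)
    show "0 < K'" using K s by (simp add: K'_def)
    show "(\<integral>\<^sup>+x. ennreal (K' * exp (- (x \<bullet> Q' x) / 2)) \<partial>lborel) = 1"
      using nn_integral_N[OF s, of 0] by (simp add: N_eq)
    show "finite I'" using I by (simp add: I'_def)
    show "0 \<le> wt' u" if "u \<in> I'" for u using wt(1) that by (auto simp: wt'_def I'_def)
    show "sum wt' I' = 1" by (rule sum1)
  qed
  have \<rho>: "path.\<rho> t x = (\<Sum>u\<in>I'. wt' u * N s (x - z - t *\<^sub>R u))" for t x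
    unfolding path.\<rho>_eq N_eq ..
  have \<rho>1: "path.\<rho> 1 = (\<lambda>x. \<Sum>u\<in>I. wt u * N s (x - u))"
    by (rule ext) (simp add: \<rho> sum')
  have \<rho>0: "path.\<rho> 0 x = N s (x - z)" for x
    by (simp add: \<rho> sum_distrib_right[symmetric] sum1)
  from path.transport_KLnn[OF \<eta> \<nu>m \<nu>0] obtain \<Psi> J where pl: "pl \<Psi> J"
    and "KLnn \<nu> (push \<Psi> J (path.\<rho> 0)) + ennreal \<eta> \<le> ennreal (exp 1) * (KLnn \<nu> (path.\<rho> 1) + ennreal \<eta>)"
    by (elim exE conjE)
  note this(2)
  also have "\<dots> \<le> ennreal (exp 1) * (ennreal \<eta> + ennreal \<eta>)"
    unfolding \<rho>1 using mix by (intro mult_left_mono add_right_mono) auto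
  also have "\<dots> = ennreal (exp 1 * (\<eta> + \<eta>))"
    using \<eta> by (simp only: ennreal_plus[symmetric] less_imp_le ennreal_mult'[symmetric] exp_ge_zero)
  also have "\<dots> = ennreal \<epsilon>" by (simp add: \<eta>_def)
  finally have le: "KLnn \<nu> (push \<Psi> J (path.\<rho> 0)) + ennreal \<eta> \<le> ennreal \<epsilon>" .
  have "KLnn \<nu> (push \<Psi> J (path.\<rho> 0)) \<le> KLnn \<nu> (push \<Psi> J (path.\<rho> 0)) + ennreal \<eta>" by simp
  from order_trans[OF this le] have le: "KLnn \<nu> (push \<Psi> J (path.\<rho> 0)) \<le> ennreal \<epsilon>" .
  have "0 < 1 / s" using s by simp
  from pl_scale[OF this] obtain Js where pls: "pl (\<lambda>x::real^'n. (1 / s) *\<^sub>R x) Js"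
    and Js: "AE x in lborel. Js x = (1 / s) ^ CARD('n)" by (elim exE conjE)
  define \<gamma>s where "\<gamma>s = push (\<lambda>x. (1 / s) *\<^sub>R x) Js \<gamma>"
  have \<gamma>sm: "\<gamma>s \<in> borel_measurable borel" unfolding \<gamma>s_def by (rule push_measurable[OF pls \<gamma>m])
  have "(1 / s) *\<^sub>R (x - z) = (1 / s) *\<^sub>R x - m" for x using s by (simp add: z_def scaleR_diff_right)
  then have \<gamma>N: "\<gamma> ((1 / s) *\<^sub>R x) * (1 / s) ^ CARD('n) = path.\<rho> 0 x" for x
    unfolding \<rho>0 N_def \<gamma>_def by simp
  have AE: "AE x in lborel. \<gamma>s x = path.\<rho> 0 x"
    using Js unfolding \<gamma>s_def push_def by eventually_elim (simp only: \<gamma>N)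
  obtain \<Phi> where \<Phi>: "\<Phi> \<in> borel_measurable borel" "\<And>x. \<Phi> (\<Psi> x) = x" "\<And>x. \<Psi> (\<Phi> x) = x"
    by (rule pl_inverse[OF pl]) (rule that)
  \<comment> \<open>The dilated Gaussian agrees with the start of the path only almost everywhere.
    \<open>KLnn_push\<close> moves \<open>\<Psi>\<close> to the target, where this is enough, and
    back again.\<close>
  have "KLnn \<nu> (push \<Psi> J \<gamma>s) = KLnn (\<lambda>y. \<nu> (\<Phi> y) / J (\<Phi> y)) \<gamma>s"
    by (rule KLnn_push[OF pl \<nu>m \<gamma>sm \<Phi>(1,2)])
  also have "\<dots> = KLnn (\<lambda>y. \<nu> (\<Phi> y) / J (\<Phi> y)) (path.\<rho> 0)" by (rule KLnn_cong_AE[OF AE])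
  also have "\<dots> = KLnn \<nu> (push \<Psi> J (path.\<rho> 0))"
    by (rule KLnn_push[OF pl \<nu>m path.\<rho>_measurable \<Phi>(1,2), symmetric])
  finally have "KLnn \<nu> (push \<Psi> J \<gamma>s) \<le> ennreal \<epsilon>" using le by simp
  moreover have "push \<Psi> J \<gamma>s = push (\<lambda>x. (1 / s) *\<^sub>R \<Psi> x) (\<lambda>x. Js (\<Psi> x) * J x) \<gamma>"
    by (rule ext) (simp only: push_def \<gamma>s_def mult.assoc)
  ultimately have "pl (\<lambda>x. (1 / s) *\<^sub>R \<Psi> x) (\<lambda>x. Js (\<Psi> x) * J x) \<and>
      KLnn \<nu> (push (\<lambda>x. (1 / s) *\<^sub>R \<Psi> x) (\<lambda>x. Js (\<Psi> x) * J x) \<gamma>) \<le> ennreal \<epsilon>"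
    using pl_comp[OF pl pls] by (simp only: simp_thms)
  then show ?thesis unfolding \<gamma>_def[abs_def] by (intro exI)
qed

text \<open>The tail bound enters through the second moment, and integrability of
  \<open>\<rho>\<^sub>s x * ln (\<rho>\<^sub>s x)\<close> through the finite constant
  \<open>total_gain\<close>; together they make the target a \<open>KL_target\<close>.\<close>

theorem theorem1p1:
  fixes m\<^sub>B :: "real^'n" and \<Sigma>\<^sub>B :: "real^'n^'n"
    and \<rho>\<^sub>s :: "real^'n \<Rightarrow> real" and M \<sigma> T \<epsilon> :: real
  assumes "transpose \<Sigma>\<^sub>B = \<Sigma>\<^sub>B"
    and "\<And>x. x \<noteq> 0 \<Longrightarrow> 0 < x \<bullet> (\<Sigma>\<^sub>B *v x)"
    and "probability_density \<rho>\<^sub>s"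
    and "integrable lborel (\<lambda>x. \<rho>\<^sub>s x * ln (\<rho>\<^sub>s x))"
    and "0 < M" and "0 < \<sigma>"
    and "\<And>x. M \<le> norm x \<Longrightarrow>
           \<rho>\<^sub>s x \<le> 1 / (2 * pi * \<sigma>\<^sup>2) powr (real CARD('n) / 2) * exp (- (norm x)\<^sup>2 / (2 * \<sigma>\<^sup>2))"
    and "0 < T" and "0 < \<epsilon>"
  shows "\<exists>(w :: real \<Rightarrow> real^'n) (a :: real \<Rightarrow> real^'n) (b :: real \<Rightarrow> real)
           (\<rho> :: real \<Rightarrow> real^'n \<Rightarrow> real).
           piecewise_constant_finite_switches T (\<lambda>t. (w t, a t, b t)) \<and>
           characteristics_solution T w a b (gaussian_density m\<^sub>B \<Sigma>\<^sub>B) \<rho> \<and>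
           (AE x in lborel. \<rho> T x = 0 \<longrightarrow> \<rho>\<^sub>s x = 0) \<and>
           integrable lborel (\<lambda>x. \<rho>\<^sub>s x * ln (\<rho>\<^sub>s x / \<rho> T x)) \<and>
           (\<integral>x. \<rho>\<^sub>s x * ln (\<rho>\<^sub>s x / \<rho> T x) \<partial>lborel) \<le> \<epsilon> \<and>
           KL_divergence (exp 1)
             (distr (density lborel (gaussian_density m\<^sub>B \<Sigma>\<^sub>B)) lborel (flow_map T w a b T))
             (density lborel \<rho>\<^sub>s) \<le> \<epsilon>"
proof -
  have \<nu>: "\<rho>\<^sub>s \<in> borel_measurable borel" "\<And>x. 0 \<le> \<rho>\<^sub>s x" "(\<integral>\<^sup>+x. ennreal (\<rho>\<^sub>s x) \<partial>lborel) = 1"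
    using assms(3) by (auto simp: probability_density_def)
  have "0 \<le> 1 / (2 * pi * \<sigma>\<^sup>2) powr (real CARD('n) / 2)" by simp
  from integrable_norm_square_gaussian_tail[OF \<nu> assms(6) this assms(7)]
  have target: "KL_target \<rho>\<^sub>s" using \<nu> assms(4) by (intro KL_target.intro)
  have "\<exists>K c. gaussian_kernel ((*v) (matrix_inv \<Sigma>\<^sub>B)) K c \<and>
      (\<forall>m x. gaussian_density m \<Sigma>\<^sub>B x = K * exp (- ((x - m) \<bullet> (matrix_inv \<Sigma>\<^sub>B *v (x - m))) / 2))"
    by (rule gaussian_density_kernel) (rule assms(1), rule assms(2))
  then obtain K c where
    kernel: "gaussian_kernel ((*v) (matrix_inv \<Sigma>\<^sub>B)) K c"
    and dens: "\<forall>m x. gaussian_density m \<Sigma>\<^sub>B x = K * exp (- ((x - m) \<bullet> (matrix_inv \<Sigma>\<^sub>B *v (x - m))) / 2)"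
    by (elim exE conjE)
  interpret gaussian_kernel "(*v) (matrix_inv \<Sigma>\<^sub>B)" K c by (rule kernel)
  define \<gamma> where "\<gamma> = gaussian_density m\<^sub>B \<Sigma>\<^sub>B"
  have \<gamma>: "\<gamma> = (\<lambda>x. K * exp (- ((x - m\<^sub>B) \<bullet> (matrix_inv \<Sigma>\<^sub>B *v (x - m\<^sub>B))) / 2))"
    unfolding \<gamma>_def using dens by (intro ext) simp
  have \<gamma>N: "\<gamma> = (\<lambda>x. N 1 (x - m\<^sub>B))" unfolding \<gamma> by (simp add: N_def)
  have \<gamma>pos: "0 < \<gamma> x" for x unfolding \<gamma>N by (rule N_pos) simp
  have \<gamma>m: "\<gamma> \<in> borel_measurable borel" unfolding \<gamma>N by measurable
  have \<gamma>prob: "probability_density \<gamma>"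
    unfolding probability_density_def
    using \<gamma>m \<gamma>pos nn_integral_N[of 1 m\<^sub>B] by (simp add: less_imp_le \<gamma>N)
  from gaussian_transport_KLnn[OF kernel target assms(9), of m\<^sub>B, folded \<gamma>]
  obtain \<Psi> J where pl: "pl \<Psi> J" and le: "KLnn \<rho>\<^sub>s (push \<Psi> J \<gamma>) \<le> ennreal \<epsilon>" by (elim exE conjE)
  from pl_characteristics_solution[OF pl assms(8) \<gamma>prob]
  obtain w a b \<rho> where pc: "piecewise_constant_finite_switches T (\<lambda>t. (w t, a t, b t))"
    and sol: "characteristics_solution T w a b \<gamma> \<rho>" and \<rho>T: "\<rho> T = push \<Psi> J \<gamma>" by (elim exE conjE)
  \<comment> \<open>As division by 0 gives 0, a zero of \<open>\<rho> T\<close> where the target is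
    positive would be invisible in the integral; here the density is positive everywhere.\<close>
  have pos: "0 < \<rho> T x" for x unfolding \<rho>T by (rule push_pos[where \<rho> = \<gamma>, OF pl \<gamma>pos])
  have "probability_density (\<rho> T)" unfolding \<rho>T by (rule probability_density_push[OF pl \<gamma>prob])
  then have \<rho>Tm: "\<rho> T \<in> borel_measurable borel" and \<rho>T1: "(\<integral>\<^sup>+x. ennreal (\<rho> T x) \<partial>lborel) = 1"
    by (auto simp: probability_density_def)
  have ac: "AE x in lborel. \<rho> T x = 0 \<longrightarrow> \<rho>\<^sub>s x = 0"
    using pos by (intro AE_I2) (simp add: less_imp_neq[THEN not_sym])
  note KL = integrable_KL_of_KLnn[where \<rho> = "\<rho> T", OF \<nu>(1) \<rho>Tm \<nu>(2,3) pos \<rho>T1 le[folded \<rho>T] less_imp_le[OF assms(9)]]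
  have "T \<in> {0..T}" using assms(8) by simp
  then have distr: "distr (density lborel \<gamma>) lborel (flow_map T w a b T) = density lborel (\<rho> T)"
    using sol unfolding characteristics_solution_def by blast
  \<comment> \<open>In \<open>KL_divergence\<close> the reference measure is the first of the two
    measures, and the base \<open>exp 1\<close> makes the logarithm natural.\<close>
  have "KL_divergence (exp 1) (density lborel (\<rho> T)) (density lborel \<rho>\<^sub>s)
      = (\<integral>x. \<rho>\<^sub>s x * log (exp 1) (\<rho>\<^sub>s x / \<rho> T x) \<partial>lborel)"
    using \<nu> \<rho>Tm pos by (intro lborel.KL_density_density ac) (auto simp: less_imp_le)
  also have "\<dots> \<le> \<epsilon>" using KL(2) by (simp add: log_def)
  finally have "KL_divergence (exp 1) (distr (density lborel \<gamma>) lborel (flow_map T w a b T)) (density lborel \<rho>\<^sub>s) \<le> \<epsilon>"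
    unfolding distr .
  with pc sol ac KL show ?thesis unfolding \<gamma>_def by (intro exI conjI)
qed

end
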